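(* Let $K$ be a finite field, let $P$ be a polynomial generic representation over $K$, and for every $i\in\mathbb{N}$ let $V_i$ be a finite-dimensional $K$-vector space and $T_i\in P(V_i)$. Then there exist $i<j$ and a linear map $\phi:V_j\to V_i$ such that $T_i=P(\phi)T_j$.
   Context: Let $\mathbf{Vec}$ be the category of finite-dimensional vector spaces over the finite field $K$. A generic representation is a functor $F:\mathbf{Vec}\to\mathbf{Vec}$ (no additivity or linearity on morphisms is required). Generic representations form an abelian category whose morphisms are natural transformations. Let $T^d$ denote the functor $V\mapsto V^{\otimes d}$, $\phi\mapsto\phi^{\otimes d}$. A generic representation $F$ is called polynomial if it satisfies any of the following properties, known to be equivalent: (a) $F$ has a finite composition series in the category of generic representations; (b) the function $n\mapsto\dim F(K^n)$ is bounded above by a polynomial in $n$; (c) $F$ is a subquotient of a finite direct sum $T^{d_1}\oplus\cdots\oplus T^{d_n}$ with $d_1,\ldots,d_n\in\mathbb{Z}_{\ge0}$. *)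

theory Defs
  imports
    "Jordan_Normal_Form.Missing_VectorSpace"
    "HOL-Computational_Algebra.Polynomial"
begin

text \<open>
  The category of finite-dimensional \<open>K\<close>-vector spaces, with carriers ranging over the subsets
  of a universe type \<open>'v\<close>. A finite-dimensional space over a finite field is a finite set, so as
  soon as \<open>'v\<close> is infinite every such space has an isomorphic copy with carrier in \<open>'v\<close>.
  A record of type \<open>('k, 'v) module\<close> also has the fields \<^const>\<open>mult\<close> and \<^const>\<open>one\<close>, which
  carry no meaning for a module; spaces differing only there are isomorphic via the identity.
\<close>

definition vec_obj :: "('k, 'm) ring_scheme \<Rightarrow> ('k, 'v) module \<Rightarrow> bool" where
  "vec_obj K V \<longleftrightarrow> vectorspace K V \<and> vectorspace.fin_dim K V"

text \<open>Morphisms are extensional, so that equality of morphisms is equality of functions.\<close>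

definition vec_hom ::
  "('k, 'm) ring_scheme \<Rightarrow> ('k, 'v) module \<Rightarrow> ('k, 'w) module \<Rightarrow> ('v \<Rightarrow> 'w) set" where
  "vec_hom K V W = {f \<in> extensional (carrier V). linear_map K V W f}"

definition vec_isomorphic ::
  "('k, 'm) ring_scheme \<Rightarrow> ('k, 'v) module \<Rightarrow> ('k, 'w) module \<Rightarrow> bool" where
  "vec_isomorphic K V W \<longleftrightarrow> (\<exists>f\<in>vec_hom K V W. bij_betw f (carrier V) (carrier W))"

text \<open>
  Functors from finite-dimensional spaces to finite-dimensional spaces over a finite field.
  Neither additivity nor linearity on morphisms is required. The universe \<open>'w\<close> of the values may
  differ from \<open>'v\<close>. Since a function does not determine its domain and codomain as spaces, the
  action on morphisms \<open>F\<^sub>m V W f\<close> takes them as arguments.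
\<close>

locale generic_representation = field K
  for K :: "('k, 'm) ring_scheme" +
  fixes F\<^sub>o :: "('k, 'v) module \<Rightarrow> ('k, 'w) module"
    and F\<^sub>m :: "('k, 'v) module \<Rightarrow> ('k, 'v) module \<Rightarrow> ('v \<Rightarrow> 'v) \<Rightarrow> 'w \<Rightarrow> 'w"
  assumes finite_field: "finite (carrier K)"
    and map_obj: "vec_obj K V \<Longrightarrow> vec_obj K (F\<^sub>o V)"
    and map_hom: "\<lbrakk>vec_obj K V; vec_obj K W; f \<in> vec_hom K V W\<rbrakk>
      \<Longrightarrow> F\<^sub>m V W f \<in> vec_hom K (F\<^sub>o V) (F\<^sub>o W)"
    and map_id: "vec_obj K V \<Longrightarrow>
      F\<^sub>m V V (restrict id (carrier V)) = restrict id (carrier (F\<^sub>o V))"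
    and map_comp: "\<lbrakk>vec_obj K U; vec_obj K V; vec_obj K W;
        f \<in> vec_hom K U V; g \<in> vec_hom K V W\<rbrakk> \<Longrightarrow>
      F\<^sub>m U W (compose (carrier U) g f) = compose (carrier (F\<^sub>o U)) (F\<^sub>m V W g) (F\<^sub>m U V f)"

text \<open>
  Of the equivalent definitions of a polynomial generic representation we take the growth
  condition: \<open>n \<mapsto> dim F(K\<^sup>n)\<close> is bounded above by a polynomial. Here \<open>K\<^sup>n\<close> is the
  space \<open>func_space {..<n}\<close> of functions from \<open>{..<n}\<close> to \<open>K\<close>; since its elements have type
  \<^typ>\<open>nat \<Rightarrow> 'k\<close>, the functor is evaluated at the copies of it in the universe \<open>'v\<close>
  (functors preserve isomorphisms, so the dimension does not depend on the copy).
\<close>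

locale polynomial_generic_representation = generic_representation K F\<^sub>o F\<^sub>m
  for K :: "('k, 'm) ring_scheme"
    and F\<^sub>o :: "('k, 'v) module \<Rightarrow> ('k, 'w) module"
    and F\<^sub>m :: "('k, 'v) module \<Rightarrow> ('k, 'v) module \<Rightarrow> ('v \<Rightarrow> 'v) \<Rightarrow> 'w \<Rightarrow> 'w" +
  assumes polynomial_growth:
    "\<exists>p :: real poly. \<forall>n V. vec_obj K V \<and> vec_isomorphic K (func_space {..<n}) V \<longrightarrow>
       real (vectorspace.dim K (F\<^sub>o V)) \<le> poly p (real n)"

end

theory Submission
  imports Defs "HOL-Library.Poly_Mapping" "HOL-Library.Function_Algebras"
    "HOL-Number_Theory.Residues" "HOL-Algebra.Free_Abelian_Groups"
begin

text \<open>
  Only the action of integer matrices and the additive structure matter, so the functor is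
  encoded as a single abelian group acted on by column-finite integer matrices. Polynomial
  growth means that, for some \<open>D\<close>, an element which is concentrated on \<open>D\<close> or more coordinates and
  killed by setting any of these to zero vanishes.

  By a noetherian induction on subfunctors it suffices to pass from \<open>B'\<close> to \<open>B\<close> when \<open>B'/B\<close> is
  simple. Adding the elements of \<open>B'\<close> living on fresh coordinates to \<open>B\<close> gives functors modulo
  which well-quasi-ordering is already known. Given a closed set \<open>Y\<close> and a proper closed subset
  \<open>X\<close>, take a polynomial function \<open>h\<close> modulo \<open>p\<close> of least degree vanishing on \<open>X\<close> but not on \<open>Y\<close>
  and pure on as many coordinates as possible. Maximality makes \<open>h\<close> additive under folding a
  coordinate into another one. Hence a shift of \<open>h\<close> by an element of \<open>B'\<close> has smaller degree,
  and, by simplicity, where this shift does not vanish an element of the group already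
  determines its \<open>B'\<close>-component modulo \<open>B\<close>; where it vanishes, induction on the degree applies.
\<close>

section \<open>Column-finite integer matrices\<close>

text \<open>Every object carries a finite set \<open>W\<close> of frozen coordinates. The matrices
  in \<open>End W\<close> fix them and do not mix them with the others, so passing from
  \<open>End {}\<close> to \<open>End W\<close> replaces a functor \<open>P\<close> by its shift,
  sending \<open>Z\<close> to \<open>P(K^W + Z)\<close>. Adding to \<open>B\<close> the elements of
  \<open>B'\<close> that avoid newly frozen coordinates lowers the degree of \<open>B'\<close>
  modulo \<open>B\<close>, but the result is guaranteed to be stable only under the smaller monoid.
  Hence statements quantify over all larger frozen sets, and the outer induction is on the degree.

  The obstacle is lifting a comparison modulo such an extension: it leaves an uncontrolled error
  \<open>\<rho>\<close> from \<open>B'\<close>. Both \<open>T i\<close> and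
  \<open>T i + \<rho>\<close> lie in the set \<open>X\<close> where \<open>h\<close> vanishes, which
  excludes errors that \<open>h\<close> can see; by simplicity, once \<open>h\<close> sees one
  element of \<open>B'\<close>, it sees all those outside \<open>B\<close>. A matrix that makes a
  shift visible may destroy information, so it is applied together with a copy of its argument on
  distant coordinates.

  Integers act through the prime field. Subgroups thus replace subspaces, and characters modulo
  \<open>p\<close> replace linear forms over \<open>K\<close>.\<close>

type_synonym cmat = "nat \<Rightarrow> nat \<Rightarrow>\<^sub>0 int"

text \<open>The matrix \<open>g\<close> is given by its columns: \<open>g i\<close> is the image of the \<open>i\<close>-th basis vector.\<close>

definition cmul :: "cmat \<Rightarrow> cmat \<Rightarrow> cmat" (infixr "\<bullet>" 75)
  where "g \<bullet> h = (\<lambda>i. frag_extend g (h i))"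

definition pr :: "nat set \<Rightarrow> cmat"
  where "pr F i = (if i \<in> F then frag_of i else 0)"

abbreviation kill :: "nat \<Rightarrow> cmat"
  where "kill i \<equiv> pr (- {i})"

definition Hom :: "nat set \<Rightarrow> nat set \<Rightarrow> cmat set"
  where "Hom W V = {g. (\<forall>i\<in>W. g i = frag_of i) \<and> (\<forall>i. i \<notin> W \<longrightarrow> Poly_Mapping.keys (g i) \<inter> V = {})}"

abbreviation End :: "nat set \<Rightarrow> cmat set"
  where "End W \<equiv> Hom W W"

lemma frag_extend_cmul_comp: "frag_extend g (frag_extend h v) = frag_extend (g \<bullet> h) v"
proof -
  have "frag_extend g (frag_extend h v)
      = (\<Sum>i\<in>Poly_Mapping.keys v. frag_extend g (frag_cmul (Poly_Mapping.lookup v i) (h i)))"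
    by (simp add: frag_extend_def[of h] frag_extend_sum)
  then show ?thesis
    unfolding frag_extend_def[of "g \<bullet> h"] by (simp add: frag_extend_cmul cmul_def)
qed

lemma cmul_assoc: "(g \<bullet> h) \<bullet> k = g \<bullet> h \<bullet> k"
  by (simp add: cmul_def[of _ k] frag_extend_cmul_comp cmul_def[of g "\<lambda>i. frag_extend h (k i)"])

lemma cmul_frag_of [simp]: "g \<bullet> frag_of = g"
  by (simp add: cmul_def)

lemma frag_of_cmul [simp]: "frag_of \<bullet> g = g"
  by (simp add: cmul_def frag_expansion[symmetric])

lemma cmul_apply_frag_of: "h i = frag_of j \<Longrightarrow> (g \<bullet> h) i = g j"
  by (simp add: cmul_def)

lemma cmul_pr: "(g \<bullet> pr F) i = (if i \<in> F then g i else 0)"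
  by (simp add: cmul_def pr_def)

lemma pr_pr [simp]: "pr F \<bullet> pr G = pr (F \<inter> G)"
  by (auto simp: cmul_pr pr_def fun_eq_iff)

lemma frag_extend_pr_id:
  assumes "Poly_Mapping.keys v \<subseteq> F" shows "frag_extend (pr F) v = v"
proof -
  have "frag_extend (pr F) v = frag_extend frag_of v"
    using assms by (intro frag_extend_eq) (auto simp: pr_def)
  then show ?thesis
    using frag_expansion by metis
qed

lemma frag_extend_pr_0:
  assumes "Poly_Mapping.keys v \<inter> F = {}" shows "frag_extend (pr F) v = 0"
  using assms by (intro frag_extend_eq_0) (auto simp: pr_def)

lemma keys_frag_extend_pr: "Poly_Mapping.keys (frag_extend (pr F) v) \<subseteq> Poly_Mapping.keys v \<inter> F"
  using keys_frag_extend[of "pr F" v] by (auto simp: pr_def split: if_splits; fastforce)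

lemma pr_cmul_id:
  assumes "\<And>i. Poly_Mapping.keys (g i) \<subseteq> F" shows "pr F \<bullet> g = g"
  using assms by (simp add: cmul_def frag_extend_pr_id)

lemma keys_pr_cmul: "Poly_Mapping.keys ((pr F \<bullet> g) i) \<subseteq> Poly_Mapping.keys (g i) \<inter> F"
  unfolding cmul_def by (rule keys_frag_extend_pr)

lemma Hom_D1: "g \<in> Hom W V \<Longrightarrow> i \<in> W \<Longrightarrow> g i = frag_of i"
  by (simp add: Hom_def)

lemma Hom_D2: "g \<in> Hom W V \<Longrightarrow> i \<notin> W \<Longrightarrow> Poly_Mapping.keys (g i) \<inter> V = {}"
  by (simp add: Hom_def)

lemma keys_frag_extend_disjoint:
  assumes "\<And>j. j \<in> Poly_Mapping.keys v \<Longrightarrow> Poly_Mapping.keys (g j) \<inter> V = {}"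
  shows "Poly_Mapping.keys (frag_extend g v) \<inter> V = {}"
  using keys_frag_extend[of g v] assms by blast

lemma Hom_cmul:
  assumes g: "g \<in> Hom V U" and h: "h \<in> Hom W V" and WV: "W \<subseteq> V"
  shows "g \<bullet> h \<in> Hom W U"
proof -
  have "Poly_Mapping.keys ((g \<bullet> h) i) \<inter> U = {}" if "i \<notin> W" for i
    unfolding cmul_def
  proof (rule keys_frag_extend_disjoint)
    fix j assume "j \<in> Poly_Mapping.keys (h i)"
    then have "j \<notin> V" using Hom_D2[OF h that] by auto
    then show "Poly_Mapping.keys (g j) \<inter> U = {}" using Hom_D2[OF g] by auto
  qed
  moreover have "(g \<bullet> h) i = frag_of i" if "i \<in> W" for i
    using Hom_D1[OF h that] Hom_D1[OF g] WV that by (auto simp: cmul_apply_frag_of)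
  ultimately show ?thesis by (auto simp: Hom_def)
qed

lemma Hom_cmul_End: "g \<in> Hom W V \<Longrightarrow> h \<in> End W \<Longrightarrow> g \<bullet> h \<in> Hom W V"
  by (rule Hom_cmul) auto

lemma End_cmul: "g \<in> End W \<Longrightarrow> h \<in> End W \<Longrightarrow> g \<bullet> h \<in> End W"
  by (rule Hom_cmul) auto

lemma frag_of_End [simp]: "frag_of \<in> End W"
  by (auto simp: Hom_def)

lemma pr_Hom: "W \<subseteq> F \<Longrightarrow> F \<inter> V \<subseteq> W \<Longrightarrow> pr F \<in> Hom W V"
  by (auto simp: Hom_def pr_def)

lemma pr_End: "W \<subseteq> F \<Longrightarrow> pr F \<in> End W"
  by (rule pr_Hom) auto

lemma Hom_mono: "W \<subseteq> W' \<Longrightarrow> End W' \<subseteq> End W"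
proof
  fix g assume W: "W \<subseteq> W'" and g: "g \<in> End W'"
  have "Poly_Mapping.keys (g i) \<inter> W = {}" if "i \<notin> W" for i
  proof (cases "i \<in> W'")
    case True then show ?thesis using Hom_D1[OF g True] that by simp
  next
    case False then show ?thesis using Hom_D2[OF g False] W by blast
  qed
  then show "g \<in> End W"
    using W Hom_D1[OF g] by (auto simp: Hom_def)
qed

lemma pr_cmul_End:
  assumes "g \<in> End W" shows "pr W \<bullet> g = pr W"
proof
  fix i show "(pr W \<bullet> g) i = pr W i"
  proof (cases "i \<in> W")
    case True then show ?thesis using Hom_D1[OF assms True] by (simp add: cmul_apply_frag_of)
  next
    case False then show ?thesis
      using Hom_D2[OF assms False] by (simp add: cmul_def frag_extend_pr_0 pr_def)
  qed
qed

lemma End_cmul_pr: "g \<in> End W \<Longrightarrow> g \<bullet> pr W = pr W"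
  using Hom_D1 by (fastforce simp: cmul_pr pr_def)

section \<open>Polynomial functors as groups with an action\<close>

definition sgrp :: "'a::ab_group_add set \<Rightarrow> bool"
  where "sgrp H \<longleftrightarrow> 0 \<in> H \<and> (\<forall>x\<in>H. \<forall>y\<in>H. x - y \<in> H)"

lemma sgrp_0: "sgrp H \<Longrightarrow> 0 \<in> H"
  by (simp add: sgrp_def)

lemma sgrp_diff: "sgrp H \<Longrightarrow> x \<in> H \<Longrightarrow> y \<in> H \<Longrightarrow> x - y \<in> H"
  by (simp add: sgrp_def)

lemma sgrp_minus: "sgrp H \<Longrightarrow> x \<in> H \<Longrightarrow> - x \<in> H"
  using sgrp_diff[of H 0 x] sgrp_0[of H] by simp

lemma sgrp_add: "sgrp H \<Longrightarrow> x \<in> H \<Longrightarrow> y \<in> H \<Longrightarrow> x + y \<in> H"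
  using sgrp_diff[of H x "- y"] sgrp_minus[of H y] by simp

lemma sgrp_diff_commute: "sgrp H \<Longrightarrow> x - y \<in> H \<Longrightarrow> y - x \<in> H"
  using sgrp_minus[of H "x - y"] by simp

lemma sgrp_cong_mem: "sgrp H \<Longrightarrow> x - y \<in> H \<Longrightarrow> y \<in> H \<Longrightarrow> x \<in> H"
  using sgrp_add[of H "x - y" y] by simp

definition nmul :: "nat \<Rightarrow> 'a::ab_group_add \<Rightarrow> 'a"
  where "nmul n x = ((+) x ^^ n) 0"

lemma nmul_0 [simp]: "nmul 0 x = 0" by (simp add: nmul_def)
lemma nmul_Suc [simp]: "nmul (Suc n) x = x + nmul n x" by (simp add: nmul_def)
lemma nmul_add: "nmul (m + n) x = nmul m x + nmul n x" by (induct m) (simp_all add: add.assoc)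
lemma nmul_plus: "nmul n (x + y) = nmul n x + nmul n y" by (induct n) (simp_all add: algebra_simps)
lemma nmul_mult: "nmul (m * n) x = nmul m (nmul n x)" by (induct m) (simp_all add: nmul_add)
lemma sgrp_nmul: "sgrp H \<Longrightarrow> x \<in> H \<Longrightarrow> nmul n x \<in> H"
  by (induct n) (auto intro: sgrp_0 sgrp_add)

lemma nmul_cong_mod:
  assumes H: "sgrp H" and p: "nmul p x \<in> H" and eq: "[m = n] (mod p)"
  shows "nmul m x - nmul n x \<in> H"
proof -
  have *: "nmul (n + p * k) x - nmul n x \<in> H" for k n
    using sgrp_nmul[OF H p, of k] by (simp add: nmul_add mult.commute[of p] nmul_mult)
  have **: "nmul m x - nmul (m mod p) x \<in> H" for m
    using *[of "m mod p" "m div p"] by simp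
  have "(nmul m x - nmul (m mod p) x) - (nmul n x - nmul (n mod p) x) \<in> H"
    by (intro sgrp_diff[OF H] **)
  then show ?thesis using eq by (simp add: cong_def)
qed

text \<open>Maximal subgroups avoiding \<open>y\<close> provide characters modulo \<open>p\<close> which separate points.\<close>

lemma separating_character:
  fixes A B :: "'a::ab_group_add set"
  assumes A: "sgrp A" and B: "sgrp B" and BA: "B \<subseteq> A" and p: "prime (p::nat)"
    and tor: "\<And>x. x \<in> A \<Longrightarrow> nmul p x \<in> B" and y: "y \<in> A" "y \<notin> B"
  obtains \<chi> :: "'a \<Rightarrow> int" where
    "\<And>x x'. x \<in> A \<Longrightarrow> x' \<in> A \<Longrightarrow> [\<chi> (x + x') = \<chi> x + \<chi> x'] (mod int p)"
    "\<And>b. b \<in> B \<Longrightarrow> [\<chi> b = 0] (mod int p)" "\<not> [\<chi> y = 0] (mod int p)"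
proof -
  define Q where "Q = {H. sgrp H \<and> B \<subseteq> H \<and> H \<subseteq> A \<and> y \<notin> H}"
  have "\<exists>M\<in>Q. \<forall>X\<in>Q. M \<subseteq> X \<longrightarrow> X = M"
  proof (rule subset_Zorn_nonempty)
    show "Q \<noteq> {}" using assms by (auto simp: Q_def)
    fix C assume C: "C \<noteq> {}" "subset.chain Q C"
    have "sgrp (\<Union>C)"
      unfolding sgrp_def
    proof (intro conjI ballI)
      show "0 \<in> \<Union>C" using C by (auto simp: subset_chain_def Q_def sgrp_def)
      fix x x' assume "x \<in> \<Union>C" "x' \<in> \<Union>C"
      then obtain X X' where X: "x \<in> X" "X \<in> C" "x' \<in> X'" "X' \<in> C" by auto
      then have "X \<subseteq> X' \<or> X' \<subseteq> X" using C by (auto simp: subset_chain_def)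
      then obtain Z where "Z \<in> C" "x \<in> Z" "x' \<in> Z" using X by blast
      then have "x - x' \<in> Z" using C by (auto simp: subset_chain_def Q_def sgrp_def)
      then show "x - x' \<in> \<Union>C" using \<open>Z \<in> C\<close> by blast
    qed
    then show "\<Union>C \<in> Q"
      using C by (auto simp: Q_def subset_chain_def)
  qed
  then obtain H where "H \<in> Q" and max: "\<And>X. X \<in> Q \<Longrightarrow> H \<subseteq> X \<Longrightarrow> X = H" by blast
  then have H: "sgrp H" "B \<subseteq> H" "H \<subseteq> A" "y \<notin> H" by (auto simp: Q_def)
  have torH: "nmul p x \<in> H" if "x \<in> A" for x using tor[OF that] H by auto
  \<comment> \<open>Maximality forces \<open>y = h + k x\<close> with \<open>h\<close> in
    \<open>H\<close>. Here \<open>p\<close> cannot divide \<open>k\<close>, and inverting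
    \<open>k\<close> modulo \<open>p\<close> expresses \<open>x\<close> as a multiple of
    \<open>y\<close> modulo \<open>H\<close>. So \<open>A/H\<close> is cyclic of order
    \<open>p\<close>, generated by \<open>y\<close>.\<close>
  have ex: "\<exists>c. x - nmul c y \<in> H" if x: "x \<in> A" for x
  proof (cases "x \<in> H")
    case True then show ?thesis by (intro exI[of _ 0]) simp
  next
    case False
    define H' where "H' = {h + nmul k x | h k. h \<in> H}"
    have "sgrp H'"
      unfolding sgrp_def
    proof (intro conjI ballI)
      show "0 \<in> H'" unfolding H'_def using sgrp_0[OF H(1)] by (intro CollectI exI[of _ 0]) auto
      fix u v assume "u \<in> H'" "v \<in> H'"
      then obtain h k h' k' where uv: "u = h + nmul k x" "v = h' + nmul k' x" "h \<in> H" "h' \<in> H"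
        by (auto simp: H'_def)
      \<comment> \<open>Only natural multiples are available, so \<open>- k' x\<close> is traded for
        \<open>(p - 1) k' x\<close>, at the cost of \<open>p k' x\<close>, which lies in
        \<open>H\<close>.\<close>
      have e: "nmul (p * k') x = nmul ((p - 1) * k') x + nmul k' x"
      proof -
        have "p * k' = (p - 1) * k' + k'"
          using prime_gt_0_nat[OF p] by (cases p) (auto simp: algebra_simps)
        then show ?thesis by (simp only: nmul_add)
      qed
      have "nmul (p * k') x \<in> H"
        using sgrp_nmul[OF H(1) torH[OF x], of k'] by (simp add: mult.commute[of p] nmul_mult)
      then have "h - h' - nmul (p * k') x \<in> H"
        using uv H(1) by (intro sgrp_diff) auto
      moreover have "u - v = (h - h' - nmul (p * k') x) + nmul (k + (p - 1) * k') x"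
        using e uv by (simp add: nmul_add algebra_simps)
      ultimately show "u - v \<in> H'" unfolding H'_def by blast
    qed
    moreover have HH': "H \<subseteq> H'"
    proof
      fix h assume "h \<in> H"
      then have "h = h + nmul 0 x \<and> h \<in> H" by simp
      then show "h \<in> H'" unfolding H'_def by blast
    qed
    moreover have "x \<in> H'"
      unfolding H'_def using sgrp_0[OF H(1)] by (auto intro!: exI[of _ "0::'a"] exI[of _ "Suc 0"])
    moreover have "H' \<subseteq> A"
      unfolding H'_def using H x A by (auto intro!: sgrp_add sgrp_nmul)
    ultimately have "H' \<notin> Q" using max[of H'] False by auto
    then have "y \<in> H'" using \<open>sgrp H'\<close> HH' \<open>H' \<subseteq> A\<close> H by (auto simp: Q_def)
    then obtain h k where hk: "h \<in> H" "y = h + nmul k x" by (auto simp: H'_def)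
    have "\<not> p dvd k"
    proof
      assume "p dvd k"
      then obtain l where "k = l * p" by (auto simp: dvd_def mult.commute)
      then have "nmul k x \<in> H" using sgrp_nmul[OF H(1) torH[OF x], of l] by (simp add: nmul_mult)
      then show False using hk H sgrp_add by blast
    qed
    then have "coprime k p" using p by (metis coprime_commute prime_imp_coprime)
    then obtain l where l: "[k * l = 1] (mod p)" using cong_solve_coprime_nat by auto
    have "nmul (k * l) x - nmul 1 x \<in> H"
      by (rule nmul_cong_mod[OF H(1) torH[OF x] l])
    moreover have "nmul l y = nmul l h + nmul (k * l) x"
      using hk by (simp add: nmul_plus mult.commute[of k] nmul_mult)
    moreover have "nmul l h \<in> H" using sgrp_nmul H hk by blast
    ultimately have "- (nmul l h + (nmul (k * l) x - nmul 1 x)) \<in> H"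
      using H(1) sgrp_add sgrp_minus by blast
    then have "x - nmul l y \<in> H" using \<open>nmul l y = _\<close> by (simp add: algebra_simps)
    then show ?thesis by blast
  qed
  define c where "c x = (SOME c. x - nmul c y \<in> H)" for x
  have c: "x - nmul (c x) y \<in> H" if "x \<in> A" for x
    unfolding c_def using someI_ex[OF ex[OF that]] .
  have dvd: "p dvd k" if "nmul k y \<in> H" for k
  proof (rule ccontr)
    assume "\<not> p dvd k"
    then have "coprime k p" using p by (metis coprime_commute prime_imp_coprime)
    then obtain l where l: "[k * l = 1] (mod p)" using cong_solve_coprime_nat by auto
    have "nmul (k * l) y - nmul 1 y \<in> H"
      by (rule nmul_cong_mod[OF H(1) torH[OF y(1)] l])
    moreover have "nmul (k * l) y \<in> H"
      using sgrp_nmul[OF H(1) that, of l] by (simp add: mult.commute[of k] nmul_mult)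
    ultimately have "nmul 1 y \<in> H" using sgrp_diff[OF H(1)] by fastforce
    then show False using H by simp
  qed
  have uniq: "[a = b] (mod p)" if "x - nmul a y \<in> H" "x - nmul b y \<in> H" for a b x
  proof -
    have *: "nmul a y - nmul b y \<in> H"
      using sgrp_diff[OF H(1) that(2) that(1)] by simp
    show ?thesis
    proof (cases "b \<le> a")
      case True
      then have "nmul (a - b) y \<in> H" using * nmul_add[of "a - b" b y] by simp
      from dvd[OF this] show ?thesis using True by (simp add: cong_altdef_nat)
    next
      case False
      then have "nmul (b - a) y \<in> H"
        using sgrp_diff_commute[OF H(1) *] nmul_add[of "b - a" a y] by simp
      from dvd[OF this] show ?thesis using False by (metis cong_altdef_nat cong_sym nat_le_linear)
    qed
  qed
  show ?thesis
  proof (rule that[of "\<lambda>x. int (c x)"])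
    fix x x' assume x: "x \<in> A" "x' \<in> A"
    have "(x + x') - nmul (c x + c x') y \<in> H"
      using sgrp_add[OF H(1) c[OF x(1)] c[OF x(2)]] by (simp add: nmul_add algebra_simps)
    moreover have "(x + x') - nmul (c (x + x')) y \<in> H" using c x A by (simp add: sgrp_add)
    ultimately have "[c (x + x') = c x + c x'] (mod p)" using uniq by blast
    then show "[int (c (x + x')) = int (c x) + int (c x')] (mod int p)"
      by (metis cong_int_iff of_nat_add)
  next
    fix b assume b: "b \<in> B"
    then have "b - nmul 0 y \<in> H" using H by auto
    moreover have "b - nmul (c b) y \<in> H" using c b BA by auto
    ultimately have "[c b = 0] (mod p)" using uniq by blast
    then show "[int (c b) = 0] (mod int p)" by (metis cong_int_iff of_nat_0)
  next
    show "\<not> [int (c y) = 0] (mod int p)"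
    proof
      assume "[int (c y) = 0] (mod int p)"
      then have "[c y = 0] (mod p)" by (metis cong_int_iff of_nat_0)
      then have "nmul (c y) y - nmul 0 y \<in> H" by (rule nmul_cong_mod[OF H(1) torH[OF y(1)]])
      then show False using c[OF y(1)] H sgrp_add by fastforce
    qed
  qed
qed

text \<open>The group of interest is \<open>A/B0\<close>; the presentation as a quotient lets
  \<open>'g\<close> be any type with a group structure. Supports and killed coordinates are
  nevertheless expressed by equalities in \<open>'g\<close>, not modulo \<open>B0\<close>, so that
  they can be rewritten freely. Finiteness is needed only for each bounded support, modulo
  \<open>B0\<close>.\<close>

locale poly_action =
  fixes act :: "cmat \<Rightarrow> 'g::ab_group_add \<Rightarrow> 'g" and A B0 :: "'g set" and p D :: nat
  assumes act_cmul: "act (g \<bullet> h) x = act g (act h x)"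
    and act_add: "act g (x + y) = act g x + act g y"
    and act_one: "act frag_of x = x"
    and A_sgrp: "sgrp A" and B0_sgrp: "sgrp B0" and B0_A: "B0 \<subseteq> A"
    and act_A: "x \<in> A \<Longrightarrow> act g x \<in> A"
    and act_B0: "x \<in> B0 \<Longrightarrow> act g x \<in> B0"
    and p: "prime p"
    and torsion: "x \<in> A \<Longrightarrow> nmul p x \<in> B0"
    and fin_supp: "x \<in> A \<Longrightarrow> \<exists>n. act (pr {..<n}) x = x"
    and fin_quot: "\<exists>F. finite F \<and> F \<subseteq> A \<and> (\<forall>x\<in>A. act (pr {..<n}) x = x \<longrightarrow> (\<exists>y\<in>F. x - y \<in> B0))"
    and degree: "\<lbrakk>x \<in> A; finite S; D \<le> card S; act (pr S) x = x; \<And>i. i \<in> S \<Longrightarrow> act (kill i) x = 0\<rbrakk>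
      \<Longrightarrow> x \<in> B0"
begin

lemma act_0 [simp]: "act g 0 = 0"
  using act_add[of g 0 0] by simp

lemma act_minus: "act g (- x) = - act g x"
  using act_add[of g x "- x"] by (simp add: eq_neg_iff_add_eq_0 add.commute)

lemma act_diff: "act g (x - y) = act g x - act g y"
  using act_add[of g x "- y"] by (simp add: act_minus)

lemmas A_diff = sgrp_diff[OF A_sgrp] and A_add = sgrp_add[OF A_sgrp]

lemma act_pr_pr: "act (pr F) (act (pr G) x) = act (pr (F \<inter> G)) x"
  by (simp flip: act_cmul)

text \<open>These are the subfunctors of the shift by \<open>W\<close>, seen as subgroups between
  \<open>B0\<close> and \<open>A\<close>.\<close>

definition stab :: "nat set \<Rightarrow> 'g set \<Rightarrow> bool"
  where "stab W B \<longleftrightarrow> sgrp B \<and> B0 \<subseteq> B \<and> B \<subseteq> A \<and> (\<forall>g\<in>End W. \<forall>x\<in>B. act g x \<in> B)"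

lemma stabD:
  assumes "stab W B"
  shows "sgrp B" "B0 \<subseteq> B" "B \<subseteq> A" "\<And>g x. g \<in> End W \<Longrightarrow> x \<in> B \<Longrightarrow> act g x \<in> B"
  using assms by (auto simp: stab_def)

lemma stab_mono: "stab W B \<Longrightarrow> W \<subseteq> W' \<Longrightarrow> stab W' B"
  using Hom_mono[of W W'] by (auto simp: stab_def)

lemma stab_A: "stab W A"
  by (simp add: stab_def A_sgrp B0_A act_A)

lemma stab_B0: "stab W B0"
  by (simp add: stab_def B0_sgrp B0_A act_B0)

definition wqo_on :: "nat set \<Rightarrow> 'g set \<Rightarrow> 'g set \<Rightarrow> bool"
  where "wqo_on W B X \<longleftrightarrow>
    (\<forall>T::nat \<Rightarrow> 'g. range T \<subseteq> X \<longrightarrow> (\<exists>i j. i < j \<and> (\<exists>g\<in>End W. act g (T j) - T i \<in> B)))"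

text \<open>This is the cross effect in the directions \<open>S\<close>, with parameters in the
  directions \<open>W\<close>.\<close>

definition pure :: "nat set \<Rightarrow> nat set \<Rightarrow> 'g \<Rightarrow> bool"
  where "pure W S x \<longleftrightarrow> act (pr (W \<union> S)) x = x \<and> (\<forall>i\<in>S. act (kill i) x = 0)"

lemma supp_mono:
  assumes "act (pr F) x = x" "F \<subseteq> G" shows "act (pr G) x = x"
proof -
  have "act (pr G) (act (pr F) x) = act (pr F) x"
    using assms(2) by (simp add: act_pr_pr Int_absorb1)
  then show ?thesis using assms(1) by simp
qed

text \<open>Inclusion-exclusion: \<open>x\<close> is the sum of \<open>act (kill i) x\<close>, which
  avoids \<open>i\<close>, and of the remainder, which \<open>kill i\<close> annihilates.
  \<open>T\<close> collects the coordinates treated in the second way. Stability keeps all pieces in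
  \<open>N\<close>, so membership in a subgroup \<open>H\<close> needs to be tested on pure elements
  only.\<close>

lemma pure_decomposition:
  assumes H: "sgrp H" and N: "sgrp N" "\<And>g x. g \<in> End W \<Longrightarrow> x \<in> N \<Longrightarrow> act g x \<in> N"
    and S: "finite S" "(S \<union> T) \<inter> W = {}" "S \<inter> T = {}"
    and x: "x \<in> N" "act (pr (W \<union> S \<union> T)) x = x" "\<And>i. i \<in> T \<Longrightarrow> act (kill i) x = 0"
    and pure: "\<And>S' y. S' \<subseteq> S \<Longrightarrow> y \<in> N \<Longrightarrow> pure W (S' \<union> T) y \<Longrightarrow> y \<in> H"
  shows "x \<in> H"
  using S x pure
proof (induction S arbitrary: T x rule: finite_induct)
  case empty
  then show ?case by (auto simp: pure_def)
next
  case (insert i S)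
  have iW: "i \<notin> W" "i \<notin> S" "i \<notin> T" "kill i \<in> End W" using insert by (auto intro: pr_End)
  define y where "y = act (kill i) x"
  have yN: "y \<in> N" using N iW insert by (auto simp: y_def)
  have "y \<in> H"
  proof (rule insert.IH[of T])
    have "y = act (kill i) (act (pr (W \<union> insert i S \<union> T)) x)" using insert y_def by simp
    also have "\<dots> = act (pr (W \<union> S \<union> T)) x"
      by (simp add: act_pr_pr) (rule arg_cong[where f="\<lambda>F. act (pr F) x"], use iW in auto)
    finally have "y = act (pr (W \<union> S \<union> T)) x" .
    then show "act (pr (W \<union> S \<union> T)) y = y" by (simp add: act_pr_pr)
    show "act (kill j) y = 0" if "j \<in> T" for j
    proof -
      have "act (kill j) y = act (kill i) (act (kill j) x)"
        unfolding y_def by (simp add: act_pr_pr Int_commute)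
      then show ?thesis using insert.prems(5)[OF that] by simp
    qed
    show "z \<in> H" if "S' \<subseteq> S" "z \<in> N" "pure W (S' \<union> T) z" for S' z
      using insert.prems(6)[of S' z] that by auto
  qed (use insert.prems yN in auto)
  moreover have "x - y \<in> H"
  proof (rule insert.IH[of "insert i T"])
    have yW: "act (pr (W \<union> S \<union> insert i T)) x = x"
      using insert.prems(4) by (simp add: Un_left_commute Un_assoc)
    have "act (pr (W \<union> S \<union> insert i T)) y = act (kill i) (act (pr (W \<union> S \<union> insert i T)) x)"
      unfolding y_def by (simp add: act_pr_pr Int_commute)
    then show "act (pr (W \<union> S \<union> insert i T)) (x - y) = x - y"
      using yW by (simp add: act_diff y_def)
    show "act (kill j) (x - y) = 0" if "j \<in> insert i T" for j
    proof (cases "j = i")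
      case True then show ?thesis by (simp add: act_diff y_def act_pr_pr)
    next
      case False
      have "act (kill j) y = act (kill i) (act (kill j) x)"
        unfolding y_def by (simp add: act_pr_pr Int_commute)
      then show ?thesis using insert.prems(5)[of j] False that by (simp add: act_diff)
    qed
    show "z \<in> H" if "S' \<subseteq> S" "z \<in> N" "pure W (S' \<union> insert i T) z" for S' z
      using insert.prems(6)[of "insert i S'" z] that by auto
    show "x - y \<in> N" using N insert yN by (auto intro: sgrp_diff)
  qed (use insert.prems iW insert.hyps in auto)
  ultimately have "(x - y) + y \<in> H" using H sgrp_add by blast
  then show ?case by simp
qed

text \<open>The degree axiom has no frozen coordinates. Decomposing along \<open>W\<close> as well
  only enlarges the set of coordinates on which the pieces are pure.\<close>

lemma pure_degree:
  assumes "finite W" "finite S" "S \<inter> W = {}" "D \<le> card S" "x \<in> A" "pure W S x"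
  shows "x \<in> B0"
proof (rule pure_decomposition[OF B0_sgrp A_sgrp, of "{}" W S x])
  show "y \<in> B0" if "S' \<subseteq> W" "y \<in> A" "pure {} (S' \<union> S) y" for S' y
  proof (rule degree[of _ "S' \<union> S"])
    show fin: "finite (S' \<union> S)" using assms that by (auto intro: finite_subset)
    have "card S \<le> card (S' \<union> S)" using fin by (intro card_mono) auto
    then show "D \<le> card (S' \<union> S)" using assms by linarith
  qed (use that in \<open>auto simp: pure_def\<close>)
qed (use assms act_A in \<open>auto simp: pure_def\<close>)

end

section \<open>Polynomial functions modulo \<open>p\<close>\<close>

locale level = poly_action act A B0 p D
  for act :: "cmat \<Rightarrow> 'g::ab_group_add \<Rightarrow> 'g" and A B0 :: "'g set" and p D :: nat +
  fixes W :: "nat set" and B :: "'g set"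
  assumes fin_W: "finite W" and stab_B: "stab W B"
begin

abbreviation ceq :: "int \<Rightarrow> int \<Rightarrow> bool" (infix "\<equiv>\<^sub>p" 50)
  where "a \<equiv>\<^sub>p b \<equiv> [a = b] (mod int p)"

lemmas B_sgrp = stabD(1)[OF stab_B] and B0_B = stabD(2)[OF stab_B] and B_A = stabD(3)[OF stab_B]
  and act_B = stabD(4)[OF stab_B]

definition supported :: "nat set \<Rightarrow> ('g \<Rightarrow> int) \<Rightarrow> bool"
  where "supported F f \<longleftrightarrow> (\<forall>x\<in>A. f (act (pr (W \<union> F)) x) \<equiv>\<^sub>p f x)"

lemma ceq_left: "a \<equiv>\<^sub>p b \<Longrightarrow> a \<equiv>\<^sub>p c \<Longrightarrow> b \<equiv>\<^sub>p c"
  by (rule cong_trans[OF cong_sym])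

lemma supported_mono:
  assumes "supported F f" "F \<subseteq> G" shows "supported G f"
  unfolding supported_def
proof
  fix x assume x: "x \<in> A"
  have FG: "(W \<union> F) \<inter> (W \<union> G) = W \<union> F" using assms(2) by blast
  have "f (act (pr (W \<union> F)) (act (pr (W \<union> G)) x)) \<equiv>\<^sub>p f (act (pr (W \<union> G)) x)"
    using assms(1) act_A[OF x] unfolding supported_def by blast
  then have "f (act (pr (W \<union> F)) x) \<equiv>\<^sub>p f (act (pr (W \<union> G)) x)"
    by (simp add: act_pr_pr FG)
  moreover have "f (act (pr (W \<union> F)) x) \<equiv>\<^sub>p f x"
    using assms(1) x unfolding supported_def by blast
  ultimately show "f (act (pr (W \<union> G)) x) \<equiv>\<^sub>p f x" by (rule ceq_left)
qed

lemma supported_Diff: "supported F f \<longleftrightarrow> supported (F - W) f"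
  by (simp add: supported_def)

definition char :: "('g \<Rightarrow> int) \<Rightarrow> bool"
  where "char \<chi> \<longleftrightarrow> (\<forall>x\<in>A. \<forall>y\<in>A. \<chi> (x + y) \<equiv>\<^sub>p \<chi> x + \<chi> y) \<and> (\<forall>b\<in>B. \<chi> b \<equiv>\<^sub>p 0)
    \<and> (\<exists>F. finite F \<and> supported F \<chi>)"

lemma charD:
  assumes "char \<chi>"
  shows "x \<in> A \<Longrightarrow> y \<in> A \<Longrightarrow> \<chi> (x + y) \<equiv>\<^sub>p \<chi> x + \<chi> y" "b \<in> B \<Longrightarrow> \<chi> b \<equiv>\<^sub>p 0"
    "\<exists>F. finite F \<and> supported F \<chi>"
  using assms by (auto simp: char_def)

text \<open>Polynomials in the characters, with integer values read modulo \<open>p\<close>;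
  \<open>n\<close> is merely an upper bound for the degree.\<close>

inductive Pol :: "nat \<Rightarrow> ('g \<Rightarrow> int) \<Rightarrow> bool" where
  const: "Pol n (\<lambda>_. c)"
| add: "Pol n f \<Longrightarrow> Pol n g \<Longrightarrow> Pol n (\<lambda>x. f x + g x)"
| step: "Pol n f \<Longrightarrow> char \<chi> \<Longrightarrow> Pol (Suc n) (\<lambda>x. \<chi> x * f x)"

lemma Pol_Suc: "Pol n f \<Longrightarrow> Pol (Suc n) f"
  by (induction rule: Pol.induct) (auto intro: Pol.intros)

lemma Pol_mono: "n \<le> m \<Longrightarrow> Pol n f \<Longrightarrow> Pol m f"
  by (induction m rule: dec_induct) (auto intro: Pol_Suc)

lemma Pol_cmult: "Pol n f \<Longrightarrow> Pol n (\<lambda>x. c * f x)"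
proof (induction rule: Pol.induct)
  case (const n c') then show ?case by (rule Pol.const)
next
  case (add n f g)
  then show ?case using Pol.add[OF add.IH] by (simp add: algebra_simps)
next
  case (step n f \<chi>)
  then show ?case using Pol.step[OF step.IH step.hyps(2)] by (simp add: algebra_simps)
qed

lemma Pol_diff: "Pol n f \<Longrightarrow> Pol n g \<Longrightarrow> Pol n (\<lambda>x. f x - g x)"
  using Pol.add[of n f "\<lambda>x. (-1) * g x"] Pol_cmult[of n g "-1"] by simp

lemma Pol_mult: "Pol n f \<Longrightarrow> Pol m g \<Longrightarrow> Pol (n + m) (\<lambda>x. f x * g x)"
proof (induction rule: Pol.induct)
  case (const n c)
  then show ?case using Pol_mono[OF _ Pol_cmult[of m g c], of "n + m"] by simp
next
  case (add n f f')
  then show ?case using Pol.add[of "n + m" "\<lambda>x. f x * g x" "\<lambda>x. f' x * g x"] by (simp add: algebra_simps)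
next
  case (step n f \<chi>)
  then show ?case using Pol.step[of "n + m" "\<lambda>x. f x * g x" \<chi>] by (simp add: algebra_simps)
qed

lemma Pol_char: "char \<chi> \<Longrightarrow> Pol 1 \<chi>"
  using Pol.step[OF Pol.const[of 0 1]] by simp

lemma Pol_power: "Pol n f \<Longrightarrow> \<exists>m. Pol m (\<lambda>x. f x ^ k)"
proof (induction k)
  case 0 then show ?case using Pol.const[of 0 1] by auto
next
  case (Suc k)
  then obtain m where "Pol m (\<lambda>x. f x ^ k)" by auto
  from Pol_mult[OF Suc.prems this] show ?case by auto
qed

lemma Pol_prod:
  assumes "finite I" "\<And>i. i \<in> I \<Longrightarrow> \<exists>m. Pol m (f i)"
  shows "\<exists>m. Pol m (\<lambda>x. \<Prod>i\<in>I. f i x)"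
  using assms
proof (induction I rule: finite_induct)
  case empty then show ?case using Pol.const[of 0 1] by auto
next
  case (insert i I)
  then obtain m where "Pol m (\<lambda>x. \<Prod>i\<in>I. f i x)" by auto
  moreover obtain m' where "Pol m' (f i)" using insert by auto
  ultimately have "Pol m' (f i)" "Pol m (\<lambda>x. \<Prod>i\<in>I. f i x)" by auto
  from Pol_mult[OF this] show ?case using insert by auto
qed

lemma Pol_supported:
  assumes "Pol n f"
  obtains F where "finite F" "F \<inter> W = {}" "supported F f"
proof -
  have "\<exists>F. finite F \<and> supported F f" using assms
  proof (induction rule: Pol.induct)
    case (const n c) then show ?case by (auto simp: supported_def)
  next
    case (add n f g)
    then obtain F G where "finite F" "supported F f" "finite G" "supported G g" by auto
    then have "supported (F \<union> G) f" "supported (F \<union> G) g" by (auto elim: supported_mono)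
    then have "supported (F \<union> G) (\<lambda>x. f x + g x)" by (auto simp: supported_def intro: cong_add)
    then show ?case using \<open>finite F\<close> \<open>finite G\<close> by blast
  next
    case (step n f \<chi>)
    then obtain F G where "finite F" "supported F f" "finite G" "supported G \<chi>" using charD(3)[OF step.hyps(2)] by blast
    then have "supported (F \<union> G) f" "supported (F \<union> G) \<chi>" by (auto elim: supported_mono)
    then have "supported (F \<union> G) (\<lambda>x. \<chi> x * f x)" by (auto simp: supported_def intro: cong_mult)
    then show ?case using \<open>finite F\<close> \<open>finite G\<close> by blast
  qed
  then obtain F where "finite F" "supported F f" by blast
  then show ?thesis using that[of "F - W"] supported_Diff by auto
qed

lemma Pol_B:
  assumes "Pol n f" "x \<in> A" "b \<in> B" shows "f (x + b) \<equiv>\<^sub>p f x"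
  using assms
proof (induction rule: Pol.induct)
  case (step n f \<chi>)
  have "b \<in> A" using step.prems B_A by blast
  then have "\<chi> (x + b) \<equiv>\<^sub>p \<chi> x + \<chi> b" by (rule charD(1)[OF step.hyps(2) step.prems(1)])
  moreover have "\<chi> x + \<chi> b \<equiv>\<^sub>p \<chi> x + 0"
    by (rule cong_add[OF cong_refl charD(2)[OF step.hyps(2) step.prems(2)]])
  ultimately have "\<chi> (x + b) \<equiv>\<^sub>p \<chi> x + 0" by (rule cong_trans)
  then have "\<chi> (x + b) \<equiv>\<^sub>p \<chi> x" by simp
  then show ?case using step by (intro cong_mult) auto
qed (auto intro: cong_add)

text \<open>By the product rule the difference of \<open>\<chi> f\<close> is
  \<open>\<chi>(x) g(x) + \<chi>(r) (f(x) + g(x))\<close>, where \<open>g\<close> is the difference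
  of \<open>f\<close>; each summand has lost one degree. The case \<open>n = 0\<close> is separate
  because the difference must then be zero, not merely of degree \<open>0\<close>.\<close>

lemma Pol_difference:
  assumes "Pol n f" "r \<in> A"
  shows "\<exists>g. (\<forall>x\<in>A. f (x + r) - f x \<equiv>\<^sub>p g x) \<and> (if n = 0 then g = (\<lambda>_. 0) else Pol (n - 1) g)"
  using assms
proof (induction rule: Pol.induct)
  case (const n c)
  then show ?case by (intro exI[of _ "\<lambda>_. 0"]) (auto intro: Pol.const)
next
  case (add n f f')
  then obtain g g' where g: "\<forall>x\<in>A. f (x + r) - f x \<equiv>\<^sub>p g x" "if n = 0 then g = (\<lambda>_. 0) else Pol (n - 1) g"
    "\<forall>x\<in>A. f' (x + r) - f' x \<equiv>\<^sub>p g' x" "if n = 0 then g' = (\<lambda>_. 0) else Pol (n - 1) g'" by auto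
  have "f (x + r) + f' (x + r) - (f x + f' x) \<equiv>\<^sub>p g x + g' x" if "x \<in> A" for x
  proof -
    have "(f (x + r) - f x) + (f' (x + r) - f' x) \<equiv>\<^sub>p g x + g' x"
      using g that by (intro cong_add) auto
    then show ?thesis by (simp add: algebra_simps)
  qed
  then show ?case using g(2,4)
    by (intro exI[of _ "\<lambda>x. g x + g' x"]) (auto intro: Pol.add split: if_splits)
next
  case (step n f \<chi>)
  then obtain g where g: "\<forall>x\<in>A. f (x + r) - f x \<equiv>\<^sub>p g x" "if n = 0 then g = (\<lambda>_. 0) else Pol (n - 1) g" by auto
  define g' where "g' = (\<lambda>x. \<chi> x * g x + \<chi> r * (f x + g x))"
  have "\<chi> (x + r) * f (x + r) - \<chi> x * f x \<equiv>\<^sub>p g' x" if x: "x \<in> A" for x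
  proof -
    have "f x + (f (x + r) - f x) \<equiv>\<^sub>p f x + g x" using g x by (intro cong_add) auto
    then have "\<chi> (x + r) * f (x + r) - \<chi> x * f x \<equiv>\<^sub>p (\<chi> x + \<chi> r) * (f x + g x) - \<chi> x * f x"
      using charD(1)[OF step.hyps(2) x step.prems] by (intro cong_diff cong_mult) auto
    then show ?thesis by (simp add: g'_def algebra_simps)
  qed
  moreover have "Pol n g'"
  proof (cases n)
    case 0
    then show ?thesis using g Pol_cmult[OF step.hyps(1), of "\<chi> r"] by (simp add: g'_def)
  next
    case (Suc m)
    then have "Pol m g" using g by simp
    then have "Pol n (\<lambda>x. \<chi> x * g x)" "Pol n g"
      using step.hyps(2) Suc by (auto intro: Pol.step Pol_Suc)
    then show ?thesis unfolding g'_def by (intro Pol.add Pol_cmult step.hyps(1))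
  qed
  ultimately show ?case by auto
qed

text \<open>A matrix \<open>g\<close> may have infinitely many nonzero columns, so a finite support
  of the composite has to be supplied through \<open>F\<close>.\<close>

lemma char_act:
  assumes "char \<chi>" "g \<in> End W" "finite F" "\<And>x. x \<in> A \<Longrightarrow> \<chi> (act g (act (pr (W \<union> F)) x)) \<equiv>\<^sub>p \<chi> (act g x)"
  shows "char (\<lambda>x. \<chi> (act g x))"
  unfolding char_def
proof (intro conjI ballI)
  show "\<chi> (act g (x + y)) \<equiv>\<^sub>p \<chi> (act g x) + \<chi> (act g y)" if "x \<in> A" "y \<in> A" for x y
    using charD(1)[OF assms(1)] that by (simp add: act_add act_A)
  show "\<chi> (act g b) \<equiv>\<^sub>p 0" if "b \<in> B" for b
    using charD(2)[OF assms(1)] act_B assms(2) that by auto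
  show "\<exists>F. finite F \<and> supported F (\<lambda>x. \<chi> (act g x))"
    using assms(3,4) by (auto simp: supported_def)
qed

lemma Pol_act:
  assumes "Pol n f" "g \<in> End W" "finite F" "g \<bullet> pr (W \<union> F) = g"
  shows "Pol n (\<lambda>x. f (act g x))"
  using assms(1)
proof (induction rule: Pol.induct)
  case (step n f \<chi>)
  have "char (\<lambda>x. \<chi> (act g x))"
    using step.hyps(2) assms(2-4) by (intro char_act) (auto simp flip: act_cmul)
  then show ?case using step.IH by (intro Pol.step)
qed (auto intro: Pol.intros)

section \<open>Sums of functions of few coordinates, and vanishing cross effects\<close>

inductive dep :: "nat \<Rightarrow> ('g \<Rightarrow> int) \<Rightarrow> bool" where
  supp: "finite F \<Longrightarrow> card F \<le> a \<Longrightarrow> supported F f \<Longrightarrow> dep a f"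
| add: "dep a f \<Longrightarrow> dep a g \<Longrightarrow> dep a (\<lambda>x. f x + g x)"
| ceq: "dep a f \<Longrightarrow> (\<And>x. x \<in> A \<Longrightarrow> g x \<equiv>\<^sub>p f x) \<Longrightarrow> dep a g"

lemma dep_mult: "dep a f \<Longrightarrow> dep b g \<Longrightarrow> dep (a + b) (\<lambda>x. f x * g x)"
proof (induction rule: dep.induct)
  case f: (supp F a f)
  from f(4) show ?case
  proof (induction rule: dep.induct)
    case g: (supp G b g)
    have "supported (F \<union> G) f" "supported (F \<union> G) g" using f(3) g(3) by (auto elim: supported_mono)
    then have "supported (F \<union> G) (\<lambda>x. f x * g x)" by (auto simp: supported_def intro: cong_mult)
    moreover have "card (F \<union> G) \<le> a + b" using card_Un_le[of F G] f(2) g(2) by simp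
    ultimately show ?case using f(1) g(1) by (intro dep.supp[of "F \<union> G"]) auto
  next
    case (add b g g')
    then show ?case using dep.add[OF add.IH] by (simp add: algebra_simps)
  next
    case (ceq b g g')
    then show ?case by (intro dep.ceq[OF ceq.IH]) (auto intro: cong_mult)
  qed
next
  case (add a f f')
  then show ?case using dep.add[OF add.IH(1)[OF add.prems] add.IH(2)[OF add.prems]] by (simp add: algebra_simps)
next
  case (ceq a f f')
  then show ?case by (intro dep.ceq[OF ceq.IH[OF ceq.prems]]) (auto intro: cong_mult)
qed

text \<open>Dual to \<open>pure_decomposition\<close>: \<open>\<chi>\<close> splits into its
  composite with \<open>kill i\<close> and the rest, and \<open>T\<close> collects coordinates whose
  killing annihilates \<open>\<chi>\<close>. If \<open>S\<close> is exhausted and \<open>T\<close>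
  has more than \<open>D\<close> elements, then \<open>\<chi>\<close> is zero: elements pure on
  \<open>T\<close> lie in \<open>B0\<close> by the degree axiom, and an element pure on a proper
  subset of \<open>T\<close> is fixed by \<open>kill i\<close> for some \<open>i\<close> in
  \<open>T\<close>.\<close>

lemma char_dep_aux:
  assumes "finite S" "char \<chi>" "finite T" "(S \<union> T) \<inter> W = {}" "S \<inter> T = {}" "supported (S \<union> T) \<chi>"
    "\<And>i x. i \<in> T \<Longrightarrow> x \<in> A \<Longrightarrow> \<chi> (act (kill i) x) \<equiv>\<^sub>p 0"
  shows "dep D \<chi>"
  using assms
proof (induction S arbitrary: T \<chi> rule: finite_induct)
  case empty
  show ?case
  proof (cases "card T \<le> D")
    case True then show ?thesis using empty by (intro dep.supp[of T]) auto
  next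
    case False
    define H where "H = {y \<in> A. \<chi> y \<equiv>\<^sub>p 0}"
    have \<chi>0: "\<chi> 0 \<equiv>\<^sub>p 0" using charD(2)[OF empty.prems(1)] B_sgrp sgrp_0 by blast
    have H: "sgrp H"
      unfolding sgrp_def
    proof (intro conjI ballI)
      show "0 \<in> H" using A_sgrp sgrp_0 \<chi>0 by (auto simp: H_def)
      fix x y assume xy: "x \<in> H" "y \<in> H"
      then have "\<chi> (x - y + y) \<equiv>\<^sub>p \<chi> (x - y) + \<chi> y"
        by (intro charD(1)[OF empty.prems(1)]) (auto simp: H_def intro: A_diff)
      moreover have "\<chi> (x - y) + \<chi> y \<equiv>\<^sub>p \<chi> (x - y) + 0" using xy by (intro cong_add) (auto simp: H_def)
      ultimately have "\<chi> (x - y + y) \<equiv>\<^sub>p \<chi> (x - y) + 0" by (rule cong_trans)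
      then have "\<chi> x \<equiv>\<^sub>p \<chi> (x - y)" by simp
      moreover have "\<chi> x \<equiv>\<^sub>p 0" using xy by (simp add: H_def)
      ultimately have "\<chi> (x - y) \<equiv>\<^sub>p 0" by (rule ceq_left)
      then show "x - y \<in> H" using xy by (auto simp: H_def intro: A_diff)
    qed
    have "\<chi> x \<equiv>\<^sub>p 0" if x: "x \<in> A" for x
    proof -
      have "act (pr (W \<union> T)) x \<in> H"
      proof (rule pure_decomposition[OF H A_sgrp, of W T "{}"])
        fix S' y assume S': "S' \<subseteq> T" and y: "y \<in> A" "pure W (S' \<union> {}) y"
        show "y \<in> H"
        proof (cases "S' = T")
          case True
          then have "y \<in> B0" using y empty False by (intro pure_degree[OF fin_W, of T]) auto
          then show ?thesis using charD(2)[OF empty.prems(1)] B0_B y by (auto simp: H_def)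
        next
          case False
          then obtain i where i: "i \<in> T" "i \<notin> S'" using S' by blast
          have "W \<union> S' \<subseteq> - {i}" using i empty.prems(3) by auto
          then have "act (kill i) y = y"
            using y(2) by - (rule supp_mono[of "W \<union> S'"], simp_all add: pure_def)
          then have "\<chi> y \<equiv>\<^sub>p 0" using empty.prems(6)[OF i(1) y(1)] by metis
          then show ?thesis using y(1) by (simp add: H_def)
        qed
      next
        show "act (pr (W \<union> T)) x \<in> A" by (rule act_A[OF x])
        show "act (pr (W \<union> T \<union> {})) (act (pr (W \<union> T)) x) = act (pr (W \<union> T)) x"
          by (simp add: act_pr_pr)
      qed (use empty act_A in simp_all)
      then have *: "\<chi> (act (pr (W \<union> T)) x) \<equiv>\<^sub>p 0" by (simp add: H_def)
      have "\<chi> (act (pr (W \<union> T)) x) \<equiv>\<^sub>p \<chi> x"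
        using empty.prems(5) x by (simp add: supported_def)
      from this * show ?thesis by (rule ceq_left)
    qed
    then show ?thesis
      by (intro dep.ceq[OF dep.supp[of "{}" D "\<lambda>_. 0"]]) (auto simp: supported_def)
  qed
next
  case (insert i S)
  define \<chi>1 where "\<chi>1 = (\<lambda>x. \<chi> (act (kill i) x))"
  define \<chi>2 where "\<chi>2 = (\<lambda>x. \<chi> x - \<chi>1 x)"
  have comm: "act (kill i) (act (pr F) x) = act (pr F) (act (kill i) x)" for F x
    by (simp add: act_pr_pr Int_commute)
  have iW: "i \<notin> W" using insert.hyps insert.prems(2-4) by auto
  have supp: "\<chi> (act (pr (W \<union> (insert i S \<union> T))) x) \<equiv>\<^sub>p \<chi> x" if "x \<in> A" for x
    using insert.prems(5) that by (simp add: supported_def)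
  have char1: "char \<chi>1"
    unfolding \<chi>1_def
  proof (rule char_act[OF insert.prems(1)])
    show "kill i \<in> End W" using iW by (intro pr_End) auto
    show "finite (insert i S \<union> T)" using insert.hyps insert.prems(2-4) by auto
    show "\<chi> (act (kill i) (act (pr (W \<union> (insert i S \<union> T))) x)) \<equiv>\<^sub>p \<chi> (act (kill i) x)" if "x \<in> A" for x
      unfolding comm using supp act_A that by blast
  qed
  have supp1: "supported (S \<union> T) \<chi>1"
    unfolding supported_def
  proof
    fix x assume x: "x \<in> A"
    have "act (kill i) (act (pr (W \<union> (S \<union> T))) x) = act (pr (W \<union> (insert i S \<union> T))) (act (kill i) x)"
      by (simp add: act_pr_pr) (rule arg_cong[where f="\<lambda>F. act (pr F) x"], use iW insert.hyps insert.prems(2-4) in auto)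
    then show "\<chi>1 (act (pr (W \<union> (S \<union> T))) x) \<equiv>\<^sub>p \<chi>1 x"
      unfolding \<chi>1_def using supp[OF act_A[OF x]] by simp
  qed
  have "dep D \<chi>1"
  proof (rule insert.IH[of _ T])
    show "\<chi>1 (act (kill j) x) \<equiv>\<^sub>p 0" if "j \<in> T" "x \<in> A" for j x
      unfolding \<chi>1_def comm using that by (intro insert.prems(6) act_A)
  qed (use insert.hyps insert.prems(2-4) char1 supp1 in auto)
  moreover have "dep D \<chi>2"
  proof (rule insert.IH[of _ "insert i T"])
    show "supported (S \<union> insert i T) \<chi>2"
    proof -
      have "supported (S \<union> insert i T) \<chi>" "supported (S \<union> insert i T) \<chi>1"
        using supported_mono[OF insert.prems(5), of "S \<union> insert i T"] supported_mono[OF supp1, of "S \<union> insert i T"] by auto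
      then show ?thesis by (auto simp: supported_def \<chi>2_def intro: cong_diff)
    qed
    then have "\<exists>F. finite F \<and> supported F \<chi>2"
      using insert.hyps(1) insert.prems(2) by (intro exI[of _ "S \<union> insert i T"]) simp
    moreover have "\<chi>2 (x + y) \<equiv>\<^sub>p \<chi>2 x + \<chi>2 y" if "x \<in> A" "y \<in> A" for x y
    proof -
      have "\<chi>2 (x + y) \<equiv>\<^sub>p (\<chi> x + \<chi> y) - (\<chi>1 x + \<chi>1 y)"
        unfolding \<chi>2_def
        by (rule cong_diff[OF charD(1)[OF insert.prems(1) that] charD(1)[OF char1 that]])
      then show ?thesis by (simp add: \<chi>2_def algebra_simps)
    qed
    moreover have "\<chi>2 b \<equiv>\<^sub>p 0" if "b \<in> B" for b
    proof -
      have "\<chi>2 b \<equiv>\<^sub>p 0 - 0"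
        unfolding \<chi>2_def
        by (rule cong_diff[OF charD(2)[OF insert.prems(1) that] charD(2)[OF char1 that]])
      then show ?thesis by simp
    qed
    ultimately show "char \<chi>2" unfolding char_def by blast
    show "\<chi>2 (act (kill j) x) \<equiv>\<^sub>p 0" if j: "j \<in> insert i T" and x: "x \<in> A" for j x
    proof (cases "j = i")
      case True then show ?thesis by (simp add: \<chi>2_def \<chi>1_def act_pr_pr)
    next
      case False
      then have "\<chi>2 (act (kill j) x) \<equiv>\<^sub>p 0 - 0"
        unfolding \<chi>2_def \<chi>1_def comm
        using j x False by (intro cong_diff insert.prems(6) act_A) auto
      then show ?thesis by simp
    qed
  qed (use insert.hyps insert.prems(2-4) iW in auto)
  ultimately have "dep D (\<lambda>x. \<chi>1 x + \<chi>2 x)" by (rule dep.add)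
  then show ?case by (simp add: \<chi>2_def)
qed

lemma char_dep:
  assumes "char \<chi>" shows "dep D \<chi>"
proof -
  from charD(3)[OF assms] obtain F where F: "finite F" "supported F \<chi>" by blast
  then show ?thesis
    using assms supported_Diff[of F \<chi>] by (intro char_dep_aux[of "F - W" \<chi> "{}"]) auto
qed

lemma Pol_dep: "Pol n f \<Longrightarrow> dep (n * D) f"
proof (induction rule: Pol.induct)
  case (const n c)
  then show ?case by (intro dep.supp[of "{}"]) (auto simp: supported_def)
next
  case (add n f g) then show ?case by (intro dep.add)
next
  case (step n f \<chi>)
  then show ?case using dep_mult[OF char_dep step.IH] by simp
qed

text \<open>The alternating sum of the values of \<open>f\<close> at \<open>x\<close> with the
  coordinates from a subset of \<open>is\<close> set to zero.\<close>

primrec cross :: "nat list \<Rightarrow> ('g \<Rightarrow> int) \<Rightarrow> 'g \<Rightarrow> int" where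
  "cross [] f = f"
| "cross (i # is) f = (\<lambda>x. cross is f x - cross is f (act (kill i) x))"

lemma cross_add: "cross is (\<lambda>x. f x + g x) = (\<lambda>x. cross is f x + cross is g x)"
  by (induction "is") (auto simp: fun_eq_iff)

lemma cross_cong:
  "(\<And>x. x \<in> A \<Longrightarrow> f x \<equiv>\<^sub>p g x) \<Longrightarrow> x \<in> A \<Longrightarrow> cross is f x \<equiv>\<^sub>p cross is g x"
  by (induction "is" arbitrary: x) (auto intro: cong_diff act_A)

lemma cross_inv:
  assumes "\<And>x. x \<in> A \<Longrightarrow> f (act (kill i) x) \<equiv>\<^sub>p f x" "x \<in> A"
  shows "cross is f (act (kill i) x) \<equiv>\<^sub>p cross is f x"
  using assms(2)
proof (induction "is" arbitrary: x)
  case (Cons j "is")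
  have "act (kill j) (act (kill i) x) = act (kill i) (act (kill j) x)"
    by (simp add: act_pr_pr Int_commute)
  then show ?case using Cons act_A by (auto intro!: cong_diff)
qed (use assms in simp)

lemma cross_0:
  assumes f: "\<And>x. x \<in> A \<Longrightarrow> f (act (kill i) x) \<equiv>\<^sub>p f x" and i: "i \<in> set is" and x: "x \<in> A"
  shows "cross is f x \<equiv>\<^sub>p 0"
  using i x
proof (induction "is" arbitrary: x)
  case (Cons j "is")
  show ?case
  proof (cases "i \<in> set is")
    case True
    then have "cross (j # is) f x \<equiv>\<^sub>p 0 - 0"
      unfolding cross.simps using Cons act_A by (intro cong_diff) auto
    then show ?thesis by simp
  next
    case False
    then have "j = i" using Cons by auto
    then have "cross (j # is) f x \<equiv>\<^sub>p cross is f x - cross is f x"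
      unfolding cross.simps using Cons.prems f by (intro cong_diff cong_refl) (simp add: cross_inv)
    then show ?thesis by simp
  qed
qed simp

text \<open>By pigeonhole each summand misses some \<open>i\<close> in \<open>is\<close>. It does
  not change under \<open>kill i\<close>, so taking the difference at \<open>i\<close> cancels
  it.\<close>

lemma dep_cross:
  assumes "dep a f" "distinct is" "a < length is" "set is \<inter> W = {}" "x \<in> A"
  shows "cross is f x \<equiv>\<^sub>p 0"
  using assms
proof (induction arbitrary: x rule: dep.induct)
  case (supp F a f)
  have "card (set is) > card F" using supp by (simp add: distinct_card)
  then have "\<not> set is \<subseteq> F" using supp(1) card_mono leD by blast
  then obtain i where i: "i \<in> set is" "i \<notin> F" by blast
  have "f (act (kill i) y) \<equiv>\<^sub>p f y" if y: "y \<in> A" for y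
  proof -
    have "(W \<union> F) \<inter> - {i} = W \<union> F" using i supp(6) by auto
    then have *: "act (pr (W \<union> F)) (act (kill i) y) = act (pr (W \<union> F)) y"
      by (simp add: act_pr_pr)
    have "f (act (pr (W \<union> F)) y) \<equiv>\<^sub>p f (act (kill i) y)"
      using supp(3) act_A[OF y] * unfolding supported_def by metis
    moreover have "f (act (pr (W \<union> F)) y) \<equiv>\<^sub>p f y"
      using supp(3) y unfolding supported_def by blast
    ultimately show ?thesis by (rule ceq_left)
  qed
  then show ?case using i supp by (intro cross_0)
next
  case (add a f g)
  then have "cross is (\<lambda>x. f x + g x) x \<equiv>\<^sub>p 0 + 0" unfolding cross_add by (intro cong_add) auto
  then show ?case by simp
next
  case (ceq a f g)
  then show ?case using cong_trans[OF cross_cong[of g f x "is"]] by simp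
qed

text \<open>On \<open>Y\<close> purity kills all terms of the cross effect along \<open>S\<close>
  except \<open>h\<close> itself, whereas cross effects in more than \<open>n * D\<close> directions
  vanish. This bound makes a maximal choice of pure coordinates possible.\<close>

lemma Pol_pure_bound:
  assumes "Pol n h" "finite S" "S \<inter> W = {}" and Y: "Y \<subseteq> A" "\<And>g x. g \<in> End W \<Longrightarrow> x \<in> Y \<Longrightarrow> act g x \<in> Y"
    and pure: "\<And>i x. i \<in> S \<Longrightarrow> x \<in> Y \<Longrightarrow> h (act (kill i) x) \<equiv>\<^sub>p 0"
    and y: "y \<in> Y" "\<not> h y \<equiv>\<^sub>p 0"
  shows "card S \<le> n * D"
proof (rule ccontr)
  assume "\<not> card S \<le> n * D"
  moreover obtain "is" where "is": "set is = S" "distinct is" using assms(2) finite_distinct_list by blast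
  ultimately have c0: "cross is h y \<equiv>\<^sub>p 0"
    using Y y assms(3) by (intro dep_cross[OF Pol_dep[OF assms(1)]]) (auto simp: distinct_card)
  have "cross js h x \<equiv>\<^sub>p h x" if "set js \<subseteq> S" "x \<in> Y" for js x
    using that
  proof (induction js arbitrary: x)
    case (Cons j js)
    have jx: "act (kill j) x \<in> Y" using Cons assms(3) by (intro Y pr_End) auto
    have "cross js h (act (kill j) x) \<equiv>\<^sub>p 0"
      using cong_trans[OF Cons.IH[OF _ jx] pure[of j x]] Cons.prems by simp
    then have "cross (j # js) h x \<equiv>\<^sub>p h x - 0"
      unfolding cross.simps using Cons by (intro cong_diff) auto
    then show ?case by simp
  qed simp
  from this[of "is" y] have "cross is h y \<equiv>\<^sub>p h y" using y "is" by simp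
  then have "h y \<equiv>\<^sub>p 0" using c0 by (rule ceq_left)
  then show False using y by simp
qed

text \<open>Interpolation by Fermat's little theorem: \<open>1 - c ^ (p - 1)\<close> is
  \<open>1\<close> modulo \<open>p\<close> if \<open>c\<close> vanishes and \<open>0\<close>
  otherwise. Elements supported on \<open>{..<m}\<close> have finitely many classes modulo
  \<open>B0\<close>, and for each representative \<open>y\<close> outside \<open>B\<close> one
  character nonzero at \<open>y\<close> suffices. The product of these factors detects membership of
  the difference in \<open>B\<close>.\<close>

lemma Pol_indicator:
  assumes "finite F" "x0 \<in> A"
  shows "\<exists>n h. Pol n h \<and> (\<forall>x\<in>A. h x \<equiv>\<^sub>p (if act (pr (W \<union> F)) x - act (pr (W \<union> F)) x0 \<in> B then 1 else 0))"
proof -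
  let ?\<pi> = "\<lambda>x. act (pr (W \<union> F)) x"
  obtain m where m: "W \<union> F \<subseteq> {..<m}"
    using fin_W assms(1) by (meson finite_UnI finite_nat_iff_bounded)
  obtain Q where Q: "finite Q" "Q \<subseteq> A" "\<And>x. x \<in> A \<Longrightarrow> act (pr {..<m}) x = x \<Longrightarrow> \<exists>y\<in>Q. x - y \<in> B0"
    using fin_quot[of m] by blast
  have "\<exists>\<chi>. (\<forall>x\<in>A. \<forall>x'\<in>A. \<chi> (x + x') \<equiv>\<^sub>p \<chi> x + \<chi> x') \<and> (\<forall>b\<in>B. \<chi> b \<equiv>\<^sub>p 0) \<and> \<not> \<chi> y \<equiv>\<^sub>p 0"
    if "y \<in> Q - B" for y
    by (rule separating_character[OF A_sgrp B_sgrp B_A p, of y])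
      (use torsion B0_B Q that in blast)+
  then obtain \<chi> where \<chi>: "\<And>y x x'. y \<in> Q - B \<Longrightarrow> x \<in> A \<Longrightarrow> x' \<in> A \<Longrightarrow> \<chi> y (x + x') \<equiv>\<^sub>p \<chi> y x + \<chi> y x'"
    "\<And>y b. y \<in> Q - B \<Longrightarrow> b \<in> B \<Longrightarrow> \<chi> y b \<equiv>\<^sub>p 0" "\<And>y. y \<in> Q - B \<Longrightarrow> \<not> \<chi> y y \<equiv>\<^sub>p 0"
    by metis
  define h where "h x = (\<Prod>y\<in>Q - B. 1 - (\<chi> y (?\<pi> x) - \<chi> y (?\<pi> x0)) ^ (p - 1))" for x
  have \<pi>A: "?\<pi> x \<in> A" if "x \<in> A" for x using act_A that by blast
  have \<pi>End: "pr (W \<union> F) \<in> End W" by (rule pr_End) auto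
  have diff: "\<chi> y (a - b) \<equiv>\<^sub>p \<chi> y a - \<chi> y b" if "y \<in> Q - B" "a \<in> A" "b \<in> A" for y a b
  proof -
    have "\<chi> y (a - b + b) \<equiv>\<^sub>p \<chi> y (a - b) + \<chi> y b" using that by (intro \<chi>(1) A_diff)
    then have "\<chi> y a - \<chi> y b \<equiv>\<^sub>p \<chi> y (a - b) + \<chi> y b - \<chi> y b" by (intro cong_diff) auto
    then show ?thesis by (simp add: cong_sym)
  qed
  have "char (\<lambda>x. \<chi> y (?\<pi> x))" if y: "y \<in> Q - B" for y
    unfolding char_def
  proof (intro conjI ballI)
    show "\<exists>F. finite F \<and> supported F (\<lambda>x. \<chi> y (?\<pi> x))"
      using assms(1) by (intro exI[of _ F]) (auto simp: supported_def act_pr_pr)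
  qed (use \<chi>(1,2)[OF y] \<pi>A act_B \<pi>End act_add in auto)
  then have "Pol 1 (\<lambda>x. \<chi> y (?\<pi> x) - \<chi> y (?\<pi> x0))" if "y \<in> Q - B" for y
    using that by (intro Pol_diff Pol_char Pol.const) auto
  then have "\<exists>m. Pol m (\<lambda>x. 1 - (\<chi> y (?\<pi> x) - \<chi> y (?\<pi> x0)) ^ (p - 1))" if "y \<in> Q - B" for y
    using Pol_power[of 1 _ "p - 1"] Pol_diff Pol.const that by meson
  then obtain n where "Pol n h"
    using Pol_prod[of "Q - B" "\<lambda>y x. 1 - (\<chi> y (?\<pi> x) - \<chi> y (?\<pi> x0)) ^ (p - 1)"] Q(1)
    unfolding h_def by auto
  moreover have "h x \<equiv>\<^sub>p (if ?\<pi> x - ?\<pi> x0 \<in> B then 1 else 0)" if x: "x \<in> A" for x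
  proof (cases "?\<pi> x - ?\<pi> x0 \<in> B")
    case True
    have "1 - (\<chi> y (?\<pi> x) - \<chi> y (?\<pi> x0)) ^ (p - 1) \<equiv>\<^sub>p 1" if y: "y \<in> Q - B" for y
    proof -
      have "\<chi> y (?\<pi> x) - \<chi> y (?\<pi> x0) \<equiv>\<^sub>p 0"
        by (rule ceq_left[OF diff[OF y \<pi>A[OF x] \<pi>A[OF assms(2)]] \<chi>(2)[OF y True]])
      then have "1 - (\<chi> y (?\<pi> x) - \<chi> y (?\<pi> x0)) ^ (p - 1) \<equiv>\<^sub>p 1 - 0 ^ (p - 1)"
        by (intro cong_diff cong_pow) auto
      then show ?thesis using prime_gt_1_nat[OF p] by (simp add: zero_power)
    qed
    then have "h x \<equiv>\<^sub>p (\<Prod>y\<in>Q - B. 1)" unfolding h_def by (intro cong_prod)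
    then show ?thesis using True by simp
  next
    case False
    define z where "z = ?\<pi> x - ?\<pi> x0"
    have zA: "z \<in> A" unfolding z_def by (intro A_diff \<pi>A x assms(2))
    have "act (pr {..<m}) z = z"
      using m by (auto simp: z_def act_diff act_pr_pr Int_absorb1)
    then obtain y where y: "y \<in> Q" "z - y \<in> B0" using Q(3) zA by blast
    have yB: "y \<in> Q - B"
      using y False B0_B B_sgrp sgrp_add[of B "z - y" y] unfolding z_def by auto
    have "\<chi> y z - \<chi> y y \<equiv>\<^sub>p 0"
      using y B0_B Q(2) by (intro ceq_left[OF diff[OF yB zA, of y] \<chi>(2)[OF yB, of "z - y"]]) auto
    then have "\<chi> y z \<equiv>\<^sub>p \<chi> y y" by (simp add: cong_iff_dvd_diff)
    then have "\<not> \<chi> y z \<equiv>\<^sub>p 0" using \<chi>(3)[OF yB] ceq_left[of "\<chi> y z" "\<chi> y y" 0] by blast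
    define c where "c = \<chi> y (?\<pi> x) - \<chi> y (?\<pi> x0)"
    have "\<not> c \<equiv>\<^sub>p 0"
      using diff[OF yB \<pi>A[OF x] \<pi>A[OF assms(2)]] \<open>\<not> \<chi> y z \<equiv>\<^sub>p 0\<close> unfolding c_def z_def[symmetric]
      using cong_trans by blast
    moreover define d where "d = nat (c mod int p)"
    have cd: "c \<equiv>\<^sub>p int d" using prime_gt_0_nat[OF p] by (simp add: d_def cong_def)
    ultimately have "\<not> int d \<equiv>\<^sub>p 0" using cong_trans[OF cd] by blast
    then have "\<not> p dvd d" by (simp add: cong_0_iff)
    then have "[d ^ (p - 1) = 1] (mod p)" by (rule fermat_theorem[OF p])
    then have "int d ^ (p - 1) \<equiv>\<^sub>p 1" by (metis cong_int_iff of_nat_1 of_nat_power)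
    then have "c ^ (p - 1) \<equiv>\<^sub>p 1" by (rule cong_trans[OF cong_pow[OF cd]])
    then have "1 - c ^ (p - 1) \<equiv>\<^sub>p 1 - 1" by (intro cong_diff) auto
    then have "int p dvd 1 - c ^ (p - 1)" by (simp add: cong_0_iff)
    then have "int p dvd h x"
      unfolding h_def c_def using yB Q(1) by (meson dvd_prodI dvd_trans finite_Diff)
    then show ?thesis using False by (simp add: cong_0_iff)
  qed
  ultimately show ?thesis by blast
qed

end

section \<open>Extensions by a simple functor\<close>

context poly_action
begin

text \<open>\<open>pr (- (U - V))\<close> sets the newly frozen coordinates to zero, so the second
  summand ranges over the elements of \<open>B'\<close> that use only coordinates in
  \<open>V\<close> and outside \<open>U\<close>.\<close>

definition ext :: "nat set \<Rightarrow> nat set \<Rightarrow> 'g set \<Rightarrow> 'g set \<Rightarrow> 'g set"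
  where "ext V U B B' = {b + act (pr (- (U - V))) r | b r. b \<in> B \<and> r \<in> B'}"

lemma extI: "b \<in> B \<Longrightarrow> r \<in> B' \<Longrightarrow> b + act (pr (- (U - V))) r \<in> ext V U B B'"
  by (auto simp: ext_def)

text \<open>Columns in \<open>V\<close> are fixed and columns outside \<open>U\<close> stay outside
  \<open>U\<close>; nothing moves into \<open>U - V\<close>. This is why \<open>ext V U B B'\<close>
  is stable under \<open>End U\<close>.\<close>

lemma shift_cmul:
  assumes "g \<in> End U"
  shows "pr (- (U - V)) \<bullet> g \<bullet> pr (- (U - V)) = g \<bullet> pr (- (U - V))"
proof
  fix i
  show "(pr (- (U - V)) \<bullet> g \<bullet> pr (- (U - V))) i = (g \<bullet> pr (- (U - V))) i"
  proof (cases "i \<in> U")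
    case True
    then show ?thesis using Hom_D1[OF assms True] by (simp add: cmul_def pr_def)
  next
    case False
    then have "Poly_Mapping.keys (g i) \<subseteq> - (U - V)" using Hom_D2[OF assms False] by auto
    moreover have "(g \<bullet> pr (- (U - V))) i = g i" using False by (simp add: cmul_pr)
    ultimately show ?thesis by (simp add: cmul_def[of "pr _"] frag_extend_pr_id)
  qed
qed

lemma ext_stab:
  assumes B: "stab V B" and B': "stab V B'" and BB': "B \<subseteq> B'" and VU: "V \<subseteq> U"
  shows "stab U (ext V U B B')" "ext V U B B' \<subseteq> B'" "B \<subseteq> ext V U B B'"
proof -
  let ?i = "pr (- (U - V))"
  have i: "?i \<in> End V" using VU by (intro pr_End) auto
  show sub: "ext V U B B' \<subseteq> B'"
    using BB' stabD[OF B'] i by (auto simp: ext_def intro!: sgrp_add)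
  show B_sub: "B \<subseteq> ext V U B B'"
  proof
    fix b assume "b \<in> B"
    from extI[OF this, of 0 B' U V] show "b \<in> ext V U B B'"
      using sgrp_0[OF stabD(1)[OF B']] by simp
  qed
  show "stab U (ext V U B B')"
    unfolding stab_def
  proof (intro conjI ballI)
    show "B0 \<subseteq> ext V U B B'" using B_sub stabD[OF B] by blast
    show "ext V U B B' \<subseteq> A" using sub stabD[OF B'] by blast
    show "sgrp (ext V U B B')"
      unfolding sgrp_def
    proof (intro conjI ballI)
      show "0 \<in> ext V U B B'" using B_sub sgrp_0[OF stabD(1)[OF B]] by blast
      fix x y assume "x \<in> ext V U B B'" "y \<in> ext V U B B'"
      then obtain b r b' r' where *: "b \<in> B" "r \<in> B'" "b' \<in> B" "r' \<in> B'"
        "x = b + act ?i r" "y = b' + act ?i r'" by (auto simp: ext_def)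
      then have eq: "x - y = (b - b') + act ?i (r - r')" by (simp add: act_diff)
      have "b - b' \<in> B" "r - r' \<in> B'"
        using * stabD(1)[OF B] stabD(1)[OF B'] by (simp_all add: sgrp_diff)
      then show "x - y \<in> ext V U B B'" unfolding eq by (rule extI)
    qed
    fix g x assume g: "g \<in> End U" and "x \<in> ext V U B B'"
    then obtain b r where *: "b \<in> B" "r \<in> B'" "x = b + act ?i r" by (auto simp: ext_def)
    have gV: "g \<in> End V" using g Hom_mono[OF VU] by (rule subsetD[rotated])
    have "act g x = act g b + act ?i (act (g \<bullet> ?i) r)"
      using * shift_cmul[OF g, of V] by (simp add: act_add flip: act_cmul)
    moreover have "act (g \<bullet> ?i) r \<in> B'" by (rule stabD(4)[OF B' End_cmul[OF gV i] *(2)])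
    ultimately show "act g x \<in> ext V U B B'"
      using extI[OF stabD(4)[OF B gV *(1)]] by simp
  qed
qed

lemma wqo_on_subset: "wqo_on W B X \<Longrightarrow> X' \<subseteq> X \<Longrightarrow> wqo_on W B X'"
  unfolding wqo_on_def by (meson subset_trans)

lemma wqo_on_subsequence:
  fixes s :: "nat \<Rightarrow> nat"
  assumes "wqo_on W B X" "strict_mono s" "\<And>i. T (s i) \<in> X"
  shows "\<exists>i j. i < j \<and> (\<exists>g\<in>End W. act g (T j) - T i \<in> B)"
proof -
  have "range (T \<circ> s) \<subseteq> X" using assms(3) by auto
  then obtain i j g where ij: "i < j" "g \<in> End W" "act g ((T \<circ> s) j) - (T \<circ> s) i \<in> B"
    using assms(1) unfolding wqo_on_def by blast
  then have "act g (T (s j)) - T (s i) \<in> B" by simp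
  moreover have "s i < s j" by (rule strict_monoD[OF assms(2) ij(1)])
  ultimately show ?thesis using ij(2)
    by (intro exI[of _ "s i"] exI[of _ "s j"] conjI bexI[of _ g])
qed

end

text \<open>\<open>V\<close> is the level at which \<open>B'/B\<close> is simple, \<open>W\<close>
  the level at which well-quasi-ordering is wanted. The assumption \<open>wqo_ext\<close> covers all
  larger \<open>U\<close> because the argument also freezes coordinates on which the auxiliary
  function is pure.\<close>

locale simple_extension = level act A B0 p D W B
  for act :: "cmat \<Rightarrow> 'g::ab_group_add \<Rightarrow> 'g" and A B0 :: "'g set" and p D :: nat
    and W :: "nat set" and B :: "'g set" +
  fixes V :: "nat set" and B' :: "'g set"
  assumes VW: "V \<subseteq> W" and stab_VB: "stab V B" and stab_B': "stab V B'"
    and BB': "B \<subseteq> B'"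
    and minimal: "\<And>C. stab V C \<Longrightarrow> B \<subseteq> C \<Longrightarrow> C \<subseteq> B' \<Longrightarrow> C = B \<or> C = B'"
    and wqo_ext: "\<And>U. finite U \<Longrightarrow> W \<subseteq> U \<Longrightarrow> wqo_on U (ext V U B B') A"
begin

abbreviation R :: "'g set" where "R \<equiv> ext V W B B'"

lemmas R_stab = ext_stab(1)[OF stab_VB stab_B' BB' VW]
  and R_B' = ext_stab(2)[OF stab_VB stab_B' BB' VW]
  and B_R = ext_stab(3)[OF stab_VB stab_B' BB' VW]
lemmas R_sgrp = stabD(1)[OF R_stab] and R_A = stabD(3)[OF R_stab] and act_R = stabD(4)[OF R_stab]
lemmas B'_sgrp = stabD(1)[OF stab_B'] and act_B' = stabD(4)[OF stab_B'] and act_VB = stabD(4)[OF stab_VB]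

lemma pr_W_shift: "pr W \<bullet> pr (- (W - V)) = pr V"
proof -
  have "W \<inter> - (W - V) = V" using VW by auto
  then show ?thesis by simp
qed

text \<open>If \<open>B'/B\<close> has a nonzero constant part, simplicity makes it constant: each
  element of \<open>B'\<close> agrees with its \<open>V\<close>-part modulo \<open>B\<close>. An
  element of \<open>R\<close> then lies in \<open>B\<close> as soon as its \<open>W\<close>-part
  does. Matrices in \<open>End W\<close> preserve \<open>W\<close>-parts, so it suffices to compare
  terms with equal \<open>W\<close>-parts modulo \<open>B0\<close>.\<close>

lemma wqo_constant:
  assumes rho: "\<rho> \<in> B'" "act (pr V) \<rho> \<notin> B"
  shows "wqo_on W B A"
proof -
  define C where "C = {x \<in> B'. x - act (pr V) x \<in> B}"
  have BC: "B \<subseteq> C"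
  proof
    fix b assume b: "b \<in> B"
    have "act (pr V) b \<in> B" by (rule act_VB[OF pr_End b]) simp
    then have "b - act (pr V) b \<in> B" by (rule sgrp_diff[OF B_sgrp b])
    then show "b \<in> C" using b BB' by (auto simp: C_def)
  qed
  have "stab V C"
    unfolding stab_def
  proof (intro conjI ballI)
    show "B0 \<subseteq> C" using BC B0_B by blast
    show "C \<subseteq> A" using stabD(3)[OF stab_B'] by (auto simp: C_def)
    show "sgrp C"
      unfolding sgrp_def
    proof (intro conjI ballI)
      show "0 \<in> C" using sgrp_0[OF B'_sgrp] sgrp_0[OF B_sgrp] by (simp add: C_def)
      fix x y assume xy: "x \<in> C" "y \<in> C"
      have "x - y - act (pr V) (x - y) = (x - act (pr V) x) - (y - act (pr V) y)"
        by (simp add: act_diff)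
      also have "\<dots> \<in> B" using xy unfolding C_def by (intro sgrp_diff[OF B_sgrp, of "x - _" "y - _"]) simp_all
      finally have "x - y - act (pr V) (x - y) \<in> B" .
      moreover have "x - y \<in> B'" using xy unfolding C_def by (intro sgrp_diff[OF B'_sgrp]) simp_all
      ultimately show "x - y \<in> C" by (simp add: C_def)
    qed
    fix g x assume g: "g \<in> End V" and x: "x \<in> C"
    have "act g x - act (pr V) (act g x) = act g (x - act (pr V) x)"
      using End_cmul_pr[OF g] pr_cmul_End[OF g] by (simp add: act_diff flip: act_cmul)
    also have "\<dots> \<in> B" using x unfolding C_def by (intro act_VB[OF g]) simp
    finally have "act g x - act (pr V) (act g x) \<in> B" .
    moreover have "act g x \<in> B'" using x unfolding C_def by (intro act_B'[OF g]) simp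
    ultimately show "act g x \<in> C" by (simp add: C_def)
  qed
  moreover have "act (pr V) \<rho> \<in> C"
    using rho sgrp_0[OF B_sgrp] act_B'[OF pr_End rho(1), of V] by (simp add: C_def act_pr_pr)
  ultimately have CB': "C = B'" using minimal[OF _ BC] rho(2) unfolding C_def by blast
  have R_const: "x \<in> B" if x: "x \<in> R" "act (pr W) x \<in> B" for x
  proof -
    let ?i = "pr (- (W - V))"
    obtain b r where br: "b \<in> B" "r \<in> B'" "x = b + act ?i r" using x by (auto simp: ext_def)
    have "act (pr W) x = act (pr W) b + act (pr V) r"
      using br pr_W_shift by (simp add: act_add flip: act_cmul)
    moreover have "act (pr W) b \<in> B" by (rule act_B[OF pr_End br(1)]) simp
    ultimately have V: "act (pr V) r \<in> B" using sgrp_diff[OF B_sgrp x(2)] by (metis add_diff_cancel_left')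
    have "act ?i (r - act (pr V) r) \<in> B"
    proof (rule act_VB)
      show "?i \<in> End V" using VW by (intro pr_End) auto
      show "r - act (pr V) r \<in> B" using CB' br by (auto simp: C_def)
    qed
    moreover have "act ?i (act (pr V) r) = act (pr V) r"
    proof -
      have "- (W - V) \<inter> V = V" by auto
      then show ?thesis by (simp add: act_pr_pr)
    qed
    ultimately have "act ?i r - act (pr V) r \<in> B" by (simp add: act_diff)
    then have "act ?i r \<in> B" using V by (rule sgrp_cong_mem[OF B_sgrp])
    then show ?thesis using br(1,3) sgrp_add[OF B_sgrp] by simp
  qed
  show ?thesis
    unfolding wqo_on_def
  proof (intro allI impI)
    fix T :: "nat \<Rightarrow> 'g" assume T: "range T \<subseteq> A"
    obtain m where m: "W \<subseteq> {..<m}" using fin_W by (meson finite_nat_iff_bounded)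
    obtain Q where Q: "finite Q" "\<And>x. x \<in> A \<Longrightarrow> act (pr {..<m}) x = x \<Longrightarrow> \<exists>y\<in>Q. x - y \<in> B0"
      using fin_quot[of m] by blast
    have "\<exists>y\<in>Q. act (pr W) (T i) - y \<in> B0" for i
    proof (rule Q(2))
      show "act (pr W) (T i) \<in> A" using T by (intro act_A) auto
      show "act (pr {..<m}) (act (pr W) (T i)) = act (pr W) (T i)" using m by (simp add: act_pr_pr Int_absorb1)
    qed
    then obtain c where c: "\<And>i. c i \<in> Q" "\<And>i. act (pr W) (T i) - c i \<in> B0" by metis
    \<comment> \<open>The \<open>W\<close>-parts fall into finitely many classes modulo
      \<open>B0\<close>, so one class recurs.\<close>
    have "\<exists>y. infinite {i. c i = y}"
    proof (rule ccontr)
      assume "\<not> ?thesis"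
      then have "finite (\<Union>y\<in>Q. {i. c i = y})" using Q(1) by blast
      moreover have "(\<Union>y\<in>Q. {i. c i = y}) = UNIV" using c(1) by auto
      ultimately show False by simp
    qed
    then obtain y where "infinite {i. c i = y}" by blast
    from infinite_enumerate[OF this] obtain s :: "nat \<Rightarrow> nat" where s: "strict_mono s" "\<forall>i. c (s i) = y" by auto
    have "range (T \<circ> s) \<subseteq> A" using T by auto
    then obtain i j g where ij: "i < j" "g \<in> End W" "act g ((T \<circ> s) j) - (T \<circ> s) i \<in> R"
      using wqo_ext[OF fin_W order.refl] unfolding wqo_on_def by blast
    then have ij: "i < j" "g \<in> End W" "act g (T (s j)) - T (s i) \<in> R" by simp_all
    have "act (pr W) (act g (T (s j)) - T (s i))
        = (act (pr W) (T (s j)) - c (s j)) - (act (pr W) (T (s i)) - c (s i))"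
      using pr_cmul_End[OF ij(2)] s(2) by (simp add: act_diff flip: act_cmul)
    also have "\<dots> \<in> B" by (rule sgrp_diff[OF B_sgrp subsetD[OF B0_B c(2)] subsetD[OF B0_B c(2)]])
    finally have "act g (T (s j)) - T (s i) \<in> B" using R_const ij(3) by blast
    then show "\<exists>i j. i < j \<and> (\<exists>g\<in>End W. act g (T j) - T i \<in> B)"
      using ij(2) strict_monoD[OF s(1) ij(1)] by blast
  qed
qed

section \<open>Closed sets and the descending chain condition\<close>

definition closed_set :: "'g set \<Rightarrow> bool"
  where "closed_set X \<longleftrightarrow> X \<subseteq> A \<and> (\<forall>g\<in>End W. \<forall>x\<in>X. act g x \<in> X) \<and> (\<forall>x\<in>X. \<forall>b\<in>B. x + b \<in> X)"

lemma closed_setD: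
  assumes "closed_set X"
  shows "X \<subseteq> A" "\<And>g x. g \<in> End W \<Longrightarrow> x \<in> X \<Longrightarrow> act g x \<in> X" "\<And>x b. x \<in> X \<Longrightarrow> b \<in> B \<Longrightarrow> x + b \<in> X"
  using assms by (auto simp: closed_set_def)

definition saturated :: "'g set \<Rightarrow> bool"
  where "saturated Y \<longleftrightarrow> closed_set Y \<and> (\<forall>x\<in>Y. \<forall>r\<in>R. x + r \<in> Y)"

text \<open>Well-quasi-ordering modulo \<open>R\<close> gives noetherianity: pick \<open>T i\<close>
  in \<open>Y i\<close> but not in \<open>Y (Suc i)\<close>. A comparison of \<open>T j\<close> with
  \<open>T i\<close> modulo \<open>R\<close> for \<open>i < j\<close> would put \<open>T i\<close>
  into \<open>Y (Suc i)\<close>.\<close>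

lemma wf_saturated: "wf {(Y', Y). saturated Y' \<and> saturated Y \<and> Y' \<subset> Y}"
  unfolding wf_iff_no_infinite_down_chain
proof
  assume "\<exists>Y. \<forall>i. (Y (Suc i), Y i) \<in> {(Y', Y). saturated Y' \<and> saturated Y \<and> Y' \<subset> Y}"
  then obtain Y where "\<forall>i. (Y (Suc i), Y i) \<in> {(Y', Y). saturated Y' \<and> saturated Y \<and> Y' \<subset> Y}" ..
  then have Y: "\<And>i. saturated (Y i)" "\<And>i. Y (Suc i) \<subset> Y i" by simp_all
  then have "\<forall>i. \<exists>x. x \<in> Y i \<and> x \<notin> Y (Suc i)" by blast
  then obtain T where T: "\<And>i. T i \<in> Y i" "\<And>i. T i \<notin> Y (Suc i)" by metis
  have "range T \<subseteq> A" using T(1) Y(1) closed_setD(1) by (fastforce simp: saturated_def)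
  then obtain i j g where ij: "i < j" "g \<in> End W" "act g (T j) - T i \<in> R"
    using wqo_ext[OF fin_W order.refl] unfolding wqo_on_def by blast
  have "antimono Y" using Y(2) by (intro decseq_SucI) auto
  then have "Y j \<subseteq> Y (Suc i)" using ij(1) by (simp add: antimonoD)
  then have "act g (T j) \<in> Y (Suc i)"
    using T(1)[of j] Y(1)[of "Suc i"] ij(2) closed_setD(2) by (auto simp: saturated_def)
  moreover have "T i - act g (T j) \<in> R" using sgrp_diff_commute[OF R_sgrp ij(3)] .
  ultimately have "act g (T j) + (T i - act g (T j)) \<in> Y (Suc i)"
    using Y(1)[of "Suc i"] unfolding saturated_def by blast
  then show False using T(2)[of i] by simp
qed

section \<open>Admissible functions and their behaviour under shifts\<close>

definition adm :: "nat \<Rightarrow> 'g set \<Rightarrow> 'g set \<Rightarrow> nat set \<Rightarrow> ('g \<Rightarrow> int) \<Rightarrow> bool"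
  where "adm n X Y S h \<longleftrightarrow> Pol n h \<and> finite S \<and> S \<inter> W = {} \<and> (\<forall>x\<in>X. h x \<equiv>\<^sub>p 0) \<and>
    (\<forall>x\<in>Y. h (act (pr (W \<union> S)) x) \<equiv>\<^sub>p h x) \<and> (\<forall>i\<in>S. \<forall>x\<in>Y. h (act (kill i) x) \<equiv>\<^sub>p 0) \<and>
    (\<exists>y\<in>Y. \<not> h y \<equiv>\<^sub>p 0)"

text \<open>A witness of least support size is automatically pure on its support: were its composite
  with \<open>kill i\<close> nonzero somewhere on \<open>Y\<close>, composing with
  \<open>pr (W \<union> (S - {i}))\<close> would give a witness with smaller support. The composite
  still vanishes on \<open>X\<close> because \<open>X\<close> is closed.\<close>

lemma adm_exists:
  assumes X: "closed_set X" and Y: "closed_set Y" and h: "Pol n h" "\<And>x. x \<in> X \<Longrightarrow> h x \<equiv>\<^sub>p 0"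
    and y: "y \<in> Y" "\<not> h y \<equiv>\<^sub>p 0"
  obtains S h where "adm n X Y S h"
proof -
  define P where "P k \<longleftrightarrow> (\<exists>S h. card S = k \<and> Pol n h \<and> finite S \<and> S \<inter> W = {} \<and> (\<forall>x\<in>X. h x \<equiv>\<^sub>p 0) \<and>
    (\<forall>x\<in>Y. h (act (pr (W \<union> S)) x) \<equiv>\<^sub>p h x) \<and> (\<exists>y\<in>Y. \<not> h y \<equiv>\<^sub>p 0))" for k
  obtain F where F: "finite F" "F \<inter> W = {}" "supported F h" using Pol_supported[OF h(1)] .
  have "\<forall>x\<in>Y. h (act (pr (W \<union> F)) x) \<equiv>\<^sub>p h x" using F(3) closed_setD(1)[OF Y] by (auto simp: supported_def)
  then have "P (card F)" unfolding P_def using F h y by blast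
  then have "P (LEAST k. P k)" and least: "\<And>k. P k \<Longrightarrow> (LEAST k. P k) \<le> k"
    by (auto intro: LeastI Least_le)
  then obtain S h where S: "card S = (LEAST k. P k)" "Pol n h" "finite S" "S \<inter> W = {}"
    "\<forall>x\<in>X. h x \<equiv>\<^sub>p 0" "\<forall>x\<in>Y. h (act (pr (W \<union> S)) x) \<equiv>\<^sub>p h x" "\<exists>y\<in>Y. \<not> h y \<equiv>\<^sub>p 0"
    unfolding P_def by blast
  have "h (act (kill i) x) \<equiv>\<^sub>p 0" if i: "i \<in> S" and x: "x \<in> Y" for i x
  proof -
    let ?g = "pr (W \<union> (S - {i}))"
    have g: "?g \<in> End W" by (rule pr_End) auto
    have Si: "(W \<union> (S - {i})) \<inter> (W \<union> S) = W \<union> (S - {i})" by auto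
    have eq: "(W \<union> S) \<inter> - {i} = W \<union> (S - {i})" using i S(4) by auto
    have "\<not> P (card (S - {i}))"
      using least[of "card (S - {i})"] S(1,3) i card_Diff1_less[of S i] by linarith
    moreover have "Pol n (\<lambda>x. h (act ?g x))"
      by (rule Pol_act[OF S(2) g S(3)]) (simp add: Si)
    moreover have "\<forall>x\<in>X. h (act ?g x) \<equiv>\<^sub>p 0" using S(5) closed_setD(2)[OF X g] by blast
    moreover have "\<forall>x\<in>Y. h (act ?g (act ?g x)) \<equiv>\<^sub>p h (act ?g x)" by (simp add: act_pr_pr)
    ultimately have "\<forall>y\<in>Y. h (act ?g y) \<equiv>\<^sub>p 0"
      unfolding P_def using S(3,4) by blast
    then have "h (act (pr (W \<union> S)) (act (kill i) x)) \<equiv>\<^sub>p 0"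
      using x by (simp add: act_pr_pr eq)
    moreover have "act (kill i) x \<in> Y" using closed_setD(2)[OF Y pr_End x, of "- {i}"] i S(4) by auto
    ultimately show ?thesis using S(6) ceq_left by blast
  qed
  then show ?thesis using that[of S h] S unfolding adm_def by blast
qed

definition adm_max :: "nat \<Rightarrow> 'g set \<Rightarrow> 'g set \<Rightarrow> nat set \<Rightarrow> ('g \<Rightarrow> int) \<Rightarrow> bool"
  where "adm_max n X Y S h \<longleftrightarrow> adm n X Y S h \<and> (\<forall>S' h'. adm n X Y S' h' \<longrightarrow> card S' \<le> card S)"

lemma adm_maximal:
  assumes Y: "closed_set Y" and ex: "adm n X Y S0 h0"
  obtains S h where "adm_max n X Y S h"
proof -
  define P where "P k \<longleftrightarrow> (\<exists>S h. card S = k \<and> adm n X Y S h)" for k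
  have "k \<le> n * D" if "P k" for k
  proof -
    from that obtain S h where S: "card S = k" "adm n X Y S h" unfolding P_def by blast
    then obtain y where "y \<in> Y" "\<not> h y \<equiv>\<^sub>p 0" by (auto simp: adm_def)
    with S show ?thesis
      using Pol_pure_bound[of n h S Y y] closed_setD[OF Y] unfolding adm_def by blast
  qed
  moreover have "P (card S0)" using ex by (auto simp: P_def)
  ultimately have "P (GREATEST k. P k)" "\<And>k. P k \<Longrightarrow> k \<le> (GREATEST k. P k)"
    by (metis GreatestI_nat, metis Greatest_le_nat)
  moreover from this(1) obtain S h where "card S = (GREATEST k. P k)" "adm n X Y S h"
    unfolding P_def by blast
  ultimately show ?thesis using that[of S h] unfolding adm_max_def P_def by metis
qed

lemma admD:
  assumes "adm n X Y S h"
  shows "Pol n h" "finite S" "S \<inter> W = {}" "x \<in> X \<Longrightarrow> h x \<equiv>\<^sub>p 0"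
    "y \<in> Y \<Longrightarrow> h (act (pr (W \<union> S)) y) \<equiv>\<^sub>p h y" "i \<in> S \<Longrightarrow> y \<in> Y \<Longrightarrow> h (act (kill i) y) \<equiv>\<^sub>p 0"
  using assms by (simp_all add: adm_def)

lemma fresh_index:
  assumes "finite S" obtains i where "i \<notin> S" "i \<notin> W"
  using ex_new_if_finite[of "S \<union> W"] assms fin_W by auto

lemma adm_vanish:
  assumes "adm n X Y S h" "closed_set Y" "g \<in> End W" "j \<in> S" "kill j \<bullet> g = g" "y \<in> Y"
  shows "h (act g y) \<equiv>\<^sub>p 0"
proof -
  have "h (act (kill j) (act g y)) \<equiv>\<^sub>p 0"
    using assms closed_setD(2)[OF assms(2,3,6)] by (intro admD(6)[OF assms(1)])
  then show ?thesis using assms(5) by (simp flip: act_cmul)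
qed

text \<open>Row additivity: folding a fresh coordinate \<open>k\<close> into \<open>i\<close> is additive because
  the failure of additivity would be an admissible function on one more coordinate.\<close>

lemma adm_fold:
  assumes max: "adm_max n X Y S h" and X: "closed_set X" and Y: "closed_set Y" and XY: "X \<subseteq> Y"
    and i: "i \<in> S" and k: "k \<notin> S" "k \<notin> W"
    and z: "z \<in> Y" "act (pr (W \<union> insert k S)) z = z"
  defines "\<tau> \<equiv> frag_of(k := frag_of i)"
  shows "h (act \<tau> z) \<equiv>\<^sub>p h (act (pr (W \<union> S)) z) + h (act (\<tau> \<bullet> pr (W \<union> insert k (S - {i}))) z)"
proof -
  have adm: "adm n X Y S h" using max by (simp add: adm_max_def)
  note h = admD[OF adm]
  define S' where "S' = insert k S"
  define g1 where "g1 = \<tau> \<bullet> pr (W \<union> S')"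
  define g2 where "g2 = pr (W \<union> S)"
  define g3 where "g3 = \<tau> \<bullet> pr (W \<union> insert k (S - {i}))"
  have iW: "i \<notin> W" "i \<noteq> k" using i h(3) k by auto
  have \<tau>: "\<tau> \<in> End W" using k iW by (auto simp: \<tau>_def Hom_def)
  have gE: "g1 \<in> End W" "g2 \<in> End W" "g3 \<in> End W"
    unfolding g1_def g2_def g3_def by (auto intro!: End_cmul \<tau> pr_End)
  have g_supp: "g \<bullet> pr (W \<union> S') = g" if "g \<in> {g1, g2, g3}" for g
    using that by (auto simp: g1_def g2_def g3_def S'_def cmul_assoc)
      (auto simp: fun_eq_iff cmul_pr pr_def)
  define h' where "h' x = h (act g1 x) - h (act g2 x) - h (act g3 x)" for x
  have "h' z \<equiv>\<^sub>p 0"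
  proof (rule ccontr)
    assume nz: "\<not> h' z \<equiv>\<^sub>p 0"
    have "adm n X Y S' h'"
      unfolding adm_def
    proof (intro conjI ballI)
      show "Pol n h'"
        unfolding h'_def using h(1,2) gE g_supp
        by (intro Pol_diff Pol_act[of _ _ _ S']) (auto simp: S'_def)
      show "finite S'" "S' \<inter> W = {}" using h k by (auto simp: S'_def)
      show "h' x \<equiv>\<^sub>p 0" if "x \<in> X" for x
      proof -
        have "h' x \<equiv>\<^sub>p 0 - 0 - 0"
          unfolding h'_def using closed_setD(2)[OF X _ that] gE by (intro cong_diff h(4))
        then show ?thesis by simp
      qed
      show "h' (act (pr (W \<union> S')) x) \<equiv>\<^sub>p h' x" for x
        using g_supp by (simp add: h'_def flip: act_cmul)
      show "\<exists>y\<in>Y. \<not> h' y \<equiv>\<^sub>p 0" using nz z by blast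
      fix j x assume j: "j \<in> S'" and x: "x \<in> Y"
      have E: "g \<bullet> kill j \<in> End W" if "g \<in> End W" for g
        using that j k h(3) by (intro End_cmul pr_End) (auto simp: S'_def)
      have eq: "h' (act (kill j) x) = h (act (g1 \<bullet> kill j) x) - h (act (g2 \<bullet> kill j) x) - h (act (g3 \<bullet> kill j) x)"
        by (simp add: h'_def act_cmul)
      \<comment> \<open>Killing \<open>i\<close> makes \<open>g1\<close> and \<open>g3\<close> equal
        and sends the \<open>g2\<close> term to zero; killing \<open>k\<close> makes
        \<open>g1\<close> and \<open>g2\<close> equal and sends the \<open>g3\<close> term to zero.
        Any other \<open>j\<close> in \<open>S\<close> survives in all three matrices, and purity of
        \<open>h\<close> annihilates each term.\<close>
      consider "j = i" | "j = k" | "j \<in> S" "j \<noteq> i" using j by (auto simp: S'_def)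
      then show "h' (act (kill j) x) \<equiv>\<^sub>p 0"
      proof cases
        case 1
        have "g1 \<bullet> kill j = g3 \<bullet> kill j"
          using 1 k i by (auto simp: g1_def g3_def S'_def cmul_assoc fun_eq_iff cmul_pr)
        moreover have "h (act (g2 \<bullet> kill j) x) \<equiv>\<^sub>p 0"
          by (rule adm_vanish[OF adm Y E[OF gE(2)] i _ x])
            (simp add: g2_def 1 Int_ac)
        ultimately show ?thesis unfolding eq by (simp add: cong_iff_dvd_diff)
      next
        case 2
        have "g1 \<bullet> kill j = g2 \<bullet> kill j"
          using 2 k i by (auto simp: g1_def g2_def S'_def cmul_assoc fun_eq_iff cmul_pr \<tau>_def pr_def)
        moreover have "kill i \<bullet> g3 \<bullet> kill j = g3 \<bullet> kill j"
          using 2 k iW by (auto simp: g3_def S'_def cmul_assoc fun_eq_iff cmul_def \<tau>_def pr_def)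
        then have "h (act (g3 \<bullet> kill j) x) \<equiv>\<^sub>p 0"
          by (rule adm_vanish[OF adm Y E[OF gE(3)] i _ x])
        ultimately show ?thesis unfolding eq by (simp add: cong_iff_dvd_diff)
      next
        case 3
        have "h (act (g \<bullet> kill j) x) \<equiv>\<^sub>p 0" if g: "g \<in> {g1, g2, g3}" for g
        proof (rule adm_vanish[OF adm Y _ 3(1) _ x])
          show "g \<bullet> kill j \<in> End W" using g gE E by blast
          show "kill j \<bullet> g \<bullet> kill j = g \<bullet> kill j"
            using g 3 k by (auto simp: g1_def g2_def g3_def S'_def cmul_assoc fun_eq_iff cmul_def \<tau>_def pr_def)
        qed
        then have "h' (act (kill j) x) \<equiv>\<^sub>p 0 - 0 - 0" unfolding eq by (intro cong_diff) auto
        then show ?thesis by simp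
      qed
    qed
    then have "card S' \<le> card S" using max by (auto simp: adm_max_def)
    then show False using h(2) k by (simp add: S'_def)
  qed
  moreover have "act g1 z = act \<tau> z" using z by (simp add: g1_def S'_def act_cmul)
  ultimately show ?thesis
    by (simp add: h'_def g2_def g3_def cong_iff_dvd_diff algebra_simps)
qed

text \<open>The element \<open>z\<close> carries \<open>x\<close> at its usual place but
  \<open>r\<close> with coordinate \<open>i\<close> moved to the fresh \<open>k\<close>; folding
  \<open>k\<close> into \<open>i\<close> gives \<open>x + r\<close> up to the support of
  \<open>h\<close>. Additivity of folding splits the value: setting \<open>k\<close> to zero kills
  the moved \<open>r\<close>, by purity at \<open>i\<close>, and the other term is left with an
  \<open>x\<close> without coordinate \<open>i\<close>.\<close>

lemma adm_shift_one:
  assumes max: "adm_max n X Y S h" and X: "closed_set X" and Y: "saturated Y" and XY: "X \<subseteq> Y"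
    and C: "C \<subseteq> S" "i \<in> C" and r: "r \<in> R" "pure W C r" and x: "x \<in> Y"
  shows "h (x + r) \<equiv>\<^sub>p h x + h (act (pr (W \<union> (S - {i}))) x + r)"
proof -
  have adm: "adm n X Y S h" using max by (simp add: adm_max_def)
  note h = admD[OF adm]
  have Yc: "closed_set Y" using Y by (simp add: saturated_def)
  obtain k where k: "k \<notin> S" "k \<notin> W" using fresh_index[OF h(2)] .
  have i: "i \<in> S" "i \<notin> W" "i \<noteq> k" using C h(3) k by auto
  define \<tau> where "\<tau> = frag_of(k := frag_of i)"
  define \<sigma> where "\<sigma> = frag_of(k := frag_of i, i := frag_of k)"
  have \<sigma>: "\<sigma> \<in> End W" using k i by (auto simp: \<sigma>_def Hom_def)
  define x' where "x' = act (pr (W \<union> S)) x"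
  have pS: "pr (W \<union> S) \<in> End W" by (rule pr_End) simp
  have x': "x' \<in> Y" unfolding x'_def by (rule closed_setD(2)[OF Yc pS x])
  define z where "z = x' + act \<sigma> r"
  have z: "z \<in> Y" using Y x' act_R[OF \<sigma> r(1)] by (simp add: z_def saturated_def)
  have rC: "act (pr (W \<union> C)) r = r" using r by (simp add: pure_def)
  then have rS: "act (pr (W \<union> S)) r = r" using C by - (rule supp_mono[of "W \<union> C"], auto)
  have act_r: "act g r = act (g \<bullet> pr (W \<union> C)) r" for g using rC by (simp add: act_cmul)
  have act_x': "act g x' = act (g \<bullet> pr (W \<union> S)) x" for g by (simp add: x'_def act_cmul)
  have kC: "k \<notin> C" using C k by auto
  have 1: "act (pr (W \<union> insert k S)) z = z"
  proof -
    have "(W \<union> insert k S) \<inter> (W \<union> S) = W \<union> S" by auto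
    then have "act (pr (W \<union> insert k S)) x' = x'" by (simp add: x'_def act_pr_pr)
    moreover have "pr (W \<union> insert k S) \<bullet> \<sigma> \<bullet> pr (W \<union> C) = \<sigma> \<bullet> pr (W \<union> C)"
      using C i k by (auto simp: \<sigma>_def fun_eq_iff cmul_def pr_def)
    then have "act (pr (W \<union> insert k S)) (act \<sigma> r) = act \<sigma> r"
      using act_r[of "pr (W \<union> insert k S) \<bullet> \<sigma>"] act_r[of \<sigma>] by (simp add: act_cmul cmul_assoc)
    ultimately show ?thesis by (simp add: z_def act_add)
  qed
  have 2: "act \<tau> z = x' + r"
  proof -
    have "\<tau> \<bullet> pr (W \<union> S) = pr (W \<union> S)" using k by (auto simp: \<tau>_def fun_eq_iff cmul_def pr_def)
    then have "act \<tau> x' = x'" unfolding act_x' by (simp add: x'_def)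
    moreover have "\<tau> \<bullet> \<sigma> \<bullet> pr (W \<union> C) = pr (W \<union> C)"
      using k kC by (auto simp: \<tau>_def \<sigma>_def fun_eq_iff cmul_def pr_def)
    then have "act \<tau> (act \<sigma> r) = r" using rC act_r[of "\<tau> \<bullet> \<sigma>"] by (simp add: act_cmul cmul_assoc)
    ultimately show ?thesis by (simp add: z_def act_add)
  qed
  have 3: "act (pr (W \<union> S)) z = x'"
  proof -
    have "pr (W \<union> S) \<bullet> \<sigma> \<bullet> pr (W \<union> C) = pr (W \<union> C) \<bullet> kill i"
      using C i k kC by (auto simp: \<sigma>_def fun_eq_iff cmul_def pr_def)
    then have "act (pr (W \<union> S)) (act \<sigma> r) = act (pr (W \<union> C)) (act (kill i) r)"
      using act_r[of "pr (W \<union> S) \<bullet> \<sigma>"] by (simp add: cmul_assoc flip: act_cmul)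
    then have "act (pr (W \<union> S)) (act \<sigma> r) = 0" using r(2) C(2) by (simp add: pure_def)
    then show ?thesis by (simp add: z_def act_add x'_def act_pr_pr)
  qed
  have 4: "act (\<tau> \<bullet> pr (W \<union> insert k (S - {i}))) z = act (pr (W \<union> (S - {i}))) x + r"
  proof -
    have "(\<tau> \<bullet> pr (W \<union> insert k (S - {i}))) \<bullet> pr (W \<union> S) = pr (W \<union> (S - {i}))"
      using i k by (auto simp: \<tau>_def fun_eq_iff cmul_def pr_def)
    then have "act (\<tau> \<bullet> pr (W \<union> insert k (S - {i}))) x' = act (pr (W \<union> (S - {i}))) x"
      unfolding act_x' by simp
    moreover have "((\<tau> \<bullet> pr (W \<union> insert k (S - {i}))) \<bullet> \<sigma>) \<bullet> pr (W \<union> C) = pr (W \<union> C)"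
      using C i k kC by (auto simp: \<tau>_def \<sigma>_def fun_eq_iff cmul_def pr_def)
    then have "act (\<tau> \<bullet> pr (W \<union> insert k (S - {i}))) (act \<sigma> r) = r"
      using rC act_r[of "(\<tau> \<bullet> pr (W \<union> insert k (S - {i}))) \<bullet> \<sigma>"]
      by (simp flip: act_cmul)
    ultimately show ?thesis by (simp add: z_def act_add)
  qed
  have xr: "x + r \<in> Y" using Y x r by (simp add: saturated_def)
  have "h (x' + r) \<equiv>\<^sub>p h (x + r)"
    using h(5)[OF xr] rS by (simp add: act_add x'_def)
  moreover have "h x' \<equiv>\<^sub>p h x" using h(5)[OF x] by (simp add: x'_def)
  moreover have "h (x' + r) \<equiv>\<^sub>p h x' + h (act (pr (W \<union> (S - {i}))) x + r)"
    using adm_fold[OF max X Yc XY i(1) k z 1] 2 3 4 by (simp add: \<tau>_def)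
  ultimately have "h (x + r) \<equiv>\<^sub>p h x' + h (act (pr (W \<union> (S - {i}))) x + r)" by (metis ceq_left)
  moreover have "h x' + h (act (pr (W \<union> (S - {i}))) x + r) \<equiv>\<^sub>p h x + h (act (pr (W \<union> (S - {i}))) x + r)"
    by (rule cong_add[OF \<open>h x' \<equiv>\<^sub>p h x\<close> cong_refl])
  ultimately show ?thesis by (rule cong_trans)
qed

text \<open>The increment of \<open>h\<close> in direction \<open>r\<close> sees only the
  coordinates of \<open>x\<close> in \<open>W \<union> (S - C)\<close>. Each use of
  \<open>adm_shift_one\<close> erases one coordinate of \<open>C\<close> from \<open>x\<close>; the
  value of \<open>h\<close> after erasure is zero by purity, so it may be subtracted to keep the
  form of a difference.\<close>

lemma adm_shift:
  assumes max: "adm_max n X Y S h" and X: "closed_set X" and Y: "saturated Y" and XY: "X \<subseteq> Y"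
    and C: "C \<subseteq> S" and r: "r \<in> R" "pure W C r" and x: "x \<in> Y"
  shows "h (x + r) - h x \<equiv>\<^sub>p h (act (pr (W \<union> (S - C))) x + r) - h (act (pr (W \<union> (S - C))) x)"
proof -
  have adm: "adm n X Y S h" using max by (simp add: adm_max_def)
  note h = admD[OF adm]
  have Yc: "closed_set Y" using Y by (simp add: saturated_def)
  have "h (x + r) - h x \<equiv>\<^sub>p h (act (pr (W \<union> (S - E))) x + r) - h (act (pr (W \<union> (S - E))) x)"
    if "E \<subseteq> C" for E
    using finite_subset[OF that finite_subset[OF C h(2)]] that
  proof (induction E rule: finite_induct)
    case empty
    have "act (pr (W \<union> S)) r = r" 
      using r(2) C unfolding pure_def by - (rule supp_mono[of "W \<union> C" r "W \<union> S"], auto)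
    moreover have "x + r \<in> Y" using Y x r by (simp add: saturated_def)
    ultimately have "h (act (pr (W \<union> S)) x + r) \<equiv>\<^sub>p h (x + r)" using h(5)[of "x + r"] by (simp add: act_add)
    from cong_diff[OF this h(5)[OF x]] show ?case by (simp add: cong_sym)
  next
    case (insert i E)
    let ?y = "act (pr (W \<union> (S - E))) x"
    have y: "?y \<in> Y" by (rule closed_setD(2)[OF Yc pr_End x]) simp
    have iC: "i \<in> C" "i \<in> S" using insert C by auto
    then have iW: "i \<notin> W" using h(3) by auto
    have y': "act (pr (W \<union> (S - {i}))) ?y = act (pr (W \<union> (S - insert i E))) x"
      by (simp add: act_pr_pr) (rule arg_cong[where f="\<lambda>F. act (pr F) x"], use h(3) in auto)
    have v: "h (act (pr (W \<union> (S - insert i E))) x) \<equiv>\<^sub>p 0"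
    proof (rule adm_vanish[OF adm Yc pr_End iC(2) _ x])
      have "- {i} \<inter> (W \<union> (S - insert i E)) = W \<union> (S - insert i E)" using iW by auto
      then show "kill i \<bullet> pr (W \<union> (S - insert i E)) = pr (W \<union> (S - insert i E))" by simp
    qed simp
    have "h (?y + r) \<equiv>\<^sub>p h ?y + h (act (pr (W \<union> (S - insert i E))) x + r)"
      using adm_shift_one[OF max X Y XY C iC(1) r y] unfolding y' .
    then have "h (?y + r) - h ?y \<equiv>\<^sub>p h (act (pr (W \<union> (S - insert i E))) x + r) - 0"
      by (simp add: cong_iff_dvd_diff algebra_simps)
    moreover have "h (act (pr (W \<union> (S - insert i E))) x + r) - 0 \<equiv>\<^sub>p
        h (act (pr (W \<union> (S - insert i E))) x + r) - h (act (pr (W \<union> (S - insert i E))) x)"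
      by (rule cong_diff[OF cong_refl cong_sym[OF v]])
    ultimately have "h (?y + r) - h ?y \<equiv>\<^sub>p
        h (act (pr (W \<union> (S - insert i E))) x + r) - h (act (pr (W \<union> (S - insert i E))) x)"
      by (rule cong_trans)
    moreover have "h (x + r) - h x \<equiv>\<^sub>p h (?y + r) - h ?y" using insert by auto
    ultimately show ?case using cong_trans by blast
  qed
  from this[OF order.refl] show ?thesis .
qed

section \<open>Directions that leave a function invariant, and top components\<close>

definition invar :: "'g set \<Rightarrow> ('g \<Rightarrow> int) \<Rightarrow> 'g set"
  where "invar Y h = {r \<in> R. \<forall>y\<in>Y. h (y + r) \<equiv>\<^sub>p h y}"

lemma invar_sgrp:
  assumes "saturated Y" shows "sgrp (invar Y h)"
  unfolding sgrp_def
proof (intro conjI ballI)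
  show "0 \<in> invar Y h" using sgrp_0[OF R_sgrp] by (simp add: invar_def)
  fix r s assume r: "r \<in> invar Y h" and s: "s \<in> invar Y h"
  then have rs: "r - s \<in> R" by (auto simp: invar_def intro: sgrp_diff[OF R_sgrp])
  moreover have "h (y + (r - s)) \<equiv>\<^sub>p h y" if y: "y \<in> Y" for y
  proof -
    have "y + (r - s) \<in> Y" using assms y rs by (simp add: saturated_def)
    moreover have "\<forall>y\<in>Y. h (y + s) \<equiv>\<^sub>p h y" using s by (simp add: invar_def)
    ultimately have "h (y + (r - s) + s) \<equiv>\<^sub>p h (y + (r - s))" by (rule bspec[rotated])
    moreover have "y + (r - s) + s = y + r" by simp
    ultimately have "h (y + r) \<equiv>\<^sub>p h (y + (r - s))" by metis
    moreover have "h (y + r) \<equiv>\<^sub>p h y" using r y by (simp add: invar_def)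
    ultimately show ?thesis by (rule ceq_left)
  qed
  ultimately show "r - s \<in> invar Y h" by (simp add: invar_def)
qed

lemma invar_decomposition:
  assumes Y: "saturated Y" and C: "finite C" "C \<inter> W = {}" and r: "r \<in> R" "act (pr (W \<union> C)) r = r"
    and pure: "\<And>C' s. C' \<subseteq> C \<Longrightarrow> s \<in> R \<Longrightarrow> pure W C' s \<Longrightarrow> s \<in> invar Y h"
  shows "r \<in> invar Y h"
proof (rule pure_decomposition[OF invar_sgrp[OF Y] R_sgrp act_R, where S=C and T="{}"])
  show "s \<in> invar Y h" if "S' \<subseteq> C" "s \<in> R" "pure W (S' \<union> {}) s" for S' s
    using pure[of S' s] that by simp
qed (use C r in simp_all)

text \<open>The product of the commuting idempotents \<open>1 - kill i\<close>: the projection onto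
  the cross effect in the directions \<open>is\<close>.\<close>

primrec topc :: "nat list \<Rightarrow> 'g \<Rightarrow> 'g" where
  "topc [] y = y"
| "topc (i # is) y = topc is y - act (kill i) (topc is y)"

lemma topc_add: "topc is (x + y) = topc is x + topc is y"
  by (induction "is") (simp_all add: act_add)

lemma topc_diff: "topc is (x - y) = topc is x - topc is y"
  by (induction "is") (simp_all add: act_diff)

lemma topc_mem:
  assumes "sgrp H" "\<And>g y. g \<in> End W \<Longrightarrow> y \<in> H \<Longrightarrow> act g y \<in> H" "set is \<inter> W = {}" "y \<in> H"
  shows "topc is y \<in> H"
  using assms(3)
proof (induction "is")
  case (Cons i "is")
  then have "kill i \<in> End W" by (intro pr_End) auto
  then show ?case using Cons assms(1,2) by (simp add: sgrp_diff)
qed (use assms in simp)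

lemma topc_supp: "act (pr F) y = y \<Longrightarrow> act (pr F) (topc is y) = topc is y"
proof (induction "is")
  case (Cons i "is")
  have "act (pr F) (act (kill i) (topc is y)) = act (kill i) (act (pr F) (topc is y))"
    by (simp add: act_pr_pr Int_commute)
  then show ?case using Cons by (simp add: act_diff)
qed simp

lemma topc_kill: "i \<in> set is \<Longrightarrow> act (kill i) (topc is y) = 0"
proof (induction "is")
  case (Cons j "is")
  have c: "act (kill i) (act (kill j) (topc is y)) = act (kill j) (act (kill i) (topc is y))"
    by (simp add: act_pr_pr Int_commute)
  show ?case
  proof (cases "i = j")
    case True then show ?thesis by (simp add: act_diff act_pr_pr)
  next
    case False then show ?thesis using Cons c by (simp add: act_diff)
  qed
qed simp

lemma topc_pure:
  assumes "\<And>i. i \<in> set is \<Longrightarrow> act (kill i) y = 0" shows "topc is y = y"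
  using assms by (induction "is") simp_all

text \<open>What \<open>topc\<close> removes is supported on proper subsets of \<open>C\<close>,
  hence a sum of pure elements that are invariant by assumption.\<close>

lemma topc_invar:
  assumes Y: "saturated Y" and "is": "set is \<subseteq> C" "finite C" "C \<inter> W = {}"
    and pure: "\<And>C' s. C' \<subset> C \<Longrightarrow> s \<in> R \<Longrightarrow> pure W C' s \<Longrightarrow> s \<in> invar Y h"
    and q: "q \<in> R" "act (pr (W \<union> C)) q = q"
  shows "q - topc is q \<in> invar Y h"
  using "is"(1)
proof (induction "is")
  case Nil
  then show ?case using sgrp_0[OF invar_sgrp[OF Y]] by simp
next
  case (Cons i "is")
  let ?t = "topc is q"
  have i: "i \<in> C" "i \<notin> W" using Cons "is" by auto
  have tR: "?t \<in> R" using Cons "is" by (intro topc_mem[OF R_sgrp act_R] q) auto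
  have "act (kill i) ?t \<in> invar Y h"
  proof (rule invar_decomposition[OF Y, of "C - {i}"])
    show "act (kill i) ?t \<in> R" using i by (intro act_R[OF pr_End tR]) auto
    have eq: "(W \<union> (C - {i})) \<inter> - {i} = - {i} \<inter> (W \<union> C)" using i by auto
    have "act (pr (W \<union> (C - {i}))) (act (kill i) ?t) = act (kill i) (act (pr (W \<union> C)) ?t)"
      by (simp add: act_pr_pr eq)
    then show "act (pr (W \<union> (C - {i}))) (act (kill i) ?t) = act (kill i) ?t"
      using topc_supp[OF q(2)] by simp
    show "s \<in> invar Y h" if "C' \<subseteq> C - {i}" "s \<in> R" "pure W C' s" for C' s
      using that i by (intro pure[of C']) auto
  qed (use "is" in auto)
  then have "(q - ?t) + act (kill i) ?t \<in> invar Y h"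
    using Cons by (intro sgrp_add[OF invar_sgrp[OF Y]]) auto
  then show ?case by (simp add: algebra_simps)
qed

text \<open>Let \<open>t\<close> be the \<open>U\<close>-part of \<open>x\<close>. The elements of
  \<open>B'\<close> whose top component along \<open>C\<close>, after any admissible relocation,
  does not change \<open>h\<close> at \<open>t\<close> form a subfunctor \<open>N\<close> between
  \<open>B\<close> and \<open>B'\<close>. It is not all of \<open>B'\<close>, because
  \<open>r\<close> changes \<open>h\<close> at \<open>t\<close>; by simplicity \<open>N = B\<close>.
  Finally \<open>\<rho>\<close> lies in \<open>N\<close>, since relocating \<open>x\<close> and
  \<open>x + \<rho>\<close> stays inside \<open>X\<close>, where \<open>h\<close> is zero.\<close>

lemma rigidity:
  assumes max: "adm_max n X Y S h" and X: "closed_set X" and Y: "saturated Y" and XY: "X \<subseteq> Y"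
    and nonconst: "\<And>\<rho>. \<rho> \<in> B' \<Longrightarrow> act (pr V) \<rho> \<in> B"
    and C: "C \<subseteq> S" and r: "r \<in> R" "pure W C r"
    and small: "\<And>C' s. C' \<subset> C \<Longrightarrow> s \<in> R \<Longrightarrow> pure W C' s \<Longrightarrow> s \<in> invar Y h"
    and x: "x \<in> X" "\<not> h (x + r) \<equiv>\<^sub>p h x"
    and \<rho>: "\<rho> \<in> B'" "act (pr (- (W \<union> (S - C) - V))) \<rho> = \<rho>" "x + \<rho> \<in> X"
  shows "\<rho> \<in> B"
proof -
  have adm: "adm n X Y S h" using max by (simp add: adm_max_def)
  note h = admD[OF adm]
  have Yc: "closed_set Y" using Y by (simp add: saturated_def)
  define U where "U = W \<union> (S - C)"
  have WU: "W \<subseteq> U" by (auto simp: U_def)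
  have finC: "finite C" "C \<inter> W = {}" using C h(2,3) by (auto intro: finite_subset)
  obtain cs where cs: "set cs = C" "distinct cs" using finC(1) finite_distinct_list by blast
  have xY: "x \<in> Y" using x XY by blast
  have pU: "pr U \<in> End W" using WU by (rule pr_End)
  define t where "t = act (pr U) x"
  have tY: "t \<in> Y" unfolding t_def by (rule closed_setD(2)[OF Yc pU xY])
  have Y_R: "y + s \<in> Y" if "y \<in> Y" "s \<in> R" for y s using Y that by (simp add: saturated_def)
  have tU: "act (pr U) t = t" by (simp add: t_def act_pr_pr)
  have K: "h (y + s) - h y \<equiv>\<^sub>p h (act (pr U) y + s) - h (act (pr U) y)"
    if "y \<in> Y" "s \<in> R" "pure W C s" for y s
    using adm_shift[OF max X Y XY C that(2,3,1)] by (simp add: U_def)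
  have r_ne: "\<not> h (t + r) \<equiv>\<^sub>p h t"
  proof
    assume "h (t + r) \<equiv>\<^sub>p h t"
    then have "h (t + r) - h t \<equiv>\<^sub>p 0" by (simp add: cong_iff_dvd_diff)
    from cong_trans[OF K[OF xY r, folded t_def] this] have "h (x + r) \<equiv>\<^sub>p h x"
      by (simp add: cong_iff_dvd_diff)
    then show False using x(2) by simp
  qed
  \<comment> \<open>An \<open>r\<close> without pure coordinates equals its \<open>W\<close>-part,
    which lies in \<open>B\<close> by \<open>nonconst\<close>; then \<open>h\<close> could not see
    it. Having an element of \<open>C\<close> is what makes \<open>pr U\<close> annihilate
    everything pure on \<open>C\<close>.\<close>
  have "C \<noteq> {}"
  proof
    assume "C = {}"
    then have r_eq: "act (pr W) r = r" using r(2) by (simp add: pure_def)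
    obtain b r0 where br: "b \<in> B" "r0 \<in> B'" "r = b + act (pr (- (W - V))) r0" using r(1) by (auto simp: ext_def)
    have "act (pr W) r = act (pr W) b + act (pr V) r0"
      using br pr_W_shift by (simp add: act_add flip: act_cmul)
    moreover have "act (pr W) b \<in> B" by (rule act_B[OF pr_End br(1)]) simp
    ultimately have "r \<in> B" using r_eq nonconst[OF br(2)] sgrp_add[OF B_sgrp] by metis
    then have "h (t + r) \<equiv>\<^sub>p h t" using closed_setD(1)[OF Yc] tY by (intro Pol_B[OF h(1)]) auto
    then show False using r_ne by simp
  qed
  then obtain c where c: "c \<in> C" by blast
  have pure_U: "act (pr U) s = 0" if "pure W C s" for s
  proof -
    have "act (pr U) s = act (pr U) (act (pr (W \<union> C)) s)" using that by (simp add: pure_def)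
    also have "\<dots> = act (pr W) (act (kill c) s)"
    proof -
      have "U \<inter> (W \<union> C) = W" "W \<inter> - {c} = W" using finC c by (auto simp: U_def)
      then show ?thesis by (simp add: act_pr_pr)
    qed
    finally show ?thesis using that c by (simp add: pure_def)
  qed
  define q where "q \<beta> s = act (pr (W \<union> C) \<bullet> \<beta>) s" for \<beta> s
  have pWC: "pr (W \<union> C) \<in> End W" by (rule pr_End) simp
  have HomE: "\<beta> \<in> End V" if "\<beta> \<in> Hom V W" for \<beta> using that VW unfolding Hom_def by blast
  have q_R: "q \<beta> s \<in> R" if \<beta>: "\<beta> \<in> Hom V W" and s: "s \<in> B'" for \<beta> s
  proof -
    have "Poly_Mapping.keys (\<beta> i) \<subseteq> - (W - V)" for i
      using Hom_D1[OF \<beta>, of i] Hom_D2[OF \<beta>, of i] by (cases "i \<in> V") auto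
    then have "pr (- (W - V)) \<bullet> \<beta> = \<beta>" by (rule pr_cmul_id)
    then have "act \<beta> s = 0 + act (pr (- (W - V))) (act \<beta> s)" by (simp flip: act_cmul)
    moreover have "act \<beta> s \<in> B'" by (rule act_B'[OF HomE[OF \<beta>] s])
    ultimately have "act \<beta> s \<in> R" using extI[OF sgrp_0[OF B_sgrp]] by metis
    then show ?thesis unfolding q_def act_cmul by (rule act_R[OF pWC])
  qed
  have q_supp: "act (pr (W \<union> C)) (q \<beta> s) = q \<beta> s" for \<beta> s
    by (simp add: q_def act_cmul act_pr_pr)
  have tq_R: "topc cs (q \<beta> s) \<in> R" if "\<beta> \<in> Hom V W" "s \<in> B'" for \<beta> s
    by (rule topc_mem[OF R_sgrp act_R _ q_R[OF that]]) (use cs finC in auto)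
  have tq_pure: "pure W C (topc cs (q \<beta> s))" for \<beta> s
    unfolding pure_def using topc_supp[OF q_supp] topc_kill[of _ cs] cs(1) by auto
  \<comment> \<open>Quantifying over all of \<open>Hom V W\<close> makes \<open>N\<close> stable:
    for \<open>g\<close> in \<open>End V\<close>, \<open>\<beta> \<bullet> g\<close> is again such a
    map.\<close>
  define N where "N = {s \<in> B'. \<forall>\<beta>\<in>Hom V W. h (t + topc cs (q \<beta> s)) \<equiv>\<^sub>p h t}"
  have BN: "B \<subseteq> N"
  proof
    fix b assume b: "b \<in> B"
    have "topc cs (q \<beta> b) \<in> B" if "\<beta> \<in> Hom V W" for \<beta>
    proof (rule topc_mem[OF B_sgrp act_B])
      show "q \<beta> b \<in> B" unfolding q_def act_cmul
        by (rule act_B[OF pWC act_VB[OF HomE[OF that] b]])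
    qed (use cs finC in auto)
    then have "h (t + topc cs (q \<beta> b)) \<equiv>\<^sub>p h t" if "\<beta> \<in> Hom V W" for \<beta>
      using closed_setD(1)[OF Yc] tY that by (intro Pol_B[OF h(1)]) auto
    then show "b \<in> N" using b BB' by (auto simp: N_def)
  qed
  have "stab V N"
    unfolding stab_def
  proof (intro conjI ballI)
    show "B0 \<subseteq> N" using BN B0_B by blast
    show "N \<subseteq> A" using stabD(3)[OF stab_B'] by (auto simp: N_def)
    show "sgrp N"
      unfolding sgrp_def
    proof (intro conjI ballI)
      show "0 \<in> N" using BN sgrp_0[OF B_sgrp] by blast
      fix s s' assume s: "s \<in> N" and s': "s' \<in> N"
      have sB: "s \<in> B'" "s' \<in> B'" using s s' by (simp_all add: N_def)
      then have "s - s' \<in> B'" by (rule sgrp_diff[OF B'_sgrp])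
      moreover have "h (t + topc cs (q \<beta> (s - s'))) \<equiv>\<^sub>p h t" if \<beta>: "\<beta> \<in> Hom V W" for \<beta>
      proof -
        define a where "a = topc cs (q \<beta> s)"
        define a' where "a' = topc cs (q \<beta> s')"
        have a: "a \<in> R" "a' \<in> R" "pure W C a" "pure W C a'"
          unfolding a_def a'_def using tq_R[OF \<beta>] sB tq_pure by auto
        have eq: "topc cs (q \<beta> (s - s')) = a - a'"
          by (simp add: a_def a'_def q_def act_diff topc_diff)
        \<comment> \<open>Since \<open>a\<close> and \<open>a'\<close> have no
          \<open>U\<close>-part, the \<open>U\<close>-part of \<open>y\<close> is \<open>t\<close>.
          By \<open>K\<close> the shift by \<open>a'\<close> has the same effect at \<open>y\<close>
          as at \<open>t\<close>, namely none, and \<open>y + a' = t + a\<close>.\<close>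
        define y where "y = t + (a - a')"
        have yY: "y \<in> Y" unfolding y_def by (intro Y_R tY sgrp_diff[OF R_sgrp] a)
        have yU: "act (pr U) y = t" unfolding y_def using pure_U a tU by (simp add: act_add act_diff)
        have "h (y + a') - h y \<equiv>\<^sub>p h (t + a') - h t" using K[OF yY a(2,4)] unfolding yU .
        moreover have "h (t + a') - h t \<equiv>\<^sub>p 0"
          using s' \<beta> by (simp add: N_def a'_def cong_iff_dvd_diff)
        ultimately have "h (y + a') - h y \<equiv>\<^sub>p 0" by (rule cong_trans)
        then have 1: "h (y + a') \<equiv>\<^sub>p h y" by (simp add: cong_iff_dvd_diff)
        have "y + a' = t + a" by (simp add: y_def)
        moreover have "h (t + a) \<equiv>\<^sub>p h t" using s \<beta> by (simp add: N_def a_def)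
        ultimately have "h (y + a') \<equiv>\<^sub>p h t" by metis
        from ceq_left[OF 1 this] show ?thesis unfolding eq y_def .
      qed
      ultimately show "s - s' \<in> N" by (simp add: N_def)
    qed
    fix g s assume g: "g \<in> End V" and s: "s \<in> N"
    have "q \<beta> (act g s) = q (\<beta> \<bullet> g) s" for \<beta> by (simp add: q_def act_cmul)
    moreover have "\<beta> \<bullet> g \<in> Hom V W" if "\<beta> \<in> Hom V W" for \<beta> using that g by (rule Hom_cmul_End)
    moreover have "act g s \<in> B'" using s by (intro act_B'[OF g]) (simp add: N_def)
    ultimately show "act g s \<in> N" using s by (simp add: N_def)
  qed
  moreover have "N \<subseteq> B'" by (auto simp: N_def)
  \<comment> \<open>As \<open>r\<close> comes from \<open>R\<close>, setting \<open>W - V\<close> to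
    zero changes it only by an element of \<open>B\<close>. With this matrix as
    \<open>\<beta>\<close>, the relocated top component is \<open>r\<close> modulo
    \<open>B\<close>.\<close>
  moreover have "N \<noteq> B'"
  proof
    assume NB': "N = B'"
    let ?i = "pr (- (W - V))"
    have i: "?i \<in> Hom V W" using VW by (intro pr_Hom) auto
    obtain b r0 where br: "b \<in> B" "r0 \<in> B'" "r = b + act ?i r0" using r(1) by (auto simp: ext_def)
    have "act ?i r - r = act ?i b - b" using br(3) by (simp add: act_add act_pr_pr)
    also have "\<dots> \<in> B" by (rule sgrp_diff[OF B_sgrp act_VB[OF HomE[OF i] br(1)] br(1)])
    finally have d: "act ?i r - r \<in> B" .
    define b' where "b' = topc cs (act (pr (W \<union> C)) (act ?i r - r))"
    have b': "b' \<in> B"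
      unfolding b'_def by (rule topc_mem[OF B_sgrp act_B _ act_B[OF pWC d]]) (use cs finC in auto)
    have "act (pr (W \<union> C)) r = r" using r(2) by (simp add: pure_def)
    then have "q ?i r = r + act (pr (W \<union> C)) (act ?i r - r)"
      unfolding q_def act_cmul act_diff by simp
    moreover have "topc cs r = r" using r(2) cs(1) by (intro topc_pure) (simp add: pure_def)
    ultimately have tq: "topc cs (q ?i r) = r + b'" by (simp add: topc_add b'_def)
    have "r \<in> N" using NB' R_B' r(1) by blast
    then have "h (t + topc cs (q ?i r)) \<equiv>\<^sub>p h t" using i unfolding N_def by blast
    then have "h (t + (r + b')) \<equiv>\<^sub>p h t" unfolding tq .
    moreover have "h ((t + r) + b') \<equiv>\<^sub>p h (t + r)"
      using closed_setD(1)[OF Yc] Y_R[OF tY r(1)] b' by (intro Pol_B[OF h(1)]) auto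
    then have "h (t + (r + b')) \<equiv>\<^sub>p h (t + r)" by (simp only: add.assoc)
    ultimately show False using r_ne ceq_left by blast
  qed
  ultimately have NB: "N = B" using minimal[OF _ BN] by blast
  have "h (t + topc cs (q \<beta> \<rho>)) \<equiv>\<^sub>p h t" if \<beta>: "\<beta> \<in> Hom V W" for \<beta>
  proof -
    \<comment> \<open>\<open>\<beta>\<close> is replaced by the identity on \<open>U\<close>. Since
      \<open>\<rho>\<close> avoids \<open>U - V\<close>, it is still moved to
      \<open>q \<beta> \<rho>\<close>, while the \<open>U\<close>-part of \<open>x\<close> remains
      \<open>t\<close>.\<close>
    define \<alpha> where "\<alpha> j = (if j \<in> U then frag_of j else (pr (W \<union> C) \<bullet> \<beta>) j)" for j
    have keys: "Poly_Mapping.keys ((pr (W \<union> C) \<bullet> \<beta>) j) \<subseteq> C" if "j \<notin> U" for j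
      using keys_pr_cmul[of "W \<union> C" \<beta> j] Hom_D2[OF \<beta>, of j] VW WU that by blast
    have \<alpha>: "\<alpha> \<in> End W"
      using WU keys finC(2) by (fastforce simp: Hom_def \<alpha>_def split: if_splits)
    have "\<alpha> \<bullet> pr (- (U - V)) = (pr (W \<union> C) \<bullet> \<beta>) \<bullet> pr (- (U - V))"
    proof
      fix j show "(\<alpha> \<bullet> pr (- (U - V))) j = ((pr (W \<union> C) \<bullet> \<beta>) \<bullet> pr (- (U - V))) j"
        using Hom_D1[OF \<beta>, of j] VW by (auto simp: cmul_pr \<alpha>_def cmul_def[of "pr _" \<beta>] pr_def)
    qed
    then have "act \<alpha> (act (pr (- (U - V))) \<rho>) = q \<beta> (act (pr (- (U - V))) \<rho>)"
      unfolding q_def by (simp flip: act_cmul)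
    then have \<alpha>\<rho>: "act \<alpha> \<rho> = q \<beta> \<rho>" using \<rho>(2) by (simp add: U_def)
    define y where "y = act \<alpha> x"
    have yX: "y \<in> X" unfolding y_def by (rule closed_setD(2)[OF X \<alpha> x(1)])
    have yqX: "y + q \<beta> \<rho> \<in> X"
      using closed_setD(2)[OF X \<alpha> \<rho>(3)] by (simp add: act_add y_def \<alpha>\<rho>)
    have yY: "y \<in> Y" using yX XY by blast
    have "pr U \<bullet> \<alpha> = pr U"
    proof
      fix j show "(pr U \<bullet> \<alpha>) j = pr U j"
      proof (cases "j \<in> U")
        case True then show ?thesis by (simp add: cmul_def \<alpha>_def)
      next
        case False
        then have "Poly_Mapping.keys (\<alpha> j) \<inter> U = {}" using keys[OF False] finC C by (auto simp: \<alpha>_def U_def)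
        then show ?thesis using False by (simp add: cmul_def frag_extend_pr_0 pr_def[of U j])
      qed
    qed
    then have yU: "act (pr U) y = t" by (simp add: y_def t_def flip: act_cmul)
    have "q \<beta> \<rho> - topc cs (q \<beta> \<rho>) \<in> invar Y h"
      by (rule topc_invar[OF Y _ finC small q_R[OF \<beta> \<rho>(1)] q_supp]) (use cs in auto)
    then have "h (y + topc cs (q \<beta> \<rho>) + (q \<beta> \<rho> - topc cs (q \<beta> \<rho>))) \<equiv>\<^sub>p h (y + topc cs (q \<beta> \<rho>))"
      using Y_R[OF yY tq_R[OF \<beta> \<rho>(1)]] unfolding invar_def by blast
    then have "h (y + q \<beta> \<rho>) \<equiv>\<^sub>p h (y + topc cs (q \<beta> \<rho>))" by (simp only: add.assoc add_diff_inverse) simp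
    from ceq_left[OF this h(4)[OF yqX]] have "h (y + topc cs (q \<beta> \<rho>)) - h y \<equiv>\<^sub>p 0 - 0"
      by (rule cong_diff[OF _ h(4)[OF yX]])
    moreover have "h (y + topc cs (q \<beta> \<rho>)) - h y \<equiv>\<^sub>p h (t + topc cs (q \<beta> \<rho>)) - h t"
      using K[OF yY tq_R[OF \<beta> \<rho>(1)] tq_pure] unfolding yU .
    ultimately have "h (t + topc cs (q \<beta> \<rho>)) - h t \<equiv>\<^sub>p 0 - 0" using ceq_left by blast
    then show ?thesis by (simp add: cong_iff_dvd_diff)
  qed
  then have "\<rho> \<in> N" using \<rho>(1) by (simp add: N_def)
  then show ?thesis using NB by simp
qed

text \<open>On \<open>Y\<close> the function \<open>h\<close> sees only the part on
  \<open>W \<union> S\<close>, and that part of \<open>s\<close> is a sum of elements pure on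
  subsets of \<open>S\<close>.\<close>

lemma invar_all:
  assumes adm: "adm n X Y S h" and Y: "saturated Y"
    and pure: "\<And>C s. C \<subseteq> S \<Longrightarrow> s \<in> R \<Longrightarrow> pure W C s \<Longrightarrow> s \<in> invar Y h" and s: "s \<in> R"
  shows "s \<in> invar Y h"
proof -
  note h = admD[OF adm]
  have Yc: "closed_set Y" using Y by (simp add: saturated_def)
  have pS: "pr (W \<union> S) \<in> End W" by (rule pr_End) simp
  let ?q = "act (pr (W \<union> S)) s"
  have "?q \<in> invar Y h"
    by (rule invar_decomposition[OF Y h(2,3) act_R[OF pS s] _ pure]) (simp_all add: act_pr_pr)
  then have q: "\<And>y. y \<in> Y \<Longrightarrow> h (y + ?q) \<equiv>\<^sub>p h y" by (simp add: invar_def)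
  have "h (y + s) \<equiv>\<^sub>p h y" if y: "y \<in> Y" for y
  proof -
    have ys: "y + s \<in> Y" using Y y s by (simp add: saturated_def)
    have "h (act (pr (W \<union> S)) y + ?q) \<equiv>\<^sub>p h (act (pr (W \<union> S)) y)"
      by (rule q[OF closed_setD(2)[OF Yc pS y]])
    then have "h (act (pr (W \<union> S)) (y + s)) \<equiv>\<^sub>p h (act (pr (W \<union> S)) y)" by (simp only: act_add)
    from ceq_left[OF h(5)[OF ys] this] show ?thesis using cong_trans h(5)[OF y] by blast
  qed
  then show ?thesis using s by (simp add: invar_def)
qed

text \<open>A matrix \<open>\<phi>\<close> may lose information. Instead, \<open>\<theta>\<close>
  copies each free coordinate \<open>j\<close> to \<open>j + K\<close>, beyond \<open>U\<close>, and
  adds the \<open>E\<close>-part of \<open>\<phi>\<close>; its \<open>U\<close>-part is that of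
  \<open>\<phi>\<close>, and \<open>\<eta>\<close> reads the copy back. The test
  \<open>k - K \<notin> W\<close> keeps \<open>\<eta>\<close> inside \<open>End W\<close>.\<close>

lemma spread:
  assumes \<phi>: "\<phi> \<in> End W" and U: "U = W \<union> E" "E \<inter> W = {}" "U \<subseteq> {..<K}"
  defines "\<theta> \<equiv> \<lambda>j. if j \<in> W then frag_of j else frag_of (j + K) + frag_extend (pr E) (\<phi> j)"
    and "\<eta> \<equiv> \<lambda>k. if k \<in> W then frag_of k else if K \<le> k \<and> k - K \<notin> W then frag_of (k - K) else 0"
  shows "\<theta> \<in> End W" "\<eta> \<in> End W" "pr U \<bullet> \<theta> = pr U \<bullet> \<phi>" "\<eta> \<bullet> \<theta> = frag_of"
proof -
  have WK: "k < K" if "k \<in> W" for k using U that by auto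
  show "\<theta> \<in> End W"
  proof -
    have "Poly_Mapping.keys (\<theta> j) \<inter> W = {}" if "j \<notin> W" for j
    proof -
      have "Poly_Mapping.keys (\<theta> j) \<subseteq> {j + K} \<union> E"
        using that keys_add[of "frag_of (j + K)" "frag_extend (pr E) (\<phi> j)"] keys_frag_extend_pr[of E "\<phi> j"]
        by (auto simp: \<theta>_def)
      then show ?thesis using U(2) WK by fastforce
    qed
    then show ?thesis by (simp add: Hom_def \<theta>_def)
  qed
  show "\<eta> \<in> End W" by (auto simp: Hom_def \<eta>_def)
  show "pr U \<bullet> \<theta> = pr U \<bullet> \<phi>"
  proof
    fix j show "(pr U \<bullet> \<theta>) j = (pr U \<bullet> \<phi>) j"
    proof (cases "j \<in> W")
      case True
      then show ?thesis using Hom_D1[OF \<phi> True] by (simp add: cmul_def \<theta>_def)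
    next
      case False
      have "j + K \<notin> U" using U(3) by auto
      then have "(pr U \<bullet> \<theta>) j = frag_extend (pr U) (frag_extend (pr E) (\<phi> j))"
        using False by (simp add: cmul_def \<theta>_def frag_extend_add pr_def[of U "j + K"])
      also have "\<dots> = frag_extend (pr (U \<inter> E)) (\<phi> j)" by (simp add: frag_extend_cmul_comp)
      also have "\<dots> = frag_extend (pr U) (\<phi> j)"
        using Hom_D2[OF \<phi> False] U(1) by (intro frag_extend_eq) (auto simp: pr_def)
      finally show ?thesis by (simp add: cmul_def)
    qed
  qed
  have \<eta>E: "\<eta> \<bullet> pr E = (\<lambda>_. 0)"
    using U by (fastforce simp: fun_eq_iff cmul_pr \<eta>_def)
  show "\<eta> \<bullet> \<theta> = frag_of"
  proof
    fix j show "(\<eta> \<bullet> \<theta>) j = frag_of j"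
    proof (cases "j \<in> W")
      case True then show ?thesis by (simp add: cmul_def \<theta>_def \<eta>_def)
    next
      case False
      have "j + K \<notin> W" using WK by force
      then have "\<eta> (j + K) = frag_of j" using False by (simp add: \<eta>_def)
      then have "(\<eta> \<bullet> \<theta>) j = frag_of j + frag_extend \<eta> (frag_extend (pr E) (\<phi> j))"
        using False by (simp add: cmul_def \<theta>_def frag_extend_add)
      also have "frag_extend \<eta> (frag_extend (pr E) (\<phi> j)) = 0"
        by (simp add: frag_extend_cmul_comp \<eta>E frag_extend_eq_0)
      finally show ?thesis by simp
    qed
  qed
qed

text \<open>By \<open>adm_shift\<close>, whether \<open>h\<close> sees the shift by \<open>r\<close>
  depends only on the \<open>U\<close>-part, so it already sees it at
  \<open>T' i = act (\<theta> i) (T i)\<close>. A comparison of the \<open>T' i\<close> modulo the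
  extension at level \<open>U\<close> leaves an error avoiding \<open>U - V\<close>, which
  \<open>rigidity\<close> puts into \<open>B\<close>; then \<open>\<eta>\<close> undoes the
  spreading.\<close>

lemma wqo_rigid:
  fixes T :: "nat \<Rightarrow> 'g"
  assumes max: "adm_max n X Y S h" and X: "closed_set X" and Y: "saturated Y" and XY: "X \<subseteq> Y"
    and nonconst: "\<And>\<rho>. \<rho> \<in> B' \<Longrightarrow> act (pr V) \<rho> \<in> B"
    and C: "C \<subseteq> S" and r: "r \<in> R" "pure W C r"
    and small: "\<And>C' s. C' \<subset> C \<Longrightarrow> s \<in> R \<Longrightarrow> pure W C' s \<Longrightarrow> s \<in> invar Y h"
    and T: "\<And>i. T i \<in> X" "\<And>i. \<exists>g\<in>End W. \<not> h (act g (T i) + r) \<equiv>\<^sub>p h (act g (T i))"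
  shows "\<exists>i j. i < j \<and> (\<exists>g\<in>End W. act g (T j) - T i \<in> B)"
proof -
  have adm: "adm n X Y S h" using max by (simp add: adm_max_def)
  note h = admD[OF adm]
  define U where "U = W \<union> (S - C)"
  have U: "finite U" "W \<subseteq> U" "V \<subseteq> U" using h(2) fin_W VW by (auto simp: U_def)
  obtain K where K: "U \<subseteq> {..<K}" using U(1) by (meson finite_nat_iff_bounded)
  have SC: "(S - C) \<inter> W = {}" using h(3) by auto
  obtain \<phi> where \<phi>: "\<And>i. \<phi> i \<in> End W" "\<And>i. \<not> h (act (\<phi> i) (T i) + r) \<equiv>\<^sub>p h (act (\<phi> i) (T i))"
    using T(2) by metis
  define \<theta> where "\<theta> i = (\<lambda>j. if j \<in> W then frag_of j
    else frag_of (j + K) + frag_extend (pr (S - C)) (\<phi> i j))" for i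
  define \<eta> :: cmat where "\<eta> = (\<lambda>k. if k \<in> W then frag_of k
    else if K \<le> k \<and> k - K \<notin> W then frag_of (k - K) else 0)"
  note sp = spread[OF \<phi>(1) U_def SC K, folded \<theta>_def \<eta>_def]
  define T' where "T' i = act (\<theta> i) (T i)" for i
  have T'X: "T' i \<in> X" for i unfolding T'_def by (rule closed_setD(2)[OF X sp(1) T(1)])
  have T'h: "\<not> h (T' i + r) \<equiv>\<^sub>p h (T' i)" for i
  proof
    assume "h (T' i + r) \<equiv>\<^sub>p h (T' i)"
    then have "h (T' i + r) - h (T' i) \<equiv>\<^sub>p 0" by (simp add: cong_iff_dvd_diff)
    moreover have "h (T' i + r) - h (T' i) \<equiv>\<^sub>p h (act (pr U) (T' i) + r) - h (act (pr U) (T' i))"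
      using adm_shift[OF max X Y XY C r subsetD[OF XY T'X]] unfolding U_def .
    ultimately have 1: "h (act (pr U) (T' i) + r) - h (act (pr U) (T' i)) \<equiv>\<^sub>p 0" by (metis ceq_left)
    have "act (pr U) (T' i) = act (pr U) (act (\<phi> i) (T i))"
      using sp(3)[of i] by (simp add: T'_def flip: act_cmul)
    moreover have "act (\<phi> i) (T i) \<in> Y" using closed_setD(2)[OF X \<phi>(1) T(1)] XY by blast
    note adm_shift[OF max X Y XY C r this, folded U_def]
    ultimately have "h (act (\<phi> i) (T i) + r) - h (act (\<phi> i) (T i)) \<equiv>\<^sub>p 0" using 1 cong_trans by metis
    then show False using \<phi>(2)[of i] by (simp add: cong_iff_dvd_diff)
  qed
  have "range T' \<subseteq> A" using T'X closed_setD(1)[OF X] by auto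
  then have "\<exists>i j. i < j \<and> (\<exists>g\<in>End U. act g (T' j) - T' i \<in> ext V U B B')"
    using wqo_ext[OF U(1,2)] unfolding wqo_on_def by blast
  then obtain i j \<psi> where ij: "i < j" "\<psi> \<in> End U" "act \<psi> (T' j) - T' i \<in> ext V U B B'"
    by (elim exE conjE bexE)
  from ij(3) obtain b \<rho>0 where b: "b \<in> B" "\<rho>0 \<in> B'" "act \<psi> (T' j) - T' i = b + act (pr (- (U - V))) \<rho>0"
    unfolding ext_def mem_Collect_eq by (elim exE conjE)
  define \<rho> where "\<rho> = act (pr (- (U - V))) \<rho>0"
  have \<psi>: "\<psi> \<in> End W" using ij(2) Hom_mono[OF U(2)] by blast
  have "\<rho> \<in> B"
  proof (rule rigidity[OF max X Y XY nonconst C r small T'X T'h])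
    show "\<rho> \<in> B'" unfolding \<rho>_def using U(3) by (intro act_B'[OF pr_End b(2)]) auto
    show "act (pr (- (W \<union> (S - C) - V))) \<rho> = \<rho>"
      unfolding U_def[symmetric] \<rho>_def by (simp add: act_pr_pr)
    have "act \<psi> (T' j) + (- b) \<in> X"
      by (rule closed_setD(3)[OF X closed_setD(2)[OF X \<psi> T'X] sgrp_minus[OF B_sgrp b(1)]])
    moreover have "act \<psi> (T' j) + (- b) = T' i + \<rho>" using b(3) by (simp add: \<rho>_def algebra_simps)
    ultimately show "T' i + \<rho> \<in> X" by simp
  qed auto
  then have "act \<psi> (T' j) - T' i \<in> B" unfolding b(3) \<rho>_def[symmetric] using b(1) by (intro sgrp_add[OF B_sgrp])
  then have "act \<eta> (act \<psi> (T' j) - T' i) \<in> B" by (rule act_B[OF sp(2)])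
  moreover have "act \<eta> (T' i) = T i"
    using sp(4)[of i] act_one by (simp add: T'_def flip: act_cmul)
  ultimately have "act (\<eta> \<bullet> \<psi> \<bullet> \<theta> j) (T j) - T i \<in> B" by (simp add: act_diff T'_def act_cmul)
  moreover have "\<eta> \<bullet> \<psi> \<bullet> \<theta> j \<in> End W" by (intro End_cmul sp \<psi>)
  ultimately show ?thesis using ij(1) by blast
qed

text \<open>Either no shift from \<open>R\<close> changes \<open>h\<close>, and \<open>X\<close>
  lies in a smaller saturated set, or some shift does, and its difference function has smaller
  degree. In the latter case the elements whose orbit it annihilates are handled by induction on
  \<open>n\<close>, the others by \<open>wqo_rigid\<close>.\<close>

lemma wqo_proper:
  assumes Y: "saturated Y" and IH: "\<And>Y'. saturated Y' \<Longrightarrow> Y' \<subset> Y \<Longrightarrow> wqo_on W B Y'"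
    and nonconst: "\<And>\<rho>. \<rho> \<in> B' \<Longrightarrow> act (pr V) \<rho> \<in> B"
  shows "closed_set X \<Longrightarrow> X \<subseteq> Y \<Longrightarrow> Pol n h \<Longrightarrow> (\<And>x. x \<in> X \<Longrightarrow> h x \<equiv>\<^sub>p 0) \<Longrightarrow> y \<in> Y \<Longrightarrow> \<not> h y \<equiv>\<^sub>p 0
    \<Longrightarrow> wqo_on W B X"
proof (induction n arbitrary: X h y rule: less_induct)
  case (less n X h0 y0)
  note X = less.prems(1) and XY = less.prems(2)
  have Yc: "closed_set Y" using Y by (simp add: saturated_def)
  obtain S0 h1 where "adm n X Y S0 h1" using adm_exists[OF X Yc less.prems(3-6)] .
  from adm_maximal[OF Yc this] obtain S h where max: "adm_max n X Y S h" .
  then have adm: "adm n X Y S h" by (simp add: adm_max_def)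
  note h = admD[OF adm]
  obtain y where y: "y \<in> Y" "\<not> h y \<equiv>\<^sub>p 0" using adm by (auto simp: adm_def)
  show ?case
  proof (cases "\<forall>s\<in>R. s \<in> invar Y h")
    case True
    \<comment> \<open>Asking for zeros along the whole orbit makes the zero set stable; invariance
      under \<open>R\<close> makes it saturated.\<close>
    define Y' where "Y' = {x \<in> Y. \<forall>g\<in>End W. h (act g x) \<equiv>\<^sub>p 0}"
    have plus: "x + s \<in> Y'" if x: "x \<in> Y'" and s: "s \<in> R" for x s
    proof -
      have "h (act g (x + s)) \<equiv>\<^sub>p 0" if g: "g \<in> End W" for g
      proof -
        have "act g x \<in> Y" using x by (intro closed_setD(2)[OF Yc g]) (simp add: Y'_def)
        then have "h (act g x + act g s) \<equiv>\<^sub>p h (act g x)"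
          using True act_R[OF g s] by (simp add: invar_def)
        moreover have "h (act g x) \<equiv>\<^sub>p 0" using x g by (simp add: Y'_def)
        ultimately show ?thesis unfolding act_add by (rule cong_trans)
      qed
      then show ?thesis using x s Y by (simp add: Y'_def saturated_def)
    qed
    have "closed_set Y'"
      unfolding closed_set_def
    proof (intro conjI ballI)
      show "Y' \<subseteq> A" using closed_setD(1)[OF Yc] by (auto simp: Y'_def)
      show "x + b \<in> Y'" if "x \<in> Y'" "b \<in> B" for x b using plus[OF that(1)] B_R that(2) by blast
      fix g x assume g: "g \<in> End W" and x: "x \<in> Y'"
      have "h (act g' (act g x)) \<equiv>\<^sub>p 0" if "g' \<in> End W" for g'
        using x End_cmul[OF that g] by (simp add: Y'_def flip: act_cmul)
      then show "act g x \<in> Y'" using x closed_setD(2)[OF Yc g] by (simp add: Y'_def)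
    qed
    then have "saturated Y'" using plus by (simp add: saturated_def)
    moreover have "y \<notin> Y'" using y(2) frag_of_End[of W] act_one[of y] unfolding Y'_def by fastforce
    then have "Y' \<subset> Y" using y(1) by (auto simp: Y'_def)
    ultimately have "wqo_on W B Y'" by (rule IH)
    moreover have "X \<subseteq> Y'" using XY h(4) closed_setD(2)[OF X] by (auto simp: Y'_def)
    ultimately show ?thesis by (rule wqo_on_subset)
  next
    case False
    \<comment> \<open>A set \<open>C\<close> of least size carrying a visible pure \<open>r\<close>
      is chosen, so that everything pure on a proper subset is invisible, as \<open>rigidity\<close>
      requires.\<close>
    define P where "P k \<longleftrightarrow> (\<exists>C s. card C = k \<and> C \<subseteq> S \<and> s \<in> R \<and> pure W C s \<and> s \<notin> invar Y h)" for k
    have "\<exists>k. P k" using False invar_all[OF adm Y] unfolding P_def by blast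
    then have "P (LEAST k. P k)" and least: "\<And>k. P k \<Longrightarrow> (LEAST k. P k) \<le> k"
      by (auto intro: LeastI Least_le)
    then obtain C r where C: "card C = (LEAST k. P k)" "C \<subseteq> S" and r: "r \<in> R" "pure W C r" "r \<notin> invar Y h"
      unfolding P_def by blast
    have finC: "finite C" using C(2) h(2) by (rule finite_subset)
    have small: "s \<in> invar Y h" if "C' \<subset> C" "s \<in> R" "pure W C' s" for C' s
    proof (rule ccontr)
      assume "s \<notin> invar Y h"
      then have "P (card C')" unfolding P_def using that C(2) by blast
      then have "card C \<le> card C'" using least C(1) by simp
      then show False using psubset_card_mono[OF finC that(1)] by simp
    qed
    obtain y1 where y1: "y1 \<in> Y" "\<not> h (y1 + r) \<equiv>\<^sub>p h y1" using r by (auto simp: invar_def)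
    have rA: "r \<in> A" using R_A r(1) by blast
    obtain f where f: "\<And>x. x \<in> A \<Longrightarrow> h (x + r) - h x \<equiv>\<^sub>p f x" "if n = 0 then f = (\<lambda>_. 0) else Pol (n - 1) f"
      using Pol_difference[OF h(1) rA] by blast
    have f_iff: "f x \<equiv>\<^sub>p 0 \<longleftrightarrow> h (x + r) \<equiv>\<^sub>p h x" if "x \<in> A" for x
    proof -
      have "f x \<equiv>\<^sub>p 0 \<longleftrightarrow> h (x + r) - h x \<equiv>\<^sub>p 0"
        using f(1)[OF that] ceq_left cong_trans by blast
      then show ?thesis by (simp add: cong_iff_dvd_diff)
    qed
    have YA: "x \<in> A" if "x \<in> Y" for x using closed_setD(1)[OF Yc] that by blast
    have fy1: "\<not> f y1 \<equiv>\<^sub>p 0" using f_iff[OF YA[OF y1(1)]] y1(2) by simp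
    \<comment> \<open>The difference of a function of degree \<open>0\<close> is zero, but
      \<open>f\<close> is not zero at \<open>y1\<close>.\<close>
    have n: "n \<noteq> 0"
    proof
      assume "n = 0"
      then have "f y1 = 0" using f(2) by simp
      then show False using fy1 by simp
    qed
    then have Pf: "Pol (n - 1) f" using f(2) by simp
    define Xf where "Xf = {x \<in> X. \<forall>g\<in>End W. f (act g x) \<equiv>\<^sub>p 0}"
    have "closed_set Xf"
      unfolding closed_set_def
    proof (intro conjI ballI)
      show "Xf \<subseteq> A" using closed_setD(1)[OF X] by (auto simp: Xf_def)
      fix x assume x: "x \<in> Xf"
      show "act g x \<in> Xf" if g: "g \<in> End W" for g
      proof -
        have "f (act g' (act g x)) \<equiv>\<^sub>p 0" if "g' \<in> End W" for g'
          using x End_cmul[OF that g] by (simp add: Xf_def flip: act_cmul)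
        then show "act g x \<in> Xf" using x closed_setD(2)[OF X g] by (simp add: Xf_def)
      qed
      show "x + b \<in> Xf" if b: "b \<in> B" for b
      proof -
        have "f (act g (x + b)) \<equiv>\<^sub>p 0" if g: "g \<in> End W" for g
        proof -
          have "act g x \<in> A" using x closed_setD(1)[OF X] by (intro act_A) (auto simp: Xf_def)
          then have "f (act g x + act g b) \<equiv>\<^sub>p f (act g x)" by (rule Pol_B[OF Pf _ act_B[OF g b]])
          moreover have "f (act g x) \<equiv>\<^sub>p 0" using x g by (simp add: Xf_def)
          ultimately show ?thesis unfolding act_add by (rule cong_trans)
        qed
        then show ?thesis using x closed_setD(3)[OF X _ b] by (simp add: Xf_def)
      qed
    qed
    moreover have "f x \<equiv>\<^sub>p 0" if "x \<in> Xf" for x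
    proof -
      have "f (act frag_of x) \<equiv>\<^sub>p 0" using that frag_of_End[of W] unfolding Xf_def by blast
      then show ?thesis by (simp add: act_one)
    qed
    moreover have "Xf \<subseteq> Y" using XY by (auto simp: Xf_def)
    ultimately have wqo_f: "wqo_on W B Xf"
      using less.IH[of "n - 1" Xf f y1] n Pf y1(1) fy1 by simp
    show ?thesis
      unfolding wqo_on_def
    proof (intro allI impI)
      fix T :: "nat \<Rightarrow> 'g" assume T: "range T \<subseteq> X"
      \<comment> \<open>A sequence meets \<open>Xf\<close> infinitely often, or it avoids
        \<open>Xf\<close> from some index \<open>N\<close> on and the shift by \<open>r\<close> is
        visible on every later orbit.\<close>
      show "\<exists>i j. i < j \<and> (\<exists>g\<in>End W. act g (T j) - T i \<in> B)"
      proof (cases "infinite {i. T i \<in> Xf}")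
        case True
        then obtain s :: "nat \<Rightarrow> nat" where "strict_mono s" "\<forall>i. T (s i) \<in> Xf"
          using infinite_enumerate[OF True] by auto
        then show ?thesis using wqo_on_subsequence[OF wqo_f, of s T] by blast
      next
        case False
        then obtain N where N: "{i. T i \<in> Xf} \<subseteq> {..<N}" using finite_nat_iff_bounded by blast
        have TX: "T (i + N) \<in> X" for i using T by auto
        have ex: "\<exists>g\<in>End W. \<not> h (act g (T (i + N)) + r) \<equiv>\<^sub>p h (act g (T (i + N)))" for i
        proof -
          have "T (i + N) \<notin> Xf" using N by force
          then obtain g where g: "g \<in> End W" "\<not> f (act g (T (i + N))) \<equiv>\<^sub>p 0"
            using TX[of i] by (auto simp: Xf_def)
          have "act g (T (i + N)) \<in> A" using TX[of i] closed_setD(1)[OF X] by (intro act_A) auto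
          then show ?thesis using f_iff g by blast
        qed
        have "\<exists>i j. i < j \<and> (\<exists>g\<in>End W. act g (T (j + N)) - T (i + N) \<in> B)"
          by (rule wqo_rigid[OF max X Y XY nonconst C(2) r(1,2) small TX ex])
        then obtain i j g where "i < j" "g \<in> End W" "act g (T (j + N)) - T (i + N) \<in> B"
          by (elim exE conjE bexE)
        then show ?thesis by (intro exI[of _ "i + N"] exI[of _ "j + N"] conjI bexI[of _ g]) simp_all
      qed
    qed
  qed
qed

text \<open>Noetherian induction on saturated sets, after the constant case is removed. In a bad
  sequence all later terms lie in the set \<open>X\<close> of elements not above \<open>T 0\<close>.
  The indicator of the class of \<open>T 0\<close> is polynomial, vanishes on \<open>X\<close> and
  not at \<open>T 0\<close>, so \<open>wqo_proper\<close> applies to \<open>X\<close>.\<close>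

theorem wqo_extension: "wqo_on W B A"
proof (cases "\<forall>\<rho>\<in>B'. act (pr V) \<rho> \<in> B")
  case False
  then show ?thesis using wqo_constant by blast
next
  case nonconst: True
  have "saturated Y \<longrightarrow> wqo_on W B Y" for Y
  proof (induction Y rule: wf_induct_rule[OF wf_saturated])
    case (1 Y)
    show ?case
    proof
      assume Y: "saturated Y"
      have Yc: "closed_set Y" using Y by (simp add: saturated_def)
      have IH: "wqo_on W B Y'" if "saturated Y'" "Y' \<subset> Y" for Y' using 1 that Y by auto
      show "wqo_on W B Y"
        unfolding wqo_on_def
      proof (intro allI impI, rule ccontr)
        fix T :: "nat \<Rightarrow> 'g" assume T: "range T \<subseteq> Y"
          and bad: "\<not> (\<exists>i j. i < j \<and> (\<exists>g\<in>End W. act g (T j) - T i \<in> B))"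
        define X where "X = {x \<in> Y. \<forall>g\<in>End W. act g x - T 0 \<notin> B}"
        have TY: "T i \<in> Y" for i using T by auto
        have TA: "T 0 \<in> A" using TY closed_setD(1)[OF Yc] by blast
        obtain m where m: "act (pr {..<m}) (T 0) = T 0" using fin_supp[OF TA] by blast
        have T0: "act (pr (W \<union> {..<m})) (T 0) = T 0" by (rule supp_mono[OF m]) simp
        \<comment> \<open>The indicator tests only the part of \<open>x\<close> on
          \<open>W \<union> {..<m}\<close>. It vanishes on \<open>X\<close> because taking this part
          is itself a matrix in \<open>End W\<close>.\<close>
        obtain n h where h: "Pol n h"
          "\<And>x. x \<in> A \<Longrightarrow> h x \<equiv>\<^sub>p (if act (pr (W \<union> {..<m})) x - T 0 \<in> B then 1 else 0)"
          using Pol_indicator[of "{..<m}" "T 0"] TA T0 by auto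
        have pm: "pr (W \<union> {..<m}) \<in> End W" by (rule pr_End) simp
        have "closed_set X"
          unfolding closed_set_def
        proof (intro conjI ballI)
          show "X \<subseteq> A" using closed_setD(1)[OF Yc] by (auto simp: X_def)
          fix x assume x: "x \<in> X"
          show "act g x \<in> X" if g: "g \<in> End W" for g
          proof -
            have "act g' (act g x) - T 0 \<notin> B" if "g' \<in> End W" for g'
              using x End_cmul[OF that g] by (simp add: X_def flip: act_cmul)
            then show ?thesis using x closed_setD(2)[OF Yc g] by (simp add: X_def)
          qed
          show "x + b \<in> X" if b: "b \<in> B" for b
          proof -
            have "act g (x + b) - T 0 \<notin> B" if g: "g \<in> End W" for g
            proof
              assume "act g (x + b) - T 0 \<in> B"
              from sgrp_diff[OF B_sgrp this act_B[OF g b]] have "act g x - T 0 \<in> B" by (simp add: act_add)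
              then show False using x g by (simp add: X_def)
            qed
            then show ?thesis using x closed_setD(3)[OF Yc _ b] by (simp add: X_def)
          qed
        qed
        moreover have "X \<subseteq> Y" by (auto simp: X_def)
        moreover have "h x \<equiv>\<^sub>p 0" if "x \<in> X" for x
          using h(2)[of x] that pm closed_setD(1)[OF Yc] by (auto simp: X_def)
        moreover have "\<not> h (T 0) \<equiv>\<^sub>p 0"
        proof
          assume "h (T 0) \<equiv>\<^sub>p 0"
          moreover have "h (T 0) \<equiv>\<^sub>p 1" using h(2)[OF TA] T0 sgrp_0[OF B_sgrp] by simp
          ultimately have "0 \<equiv>\<^sub>p 1" by (rule ceq_left)
          then have "int p dvd 1" by (simp add: cong_iff_dvd_diff)
          then show False using prime_gt_1_nat[OF p] by (simp add: zdvd1_eq)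
        qed
        ultimately have wqoX: "wqo_on W B X"
          using wqo_proper[OF Y IH _ _ _ h(1)] nonconst TY[of 0] by blast
        have "T (Suc i) \<in> X" for i
          using bad TY[of "Suc i"] unfolding X_def by blast
        then have "\<exists>i j. i < j \<and> (\<exists>g\<in>End W. act g (T j) - T i \<in> B)"
          using wqo_on_subsequence[OF wqoX, of Suc T] by (simp add: strict_mono_Suc_iff)
        then show False using bad by blast
      qed
    qed
  qed
  moreover have "saturated A"
    using act_A A_add B_A R_A unfolding saturated_def closed_set_def by blast
  ultimately show ?thesis by blast
qed

end

section \<open>The noetherian induction\<close>

context poly_action
begin

text \<open>The quantifier over larger frozen sets is what supplies the assumption
  \<open>wqo_ext\<close> of a simple extension.\<close>

definition swqo :: "nat set \<Rightarrow> 'g set \<Rightarrow> bool"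
  where "swqo W B \<longleftrightarrow> (\<forall>U. finite U \<longrightarrow> W \<subseteq> U \<longrightarrow> wqo_on U B A)"

text \<open>The functor \<open>N/B\<close> has degree less than \<open>k\<close> in the free
  coordinates.\<close>

definition deglt :: "nat set \<Rightarrow> nat \<Rightarrow> 'g set \<Rightarrow> 'g set \<Rightarrow> bool"
  where "deglt W k B N \<longleftrightarrow>
    (\<forall>S x. finite S \<longrightarrow> S \<inter> W = {} \<longrightarrow> k \<le> card S \<longrightarrow> x \<in> N \<longrightarrow> pure W S x \<longrightarrow> x \<in> B)"

lemma swqo_mono: "swqo W B \<Longrightarrow> W \<subseteq> U \<Longrightarrow> swqo U B"
  by (auto simp: swqo_def)

lemma deglt_0:
  assumes W: "finite W" and B: "sgrp B" and N: "stab W N" and deg: "deglt W 0 B N"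
  shows "N \<subseteq> B"
proof
  fix x assume x: "x \<in> N"
  then obtain n where n: "act (pr {..<n}) x = x" using stabD(3)[OF N] fin_supp by blast
  show "x \<in> B"
  proof (rule pure_decomposition[OF B stabD(1)[OF N] stabD(4)[OF N], where S="{..<n} - W" and T="{}"])
    show "act (pr (W \<union> ({..<n} - W) \<union> {})) x = x" using supp_mono[OF n] by auto
    show "y \<in> B" if "S' \<subseteq> {..<n} - W" "y \<in> N" "pure W (S' \<union> {}) y" for S' y
      using deg that finite_subset[OF that(1)] unfolding deglt_def by auto
  qed (use x in auto)
qed

text \<open>An element pure on \<open>S\<close> is decomposed along \<open>U - V\<close>. The piece
  that uses no coordinate of \<open>U - V\<close> belongs to the extension by definition; every
  other piece is pure on at least one further coordinate, hence on \<open>Suc k\<close> of them, and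
  lies in \<open>B\<close>.\<close>

lemma deglt_ext:
  assumes B: "stab V B" and B': "stab V B'" and BB': "B \<subseteq> B'" and U: "finite U" "V \<subseteq> U"
    and deg: "deglt V (Suc k) B B'"
  shows "deglt U k (ext V U B B') B'"
  unfolding deglt_def
proof (intro allI impI)
  fix S x assume S: "finite S" "S \<inter> U = {}" "k \<le> card S" and x: "x \<in> B'" "pure U S x"
  have VU: "V \<union> (U - V) = U" using U by auto
  show "x \<in> ext V U B B'"
  proof (rule pure_decomposition[OF stabD(1)[OF ext_stab(1)[OF B B' BB' U(2)]] stabD(1)[OF B'] stabD(4)[OF B'],
        where S="U - V" and T=S])
    fix S' y assume y: "S' \<subseteq> U - V" "y \<in> B'" "pure V (S' \<union> S) y"
    show "y \<in> ext V U B B'"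
    proof (cases "S' = {}")
      case True
      have "act (pr (V \<union> S)) y = y" using y(3) True by (simp add: pure_def)
      then have "act (pr (- (U - V))) y = y" by (rule supp_mono) (use S in auto)
      then have "y = 0 + act (pr (- (U - V))) y" by simp
      then show ?thesis using extI[OF sgrp_0[OF stabD(1)[OF B]] y(2)] by metis
    next
      case False
      have fin: "finite S'" using y(1) U(1) by (meson finite_Diff finite_subset)
      have "S' \<inter> S = {}" using y(1) S(2) by auto
      then have "card (S' \<union> S) = card S' + card S" using fin S(1) by (simp add: card_Un_disjoint)
      then have "Suc k \<le> card (S' \<union> S)" using False fin S(3) card_gt_0_iff[of S'] by linarith
      moreover have "(S' \<union> S) \<inter> V = {}" using y(1) S(2) U(2) by auto
      ultimately have "y \<in> B" using deg y fin S(1) unfolding deglt_def by blast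
      then show ?thesis using ext_stab(3)[OF B B' BB' U(2)] by blast
    qed
  next
    show "act (pr (V \<union> (U - V) \<union> S)) x = x" unfolding VU using x(2) by (simp add: pure_def)
    show "act (kill i) x = 0" if "i \<in> S" for i using x(2) that by (simp add: pure_def)
  qed (use U S x in auto)
qed

text \<open>Subfunctors are determined by their pure elements on fewer than \<open>D\<close> free
  coordinates. These can be moved into the window \<open>{..<w + D}\<close> and back, and there only
  finitely many classes modulo \<open>B0\<close> exist; \<open>F\<close> represents them. In this
  way inclusions become visible on a finite set.\<close>

lemma trace:
  assumes W: "finite W"
  shows "\<exists>F. finite F \<and> (\<forall>N1 N2. stab W N1 \<longrightarrow> stab W N2 \<longrightarrow> F \<inter> N2 \<subseteq> N1 \<longrightarrow> N2 \<subseteq> N1)"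
proof -
  obtain w where w: "W \<subseteq> {..<w}" using W by (meson finite_nat_iff_bounded)
  obtain F where F: "finite F" "F \<subseteq> A"
    "\<And>x. x \<in> A \<Longrightarrow> act (pr {..<w + D}) x = x \<Longrightarrow> \<exists>y\<in>F. x - y \<in> B0"
    using fin_quot[of "w + D"] by blast
  have "N2 \<subseteq> N1" if N1: "stab W N1" and N2: "stab W N2" and sub: "F \<inter> N2 \<subseteq> N1" for N1 N2
  proof
    fix x assume x: "x \<in> N2"
    then obtain n where n: "act (pr {..<n}) x = x" using stabD(3)[OF N2] fin_supp by blast
    show "x \<in> N1"
    proof (rule pure_decomposition[OF stabD(1)[OF N1] stabD(1)[OF N2] stabD(4)[OF N2],
          where S="{..<n} - W" and T="{}"])
      show "act (pr (W \<union> ({..<n} - W) \<union> {})) x = x" using supp_mono[OF n] by auto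
      fix S y assume S: "S \<subseteq> {..<n} - W" and y: "y \<in> N2" "pure W (S \<union> {}) y"
      have fin: "finite S" using finite_subset[OF S] by simp
      have SW: "S \<inter> W = {}" using S by auto
      have yA: "y \<in> A" using y(1) stabD(3)[OF N2] by blast
      show "y \<in> N1"
      proof (cases "D \<le> card S")
        case True
        then have "y \<in> B0" using pure_degree[OF W fin SW] yA y(2) by simp
        then show ?thesis using stabD(2)[OF N1] by blast
      next
        case False
        then have "card S \<le> card {w..<w + D}" by simp
        then obtain f where f: "f ` S \<subseteq> {w..<w + D}" "inj_on f S" using fin card_le_inj by (metis finite_atLeastLessThan)
        \<comment> \<open>\<open>\<beta>\<close> moves \<open>S\<close> injectively into the window,
          fixing \<open>W\<close>, and \<open>\<gamma>\<close> moves it back.\<close>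
        define \<beta> :: cmat where "\<beta> = (\<lambda>i. if i \<in> W then frag_of i else if i \<in> S then frag_of (f i) else 0)"
        define \<gamma> :: cmat where "\<gamma> = (\<lambda>k. if k \<in> W then frag_of k
          else if k \<in> f ` S then frag_of (inv_into S f k) else 0)"
        have fW: "f i \<notin> W" if "i \<in> S" for i using f(1) w that by fastforce
        have \<beta>: "\<beta> \<in> End W" using fW by (auto simp: Hom_def \<beta>_def)
        have \<gamma>: "\<gamma> \<in> End W"
          using SW f(2) by (auto simp: Hom_def \<gamma>_def dest: inv_into_f_f)
        have \<gamma>\<beta>: "\<gamma> \<bullet> \<beta> = pr (W \<union> S)"
          using fW f(2) by (auto simp: fun_eq_iff cmul_def \<beta>_def \<gamma>_def pr_def)
        have "Poly_Mapping.keys (\<beta> i) \<subseteq> {..<w + D}" for i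
          using w f(1) by (auto simp: \<beta>_def)
        then have "pr {..<w + D} \<bullet> \<beta> = \<beta>" by (rule pr_cmul_id)
        then have "act (pr {..<w + D}) (act \<beta> y) = act \<beta> y" by (simp flip: act_cmul)
        then obtain v where v: "v \<in> F" "act \<beta> y - v \<in> B0" using F(3)[OF act_A[OF yA]] by blast
        have \<beta>y: "act \<beta> y \<in> N2" by (rule stabD(4)[OF N2 \<beta> y(1)])
        have "act \<beta> y - (act \<beta> y - v) \<in> N2"
          by (rule sgrp_diff[OF stabD(1)[OF N2] \<beta>y subsetD[OF stabD(2)[OF N2] v(2)]])
        then have "v \<in> N1" using v(1) sub by auto
        moreover have "act \<beta> y - v \<in> N1" using v(2) stabD(2)[OF N1] by blast
        ultimately have "act \<beta> y \<in> N1" by (rule sgrp_cong_mem[OF stabD(1)[OF N1], rotated])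
        then have "act \<gamma> (act \<beta> y) \<in> N1" by (rule stabD(4)[OF N1 \<gamma>])
        then show ?thesis using y(2) \<gamma>\<beta> by (simp add: pure_def flip: act_cmul)
      qed
    qed (use x in auto)
  qed
  then show ?thesis using F(1) by (intro exI[of _ F]) simp
qed

text \<open>Outer induction on the degree, inner induction on the part of the finite trace of
  \<open>N\<close> missing from \<open>B\<close>. With \<open>B'\<close> minimal above
  \<open>B\<close>, the inner hypothesis handles \<open>B'\<close>, and the outer one handles the
  extensions of \<open>B\<close> by \<open>B'\<close>, whose degree is smaller.\<close>

lemma swqo_deglt:
  assumes "finite W" "stab W B" "stab W N" "B \<subseteq> N" "deglt W k B N" "swqo W N"
  shows "swqo W B"
  using assms
proof (induction k arbitrary: W B N)
  case 0
  then have "N \<subseteq> B" by (intro deglt_0[of W B N] stabD(1)[OF 0(2)])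
  then show ?case using 0 by auto
next
  case (Suc k)
  note W = Suc.prems(1) and N = Suc.prems(3) and swqo_N = Suc.prems(6)
  obtain F where F: "finite F" and tr: "\<And>N1 N2. stab W N1 \<Longrightarrow> stab W N2 \<Longrightarrow> F \<inter> N2 \<subseteq> N1 \<Longrightarrow> N2 \<subseteq> N1"
    using trace[OF W] by auto
  show ?case
    using Suc.prems(2,4,5)
  proof (induction "card (F \<inter> N - B)" arbitrary: B rule: less_induct)
    case less
    note B = less.prems(1) and BN = less.prems(2) and deg = less.prems(3)
    show ?case
    proof (cases "B = N")
      case True then show ?thesis using swqo_N by simp
    next
      case False
      \<comment> \<open>Least trace gives minimality: a subfunctor between \<open>B\<close> and
        \<open>B'\<close> other than \<open>B\<close> has the same trace as \<open>B'\<close>, hence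
        contains it.\<close>
      define P where "P m \<longleftrightarrow> (\<exists>C. card (F \<inter> C) = m \<and> stab W C \<and> B \<subset> C \<and> C \<subseteq> N)" for m
      have "P (card (F \<inter> N))" using N BN False unfolding P_def by blast
      then have "P (LEAST m. P m)" and least: "\<And>m. P m \<Longrightarrow> (LEAST m. P m) \<le> m"
        by (auto intro: LeastI Least_le)
      then obtain B' where B': "card (F \<inter> B') = (LEAST m. P m)" "stab W B'" "B \<subset> B'" "B' \<subseteq> N"
        unfolding P_def by blast
      have minimal: "C = B \<or> C = B'" if C: "stab W C" "B \<subseteq> C" "C \<subseteq> B'" for C
      proof (cases "C = B")
        case neq: False
        have "P (card (F \<inter> C))" unfolding P_def using C B'(4) neq by blast
        then have le: "card (F \<inter> B') \<le> card (F \<inter> C)" using least B'(1) by simp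
        have "F \<inter> C = F \<inter> B'" by (rule card_seteq[OF _ _ le]) (use F C(3) in auto)
        then have "B' \<subseteq> C" using tr[OF C(1) B'(2)] by blast
        then show ?thesis using C(3) by auto
      qed simp
      have deg': "deglt W (Suc k) B' N" "deglt W (Suc k) B B'"
        using deg B'(3,4) unfolding deglt_def by blast+
      have "\<not> F \<inter> B' \<subseteq> B" using tr[OF B B'(2)] B'(3) by blast
      then have "F \<inter> N - B' \<subset> F \<inter> N - B" using B'(3,4) by blast
      then have "card (F \<inter> N - B') < card (F \<inter> N - B)" using F by (intro psubset_card_mono) auto
      then have swqo_B': "swqo W B'" by (rule less.hyps[OF _ B'(2,4) deg'(1)])
      have BB': "B \<subseteq> B'" using B'(3) by blast
      show ?thesis
        unfolding swqo_def
      proof (intro allI impI)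
        fix U assume U: "finite U" "W \<subseteq> U"
        interpret simple_extension act A B0 p D U B W B'
        proof unfold_locales
          show "stab U B" by (rule stab_mono[OF B U(2)])
          fix U' assume U': "finite U'" "U \<subseteq> U'"
          then have WU': "W \<subseteq> U'" using U by auto
          \<comment> \<open>The outer hypothesis is used at the new frozen set \<open>U'\<close>,
            with \<open>B'\<close> in the role of \<open>N\<close>: modulo the extension
            \<open>B'\<close> has degree less than \<open>k\<close>.\<close>
          have "swqo U' (ext W U' B B')"
          proof (rule Suc.IH[OF U'(1)])
            show "stab U' (ext W U' B B')" "ext W U' B B' \<subseteq> B'"
              using ext_stab[OF B B'(2) BB' WU'] by auto
            show "stab U' B'" by (rule stab_mono[OF B'(2) WU'])
            show "deglt U' k (ext W U' B B') B'" by (rule deglt_ext[OF B B'(2) BB' U'(1) WU' deg'(2)])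
            show "swqo U' B'" by (rule swqo_mono[OF swqo_B' WU'])
          qed
          then show "wqo_on U' (ext W U' B B') A" using U'(1) by (simp add: swqo_def)
        qed (use U B B' BB' minimal in auto)
        show "wqo_on U B A" by (rule wqo_extension)
      qed
    qed
  qed
qed

text \<open>The induction starts from \<open>N = A\<close>, modulo which all elements are
  comparable; the degree axiom bounds the degree of \<open>A/B0\<close>.\<close>

theorem wqo: "wqo_on {} B0 A"
proof -
  have "wqo_on U A A" for U
    unfolding wqo_on_def
  proof (intro allI impI)
    fix T :: "nat \<Rightarrow> 'g" assume T: "range T \<subseteq> A"
    then have "act frag_of (T 1) - T 0 \<in> A" by (intro A_diff act_A) auto
    then show "\<exists>i j. i < j \<and> (\<exists>g\<in>End U. act g (T j) - T i \<in> A)"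
      by (intro exI[of _ 0] exI[of _ 1] conjI bexI[of _ frag_of]) auto
  qed
  then have "swqo {} A" by (simp add: swqo_def)
  moreover have "deglt {} D B0 A"
    unfolding deglt_def pure_def using degree by auto
  ultimately have "swqo {} B0"
    by (intro swqo_deglt[OF _ stab_B0 stab_A B0_A]) auto
  then show ?thesis by (simp add: swqo_def)
qed

end

section \<open>Coordinate spaces and integer matrices\<close>

abbreviation "lhom \<equiv> LinearCombinations.module_hom"

lemma linear_map_iff:
  "linear_map K V W T \<longleftrightarrow> vectorspace K V \<and> vectorspace K W \<and> T \<in> lhom K V W"
  by (auto simp: linear_map_def mod_hom_def mod_hom_axioms_def vectorspace_def)

lemma vec_hom_iff:
  "f \<in> vec_hom K V W \<longleftrightarrow>
    f \<in> extensional (carrier V) \<and> vectorspace K V \<and> vectorspace K W \<and> f \<in> lhom K V W"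
  by (auto simp: vec_hom_def linear_map_iff)

lemma restrict_module_hom:
  assumes "Module.module K V" "f \<in> lhom K V W" shows "restrict f (carrier V) \<in> lhom K V W"
proof -
  interpret Module.module K V by fact
  show ?thesis using assms(2) by (auto simp: LinearCombinations.module_hom_def)
qed

lemma vec_hom_restrict:
  assumes "vectorspace K V" "vectorspace K W" "f \<in> lhom K V W"
  shows "restrict f (carrier V) \<in> vec_hom K V W"
  using assms restrict_module_hom[of K V f W] by (auto simp: vec_hom_iff vectorspace_def)

lemma module_hom_comp:
  assumes "f \<in> lhom K U V" "g \<in> lhom K V W"
  shows "(\<lambda>x. g (f x)) \<in> lhom K U W"
  using assms by (auto simp: LinearCombinations.module_hom_def Pi_iff)

lemma module_hom_inverse:
  assumes V: "Module.module K V" and f: "f \<in> lhom K V W" "bij_betw f (carrier V) (carrier W)"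
  shows "inv_into (carrier V) f \<in> lhom K W V"
proof -
  interpret Module.module K V by fact
  let ?g = "inv_into (carrier V) f"
  have g: "?g y \<in> carrier V" "f (?g y) = y" if "y \<in> carrier W" for y
    using that f(2) by (auto simp: bij_betw_def inv_into_into f_inv_into_f)
  have gf: "?g (f x) = x" if "x \<in> carrier V" for x
    using that f(2) by (auto simp: bij_betw_def)
  have "?g (f a \<oplus>\<^bsub>W\<^esub> f b) = a \<oplus>\<^bsub>V\<^esub> b" if "a \<in> carrier V" "b \<in> carrier V" for a b
    using that f(1) gf[of "a \<oplus>\<^bsub>V\<^esub> b"] by (simp add: LinearCombinations.module_hom_add[OF f(1), symmetric])
  then have 1: "?g (x \<oplus>\<^bsub>W\<^esub> y) = ?g x \<oplus>\<^bsub>V\<^esub> ?g y" if "x \<in> carrier W" "y \<in> carrier W" for x y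
    using that g by metis
  have "?g (r \<odot>\<^bsub>W\<^esub> f a) = r \<odot>\<^bsub>V\<^esub> a" if "r \<in> carrier K" "a \<in> carrier V" for r a
    using that f(1) gf[of "r \<odot>\<^bsub>V\<^esub> a"] by (simp add: LinearCombinations.module_hom_smult[OF f(1), symmetric])
  then have 2: "?g (r \<odot>\<^bsub>W\<^esub> x) = r \<odot>\<^bsub>V\<^esub> ?g x" if "r \<in> carrier K" "x \<in> carrier W" for r x
    using that g by metis
  show ?thesis using g 1 2 by (simp add: LinearCombinations.module_hom_def)
qed

definition comb :: "('k, 'v, 'm) module_scheme \<Rightarrow> (nat \<Rightarrow> 'v) \<Rightarrow> nat \<Rightarrow> (nat \<Rightarrow> 'k) \<Rightarrow> 'v"
  where "comb V b n x = (\<Oplus>\<^bsub>V\<^esub>i\<in>{..<n}. x i \<odot>\<^bsub>V\<^esub> b i)"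

context field
begin

abbreviation coord :: "nat \<Rightarrow> ('a, nat \<Rightarrow> 'a) module" where "coord n \<equiv> func_space {..<n}"

definition unitvec :: "nat \<Rightarrow> nat \<Rightarrow> nat \<Rightarrow> 'a"
  where "unitvec n i = (\<lambda>j\<in>{..<n}. if j = i then \<one> else \<zero>)"

lemma coord_carrier: "carrier (coord n) = {..<n} \<rightarrow>\<^sub>E carrier R"
  by (simp add: func_space_def)

lemma coord_smult: "r \<odot>\<^bsub>coord n\<^esub> x = (\<lambda>j\<in>{..<n}. r \<otimes> x j)"
  by (simp add: func_space_def)

lemma coord_add: "x \<oplus>\<^bsub>coord n\<^esub> y = (\<lambda>j\<in>{..<n}. x j \<oplus> y j)"
  by (simp add: func_space_def)

lemma coord_zero: "\<zero>\<^bsub>coord n\<^esub> = (\<lambda>j\<in>{..<n}. \<zero>)"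
  by (simp add: func_space_def)

lemma coord_eqI:
  "\<lbrakk>x \<in> carrier (coord n); y \<in> carrier (coord n); \<And>i. i < n \<Longrightarrow> x i = y i\<rbrakk> \<Longrightarrow> x = y"
  unfolding coord_carrier by (rule PiE_ext) auto

lemma coord_module: "Module.module R (coord n)"
  by (rule func_space_is_module)

lemma coord_vectorspace: "vectorspace R (coord n)"
  using coord_module field_axioms by (simp add: vectorspace_def)

lemma unitvec_carrier: "unitvec n i \<in> carrier (coord n)"
  by (auto simp: unitvec_def func_space_def)

lemma comb_hom:
  assumes V: "Module.module R V" and b: "b \<in> {..<n} \<rightarrow> carrier V"
  shows "comb V b n \<in> lhom R (coord n) V"
proof -
  interpret V: Module.module R V by fact
  have x: "x i \<in> carrier R" if "x \<in> carrier (coord n)" "i < n" for x i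
    using that by (auto simp: func_space_def)
  have bi: "b i \<in> carrier V" if "i < n" for i using b that by auto
  show ?thesis
    unfolding LinearCombinations.module_hom_def
  proof (intro CollectI conjI allI impI)
    show "comb V b n \<in> carrier (coord n) \<rightarrow> carrier V"
      unfolding comb_def by (intro funcsetI V.M.finsum_closed) (auto simp: x bi)
    fix y z assume yz: "y \<in> carrier (coord n) \<and> z \<in> carrier (coord n)"
    have "comb V b n (y \<oplus>\<^bsub>coord n\<^esub> z) = (\<Oplus>\<^bsub>V\<^esub>i\<in>{..<n}. y i \<odot>\<^bsub>V\<^esub> b i \<oplus>\<^bsub>V\<^esub> z i \<odot>\<^bsub>V\<^esub> b i)"
      unfolding comb_def using yz
      by (intro V.M.finsum_cong') (auto simp: x bi func_space_def V.smult_l_distr)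
    also have "\<dots> = comb V b n y \<oplus>\<^bsub>V\<^esub> comb V b n z"
      unfolding comb_def using yz by (intro V.M.finsum_addf) (auto simp: x bi)
    finally show "comb V b n (y \<oplus>\<^bsub>coord n\<^esub> z) = comb V b n y \<oplus>\<^bsub>V\<^esub> comb V b n z" .
  next
    fix r y assume ry: "r \<in> carrier R \<and> y \<in> carrier (coord n)"
    have "comb V b n (r \<odot>\<^bsub>coord n\<^esub> y) = (\<Oplus>\<^bsub>V\<^esub>i\<in>{..<n}. r \<odot>\<^bsub>V\<^esub> (y i \<odot>\<^bsub>V\<^esub> b i))"
      unfolding comb_def using ry
      by (intro V.M.finsum_cong') (auto simp: x bi func_space_def V.smult_assoc1)
    also have "\<dots> = r \<odot>\<^bsub>V\<^esub> comb V b n y"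
      unfolding comb_def using ry by (intro V.finsum_smult[symmetric]) (auto simp: x bi)
    finally show "comb V b n (r \<odot>\<^bsub>coord n\<^esub> y) = r \<odot>\<^bsub>V\<^esub> comb V b n y" .
  qed
qed

lemma comb_unitvec:
  assumes V: "Module.module R V" and b: "b \<in> {..<n} \<rightarrow> carrier V" and i: "i < n"
  shows "comb V b n (unitvec n i) = b i"
proof -
  interpret V: Module.module R V by fact
  have bi: "b i \<in> carrier V" if "i < n" for i using b that by auto
  have "comb V b n (unitvec n i) = (\<Oplus>\<^bsub>V\<^esub>j\<in>{..<n}. if i = j then b j else \<zero>\<^bsub>V\<^esub>)"
    unfolding comb_def by (intro V.M.finsum_cong') (auto simp: bi unitvec_def)
  also have "\<dots> = b i" using i bi by (intro V.M.finsum_singleton) auto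
  finally show ?thesis .
qed

lemma coord_hom_unique:
  assumes V: "Module.module R V" and T: "T \<in> lhom R (coord n) V" "T' \<in> lhom R (coord n) V"
    and eq: "\<And>i. i < n \<Longrightarrow> T (unitvec n i) = T' (unitvec n i)" and x: "x \<in> carrier (coord n)"
  shows "T x = T' x"
proof -
  interpret V: Module.module R V by fact
  interpret E: Module.module R "coord n" by (rule coord_module)
  \<comment> \<open>\<open>k\<close> bounds the nonzero coordinates of \<open>x\<close>; the
    induction step splits off coordinate \<open>k\<close>.\<close>
  have "T x = T' x" if "k \<le> n" "x \<in> carrier (coord n)" "\<And>j. k \<le> j \<Longrightarrow> j < n \<Longrightarrow> x j = \<zero>" for k x
    using that
  proof (induction k arbitrary: x)
    case 0
    have "x = \<zero> \<odot>\<^bsub>coord n\<^esub> x"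
    proof (rule coord_eqI[of _ n])
      fix i assume "i < n"
      then show "x i = (\<zero> \<odot>\<^bsub>coord n\<^esub> x) i" using 0(3)[of i] by (simp add: coord_smult)
    qed (use 0 in simp_all)
    moreover have "T (\<zero> \<odot>\<^bsub>coord n\<^esub> x) = \<zero>\<^bsub>V\<^esub>" "T' (\<zero> \<odot>\<^bsub>coord n\<^esub> x) = \<zero>\<^bsub>V\<^esub>"
    proof -
      have "T x \<in> carrier V" "T' x \<in> carrier V"
        using 0(2) T[THEN LinearCombinations.module_hom_closed] by blast+
      then show "T (\<zero> \<odot>\<^bsub>coord n\<^esub> x) = \<zero>\<^bsub>V\<^esub>" "T' (\<zero> \<odot>\<^bsub>coord n\<^esub> x) = \<zero>\<^bsub>V\<^esub>"
        using LinearCombinations.module_hom_smult[OF T(1) zero_closed 0(2)]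
          LinearCombinations.module_hom_smult[OF T(2) zero_closed 0(2)] V.lmult_0 by metis+
    qed
    ultimately show ?case by metis
  next
    case (Suc k)
    let ?y = "\<lambda>j\<in>{..<n}. if j = k then \<zero> else x j"
    let ?z = "x k \<odot>\<^bsub>coord n\<^esub> unitvec n k"
    have xR: "x j \<in> carrier R" if "j < n" for j using Suc.prems(2) that by (auto simp: coord_carrier)
    have kn: "k < n" using Suc.prems(1) by simp
    have y: "?y \<in> carrier (coord n)" using xR by (auto simp: coord_carrier)
    have z: "?z \<in> carrier (coord n)" using xR[OF kn] unitvec_carrier by simp
    have xeq: "x = ?y \<oplus>\<^bsub>coord n\<^esub> ?z"
    proof (rule coord_eqI[of _ n])
      fix i assume "i < n"
      then show "x i = (?y \<oplus>\<^bsub>coord n\<^esub> ?z) i"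
        using xR[of i] xR[OF kn] by (simp add: coord_add coord_smult unitvec_def)
    next
      show "?y \<oplus>\<^bsub>coord n\<^esub> ?z \<in> carrier (coord n)" using y z by (rule E.M.a_closed)
    qed (use Suc in simp)
    have "T ?y = T' ?y"
      by (rule Suc.IH[OF _ y]) (use Suc.prems in auto)
    moreover have "T ?z = T' ?z"
      using xR[OF kn] kn by (simp add: LinearCombinations.module_hom_smult[OF T(1)]
          LinearCombinations.module_hom_smult[OF T(2)] unitvec_carrier eq)
    ultimately have "T (?y \<oplus>\<^bsub>coord n\<^esub> ?z) = T' (?y \<oplus>\<^bsub>coord n\<^esub> ?z)"
      unfolding LinearCombinations.module_hom_add[OF T(1) y z] LinearCombinations.module_hom_add[OF T(2) y z]
      by simp
    then show ?case using xeq by metis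
  qed
  from this[of n] x show ?thesis by auto
qed

lemma ex_frame:
  assumes "vectorspace R V" "vectorspace.fin_dim R V"
  shows "\<exists>n b. b \<in> {..<n} \<rightarrow> carrier V \<and> n = vectorspace.dim R V
    \<and> bij_betw (comb V b n) (carrier (coord n)) (carrier V)"
proof -
  interpret V: vectorspace R V by fact
  obtain \<beta> where \<beta>: "finite \<beta>" "V.basis \<beta>" using V.finite_basis_exists assms(2) by blast
  then have li: "V.lin_indpt \<beta>" and gen: "V.span \<beta> = carrier V" and sub: "\<beta> \<subseteq> carrier V"
    by (auto simp: V.basis_def)
  obtain b where b: "bij_betw b {..<card \<beta>} \<beta>" using ex_bij_betw_nat_finite[OF \<beta>(1)] by (auto simp: lessThan_atLeast0)
  let ?n = "card \<beta>"
  have bV: "b \<in> {..<?n} \<rightarrow> carrier V" using b sub by (auto simp: bij_betw_def)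
  define ib where "ib = inv_into {..<?n} b"
  have ib: "ib v < ?n" "b (ib v) = v" if "v \<in> \<beta>" for v
    using that b inv_into_into[of v b "{..<?n}"] f_inv_into_f[of v b "{..<?n}"]
    by (auto simp: bij_betw_def ib_def)
  have ib_b: "ib (b i) = i" "b i \<in> \<beta>" if "i < ?n" for i
    using that b by (auto simp: bij_betw_def ib_def)
  have bi: "b i \<in> carrier V" if "i < ?n" for i using ib_b[OF that] sub by auto
  have xR: "x i \<in> carrier R" if "x \<in> carrier (coord ?n)" "i < ?n" for x i
    using that by (auto simp: coord_carrier)
  have comb_lc: "comb V b ?n x = V.lincomb (\<lambda>v. x (ib v)) \<beta>" if x: "x \<in> carrier (coord ?n)" for x
  proof -
    have "V.lincomb (\<lambda>v. x (ib v)) (b ` {..<?n}) = (\<Oplus>\<^bsub>V\<^esub>i\<in>{..<?n}. x (ib (b i)) \<odot>\<^bsub>V\<^esub> b i)"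
      unfolding V.lincomb_def
    proof (rule V.M.finsum_reindex)
      show "(\<lambda>v. x (ib v) \<odot>\<^bsub>V\<^esub> v) \<in> b ` {..<?n} \<rightarrow> carrier V"
        using xR[OF x] ib_b bi by (intro funcsetI) (auto intro!: V.smult_closed)
    qed (use b in \<open>simp add: bij_betw_def\<close>)
    also have "\<dots> = comb V b ?n x"
      unfolding comb_def by (rule V.M.finsum_cong') (use xR[OF x] ib_b bi in auto)
    finally show ?thesis using b by (simp add: bij_betw_def)
  qed
  have hom: "comb V b ?n \<in> lhom R (coord ?n) V" by (rule comb_hom[OF _ bV]) unfold_locales
  interpret E: Module.module R "coord ?n" by (rule coord_module)
  interpret h: mod_hom R "coord ?n" V "comb V b ?n"
    using hom by unfold_locales
  have "inj_on (comb V b ?n) (carrier (coord ?n))"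
  proof (rule inj_onI)
    fix x y assume x: "x \<in> carrier (coord ?n)" and y: "y \<in> carrier (coord ?n)"
      and e: "comb V b ?n x = comb V b ?n y"
    define z where "z = x \<ominus>\<^bsub>coord ?n\<^esub> y"
    have z: "z \<in> carrier (coord ?n)" using x y by (simp add: z_def)
    have "comb V b ?n z = \<zero>\<^bsub>V\<^esub>" using x y e h.f_im[OF y] by (simp add: z_def V.M.minus_eq V.M.r_neg)
    then have lc: "V.lincomb (\<lambda>v. z (ib v)) \<beta> = \<zero>\<^bsub>V\<^esub>" using comb_lc[OF z] by simp
    have zc: "(\<lambda>v. z (ib v)) \<in> \<beta> \<rightarrow> carrier R"
      using xR[OF z] ib by (intro funcsetI) simp
    have "z i = \<zero>" if i: "i < ?n" for i
    proof (rule ccontr)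
      assume "z i \<noteq> \<zero>"
      then have "V.lin_dep \<beta>"
        using V.lin_dep_crit[OF \<beta>(1) order.refl zc ib_b(2)[OF i] _ lc] ib_b(1)[OF i] by simp
      then show False using li by simp
    qed
    then have "z = \<zero>\<^bsub>coord ?n\<^esub>" by (intro coord_eqI[OF z E.M.zero_closed]) (simp_all add: coord_zero)
    moreover have "x = z \<oplus>\<^bsub>coord ?n\<^esub> y"
      using x y by (simp add: z_def E.M.minus_eq E.M.a_assoc E.M.l_neg)
    ultimately show "x = y" using y by simp
  qed
  moreover have "comb V b ?n ` carrier (coord ?n) = carrier V"
  proof
    show "comb V b ?n ` carrier (coord ?n) \<subseteq> carrier V" using h.f_im by blast
    show "carrier V \<subseteq> comb V b ?n ` carrier (coord ?n)"
    proof
      fix v assume "v \<in> carrier V"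
      then obtain a where a: "a \<in> \<beta> \<rightarrow> carrier R" "V.lincomb a \<beta> = v"
        using V.finite_in_span[OF \<beta>(1) sub] gen by blast
      let ?x = "\<lambda>i\<in>{..<?n}. a (b i)"
      have x: "?x \<in> carrier (coord ?n)" using a(1) ib_b by (auto simp: coord_carrier)
      have "V.lincomb (\<lambda>v. ?x (ib v)) \<beta> = V.lincomb a \<beta>"
        unfolding V.lincomb_def
      proof (rule V.M.finsum_cong')
        fix v assume v: "v \<in> \<beta>"
        show "?x (ib v) \<odot>\<^bsub>V\<^esub> v = a v \<odot>\<^bsub>V\<^esub> v" using ib[OF v] by simp
      qed (use a sub in auto)
      then show "v \<in> comb V b ?n ` carrier (coord ?n)" using comb_lc[OF x] a x by (metis image_eqI)
    qed
  qed
  ultimately show ?thesis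
    using bV V.dim_basis[OF \<beta>] by (intro exI[of _ ?n] exI[of _ b]) (simp add: bij_betw_def)
qed

lemma fin_dim_if_finite:
  assumes "vectorspace R V" "finite (carrier V)" shows "vectorspace.fin_dim R V"
proof -
  interpret V: vectorspace R V by fact
  have "V.span (carrier V) = carrier V"
    using V.span_closed[of "carrier V"] V.in_own_span[of "carrier V"] by auto
  then show ?thesis using assms(2) unfolding V.fin_dim_def by blast
qed

text \<open>The elements of \<open>coord n\<close> have type \<open>nat \<Rightarrow> 'a\<close>,
  where the functor cannot be evaluated. As \<open>coord n\<close> is finite, the infinite type
  \<open>'v\<close> contains a set of the same size, to which the structure is transported along
  \<open>c\<close>.\<close>

lemma ex_copy:
  assumes "finite (carrier R)" "infinite (UNIV :: 'v set)"
  shows "\<exists>(X :: ('a, 'v) module) c. vectorspace R X \<and> finite (carrier X) \<and>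
    c \<in> lhom R (coord n) X \<and> bij_betw c (carrier (coord n)) (carrier X)"
proof -
  interpret E: Module.module R "coord n" by (rule coord_module)
  have fin: "finite (carrier (coord n))" using assms(1) by (auto simp: coord_carrier intro: finite_PiE)
  obtain S :: "'v set" where S: "finite S" "card S = card (carrier (coord n))"
    using infinite_arbitrarily_large[OF assms(2)] by blast
  obtain c where c: "bij_betw c (carrier (coord n)) S"
    using finite_same_card_bij[OF fin S(1)] S(2) by auto
  define d where "d = inv_into (carrier (coord n)) c"
  have d: "d u \<in> carrier (coord n)" "c (d u) = u" if "u \<in> S" for u
    using that c by (auto simp: d_def bij_betw_def inv_into_into f_inv_into_f)
  have dc: "d (c x) = x" "c x \<in> S" if "x \<in> carrier (coord n)" for x
    using that c by (auto simp: d_def bij_betw_def)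
  define X :: "('a, 'v) module" where "X = \<lparr>carrier = S, Group.monoid.mult = undefined, Group.monoid.one = undefined,
    Ring.ring.zero = c \<zero>\<^bsub>coord n\<^esub>, Ring.ring.add = (\<lambda>u v. c (d u \<oplus>\<^bsub>coord n\<^esub> d v)), Module.module.smult = (\<lambda>r u. c (r \<odot>\<^bsub>coord n\<^esub> d u))\<rparr>"
  have X: "carrier X = S" "\<zero>\<^bsub>X\<^esub> = c \<zero>\<^bsub>coord n\<^esub>" "\<And>u v. u \<oplus>\<^bsub>X\<^esub> v = c (d u \<oplus>\<^bsub>coord n\<^esub> d v)"
    "\<And>r u. r \<odot>\<^bsub>X\<^esub> u = c (r \<odot>\<^bsub>coord n\<^esub> d u)"
    by (simp_all add: X_def)
  have "Module.module R X"
  proof (rule module_criteria)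
    show "cring R" by unfold_locales
    show "\<forall>v\<in>carrier X. \<exists>w\<in>carrier X. v \<oplus>\<^bsub>X\<^esub> w = \<zero>\<^bsub>X\<^esub>"
    proof
      fix v assume v: "v \<in> carrier X"
      let ?w = "c (\<ominus>\<^bsub>coord n\<^esub> d v)"
      have "?w \<in> carrier X" "v \<oplus>\<^bsub>X\<^esub> ?w = \<zero>\<^bsub>X\<^esub>"
        using v d dc by (simp_all add: X E.M.r_neg)
      then show "\<exists>w\<in>carrier X. v \<oplus>\<^bsub>X\<^esub> w = \<zero>\<^bsub>X\<^esub>" by blast
    qed
  qed (use d dc in \<open>simp_all add: X E.M.a_assoc E.smult_assoc1 E.smult_l_distr E.smult_r_distr E.M.a_comm E.M.a_lcomm\<close>)
  moreover have "c \<in> lhom R (coord n) X"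
    using dc by (simp add: LinearCombinations.module_hom_def X)
  ultimately show ?thesis
    using c S(1) field_axioms by (intro exI[of _ X] exI[of _ c]) (simp add: vectorspace_def X(1))
qed

end

section \<open>A skeleton of the category and the action of integer matrices on it\<close>

locale skeleton = polynomial_generic_representation K F\<^sub>o F\<^sub>m
  for K :: "('k, 'm) ring_scheme"
    and F\<^sub>o :: "('k, 'v) module \<Rightarrow> ('k, 'w) module"
    and F\<^sub>m :: "('k, 'v) module \<Rightarrow> ('k, 'v) module \<Rightarrow> ('v \<Rightarrow> 'v) \<Rightarrow> 'w \<Rightarrow> 'w" +
  fixes X :: "nat \<Rightarrow> ('k, 'v) module" and b :: "nat \<Rightarrow> nat \<Rightarrow> 'v"
  assumes X_obj: "vec_obj K (X n)"
    and b_carrier: "b n \<in> {..<n} \<rightarrow> carrier (X n)"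
    and b_frame: "bij_betw (comb (X n) (b n) n) (carrier (coord n)) (carrier (X n))"
begin

abbreviation Q where "Q n \<equiv> F\<^sub>o (X n)"

lemma X_vs: "vectorspace K (X n)" and X_mod: "Module.module K (X n)"
  using X_obj[of n] by (simp_all add: vec_obj_def vectorspace_def)

lemma Q_obj: "vec_obj K (Q n)"
  by (rule map_obj[OF X_obj])

lemma Q_vs: "vectorspace K (Q n)" and Q_mod: "Module.module K (Q n)"
  using Q_obj[of n] by (simp_all add: vec_obj_def vectorspace_def)

lemma comb_b_hom: "comb (X n) (b n) n \<in> lhom K (coord n) (X n)"
  by (rule comb_hom[OF X_mod b_carrier])

lemma X_hom_unique:
  assumes V: "Module.module K V" and f: "f \<in> lhom K (X n) V" "f' \<in> lhom K (X n) V"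
    and eq: "\<And>i. i < n \<Longrightarrow> f (b n i) = f' (b n i)" and w: "w \<in> carrier (X n)"
  shows "f w = f' w"
proof -
  obtain x where x: "x \<in> carrier (coord n)" "w = comb (X n) (b n) n x"
    using w b_frame[of n] by (auto simp: bij_betw_def)
  show ?thesis unfolding x(2)
  proof (rule coord_hom_unique[OF V module_hom_comp[OF comb_b_hom f(1)] module_hom_comp[OF comb_b_hom f(2)] _ x(1)])
    show "f (comb (X n) (b n) n (unitvec n i)) = f' (comb (X n) (b n) n (unitvec n i))" if "i < n" for i
      using that eq by (simp add: comb_unitvec[OF X_mod b_carrier])
  qed
qed

lemma ex_L:
  "\<exists>h. h \<in> hom (free_Abelian_group UNIV) (add_monoid (X n)) \<and>
    (\<forall>i. h (frag_of i) = (if i < n then b n i else \<zero>\<^bsub>X n\<^esub>))"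
proof -
  interpret X: Module.module K "X n" by (rule X_mod)
  have "(\<lambda>i. if i < n then b n i else \<zero>\<^bsub>X n\<^esub>) ` UNIV \<subseteq> carrier (add_monoid (X n))"
    using b_carrier[of n] by auto
  from comm_group.free_Abelian_group_universal[OF X.M.a_comm_group this] show ?thesis
    by (metis UNIV_I)
qed

text \<open>Truncation to the first \<open>n\<close> coordinates followed by the reduction of
  integers into the field; it comes from the universal property of the free abelian group.\<close>

definition L :: "nat \<Rightarrow> (nat \<Rightarrow>\<^sub>0 int) \<Rightarrow> 'v"
  where "L n = (SOME h. h \<in> hom (free_Abelian_group UNIV) (add_monoid (X n)) \<and>
    (\<forall>i. h (frag_of i) = (if i < n then b n i else \<zero>\<^bsub>X n\<^esub>)))"

lemma L_hom: "L n \<in> hom (free_Abelian_group UNIV) (add_monoid (X n))"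
  and L_frag_of: "i < n \<Longrightarrow> L n (frag_of i) = b n i"
  using someI_ex[OF ex_L[of n], folded L_def] by auto

lemma L_carrier: "L n v \<in> carrier (X n)"
  using hom_carrier[OF L_hom[of n]] by (auto simp: image_subset_iff)

lemma L_add: "L n (u + v) = L n u \<oplus>\<^bsub>X n\<^esub> L n v"
  using hom_mult[OF L_hom[of n], of u v] by simp

lemma L_0: "L n 0 = \<zero>\<^bsub>X n\<^esub>"
proof -
  interpret X: Module.module K "X n" by (rule X_mod)
  have "L n 0 \<oplus>\<^bsub>X n\<^esub> L n 0 = L n 0" using L_add[of n 0 0] by simp
  then show ?thesis using L_carrier by (simp add: X.M.add.r_cancel_one)
qed

lemma L_diff: "L n (u - v) = L n u \<ominus>\<^bsub>X n\<^esub> L n v"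
proof -
  interpret X: Module.module K "X n" by (rule X_mod)
  have "L n (u - v) \<oplus>\<^bsub>X n\<^esub> L n v = L n u" using L_add[of n "u - v" v] by simp
  then show ?thesis using L_carrier by (metis X.M.minus_eq X.M.add.inv_solve_right')
qed

text \<open>The linear map whose matrix is the upper left block of \<open>g\<close> with
  \<open>m\<close> rows and \<open>n\<close> columns, entries being multiples of the unit of
  \<open>K\<close>.\<close>

definition q :: "nat \<Rightarrow> nat \<Rightarrow> cmat \<Rightarrow> 'v \<Rightarrow> 'v"
  where "q n m g = (\<lambda>w\<in>carrier (X n). comb (X m) (\<lambda>i. L m (g i)) n
    (inv_into (carrier (coord n)) (comb (X n) (b n) n) w))"

lemma q_hom: "q n m g \<in> vec_hom K (X n) (X m)"
proof -
  have "(\<lambda>i. L m (g i)) \<in> {..<n} \<rightarrow> carrier (X m)" by (simp add: L_carrier)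
  from module_hom_comp[OF module_hom_inverse[OF coord_module comb_b_hom b_frame] comb_hom[OF X_mod this]]
  show ?thesis unfolding q_def by (rule vec_hom_restrict[OF X_vs X_vs])
qed

lemma q_lhom: "q n m g \<in> lhom K (X n) (X m)"
  using q_hom by (simp add: vec_hom_iff)

lemma q_b:
  assumes i: "i < n" shows "q n m g (b n i) = L m (g i)"
proof -
  have "inv_into (carrier (coord n)) (comb (X n) (b n) n) (comb (X n) (b n) n (unitvec n i)) = unitvec n i"
    using b_frame[of n] unitvec_carrier by (auto simp: bij_betw_def)
  moreover have "b n i \<in> carrier (X n)" using b_carrier[of n] i by auto
  ultimately show ?thesis
    using i by (simp add: q_def comb_unitvec[OF X_mod b_carrier] comb_unitvec[OF X_mod] L_carrier)
qed

lemma q_L: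
  assumes "Poly_Mapping.keys v \<subseteq> {..<n}"
  shows "q n m g (L n v) = L m (frag_extend g v)"
  using assms
proof (rule free_Abelian_group_induct)
  interpret Xn: Module.module K "X n" by (rule X_mod)
  interpret Xm: Module.module K "X m" by (rule X_mod)
  interpret q: mod_hom K "X n" "X m" "q n m g" using q_lhom by unfold_locales
  show "q n m g (L n 0) = L m (frag_extend g 0)" by (simp add: L_0)
  show "q n m g (L n (u - v)) = L m (frag_extend g (u - v))"
    if "q n m g (L n u) = L m (frag_extend g u)" "q n m g (L n v) = L m (frag_extend g v)" for u v
    using that by (simp add: L_diff frag_extend_diff L_carrier)
  show "q n m g (L n (frag_of i)) = L m (frag_extend g (frag_of i))" if "i \<in> {..<n}" for i
    using that by (simp add: L_frag_of q_b)
qed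

lemma q_cong:
  assumes "\<And>i. i < n \<Longrightarrow> g i = g' i" shows "q n m g = q n m g'"
proof
  fix w show "q n m g w = q n m g' w"
  proof (cases "w \<in> carrier (X n)")
    case True
    then show ?thesis by (rule X_hom_unique[OF X_mod q_lhom q_lhom, rotated]) (simp add: q_b assms)
  qed (simp add: q_def)
qed

lemma q_id: "q n n frag_of = restrict id (carrier (X n))"
proof
  fix w show "q n n frag_of w = restrict id (carrier (X n)) w"
  proof (cases "w \<in> carrier (X n)")
    case True
    have "(\<lambda>w. w) \<in> lhom K (X n) (X n)" by (simp add: LinearCombinations.module_hom_def)
    from X_hom_unique[OF X_mod q_lhom this _ True] show ?thesis using True by (simp add: q_b L_frag_of)
  qed (simp add: q_def)
qed

text \<open>Rows of \<open>h\<close> from \<open>m\<close> on are dropped by \<open>q n m h\<close>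
  but contribute to \<open>g \<bullet> h\<close>, whence the bound on the keys.\<close>

lemma q_comp:
  assumes "\<And>i. i < n \<Longrightarrow> Poly_Mapping.keys (h i) \<subseteq> {..<m}"
  shows "compose (carrier (X n)) (q m l g) (q n m h) = q n l (g \<bullet> h)"
proof
  fix w show "compose (carrier (X n)) (q m l g) (q n m h) w = q n l (g \<bullet> h) w"
  proof (cases "w \<in> carrier (X n)")
    case True
    have "q m l g (q n m h w) = q n l (g \<bullet> h) w"
      by (rule X_hom_unique[OF X_mod module_hom_comp[OF q_lhom q_lhom] q_lhom _ True])
        (simp add: q_b q_L assms cmul_def)
    then show ?thesis using True by (simp add: compose_eq)
  qed (simp add: q_def compose_def)
qed

definition P :: "nat \<Rightarrow> nat \<Rightarrow> cmat \<Rightarrow> 'w \<Rightarrow> 'w"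
  where "P n m g = F\<^sub>m (X n) (X m) (q n m g)"

lemma P_hom: "P n m g \<in> lhom K (Q n) (Q m)"
  using map_hom[OF X_obj X_obj q_hom] by (simp add: P_def vec_hom_iff)

lemma P_carrier: "T \<in> carrier (Q n) \<Longrightarrow> P n m g T \<in> carrier (Q m)"
  using LinearCombinations.module_hom_closed[OF P_hom] by blast

lemma P_cong: "(\<And>i. i < n \<Longrightarrow> g i = g' i) \<Longrightarrow> P n m g = P n m g'"
  using q_cong[of n g g' m] by (simp add: P_def)

lemma P_id: "T \<in> carrier (Q n) \<Longrightarrow> P n n frag_of T = T"
  using map_id[OF X_obj[of n]] by (simp add: P_def q_id)

lemma P_comp:
  assumes T: "T \<in> carrier (Q n)" and h: "\<And>i. i < n \<Longrightarrow> Poly_Mapping.keys (h i) \<subseteq> {..<m}"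
  shows "P m l g (P n m h T) = P n l (g \<bullet> h) T"
proof -
  have "P n l (g \<bullet> h) = compose (carrier (Q n)) (P m l g) (P n m h)"
    using map_comp[OF X_obj X_obj X_obj q_hom[of n m h] q_hom[of m l g]] q_comp[OF h, where l=l and g=g]
    by (simp add: P_def)
  then show ?thesis using T by (simp add: compose_eq)
qed

end

text \<open>\<open>n choose k\<close> is at least \<open>(n / k) ^ k\<close>, which as a polynomial
  in \<open>n\<close> has degree \<open>k\<close> and positive leading coefficient and so outgrows
  \<open>r\<close>.\<close>

lemma binomial_not_poly_bounded:
  fixes r :: "real poly"
  assumes "degree r < k" shows "\<exists>n. poly r (real n) < real (n choose k)"
proof -
  define s where "s = [:0, 1 / real k:] ^ k - r"
  have k: "k > 0" using assms by simp
  have deg: "degree ([:0, 1 / real k:] ^ k) = k" using k by (simp add: degree_power_eq)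
  have lc: "lead_coeff ([:0, 1 / real k:] ^ k) = (1 / real k) ^ k" using k by (simp add: lead_coeff_power)
  have s: "degree s = k" using deg assms unfolding s_def
    using degree_add_eq_left[of "- r" "[:0, 1 / real k:] ^ k"] by simp
  have "lead_coeff s = (1 / real k) ^ k"
    using lc deg assms unfolding s by (simp add: s_def coeff_eq_0)
  then have pos: "lead_coeff s > 0" using k by simp
  then obtain N where N: "\<And>x. N \<le> x \<Longrightarrow> lead_coeff s \<le> poly s x"
    using poly_pinfty_gt_lc by blast
  obtain n where n: "N \<le> real n" "k \<le> n"
    by (metis max.bounded_iff of_nat_mono order_trans real_arch_simple nat_le_linear)
  have "0 < poly s (real n)" using N[OF n(1)] pos by simp
  then have "poly r (real n) < (real n / real k) ^ k" by (simp add: s_def field_simps)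
  also have "\<dots> \<le> real (n choose k)" by (rule binomial_ge_n_over_k_pow_k[OF n(2)])
  finally show ?thesis by blast
qed

lemma (in field) ex_prime_char:
  assumes "finite (carrier R)" shows "\<exists>p::nat. prime p \<and> add_pow R p \<one> = \<zero>"
proof -
  define Z where "Z n \<longleftrightarrow> n > 0 \<and> add_pow R n \<one> = \<zero>" for n :: nat
  have "\<not> inj (\<lambda>n::nat. add_pow R n \<one>)"
  proof
    assume "inj (\<lambda>n::nat. add_pow R n \<one>)"
    moreover have "range (\<lambda>n::nat. add_pow R n \<one>) \<subseteq> carrier R" by auto
    then have "finite (range (\<lambda>n::nat. add_pow R n \<one>))" using assms by (rule finite_subset)
    ultimately have "finite (UNIV :: nat set)" by (rule finite_imageD[rotated])
    then show False by simp
  qed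
  then obtain m n :: nat where mn: "add_pow R m \<one> = add_pow R n \<one>" "m < n"
    by (metis injI linorder_neqE_nat)
  have "(add_pow R m \<one>) \<oplus> (add_pow R (n - m) \<one>) = add_pow R m \<one>"
    using mn add.nat_pow_mult[of \<one> m "n - m"] by simp
  then have "Z (n - m)" using mn(2) by (simp add: Z_def add.r_cancel_one)
  then have Zp: "Z (LEAST n. Z n)" and least: "\<And>n. Z n \<Longrightarrow> (LEAST n. Z n) \<le> n"
    by (auto intro: LeastI Least_le)
  define p where "p = (LEAST n. Z n)"
  have p: "p > 0" "add_pow R p \<one> = \<zero>" using Zp by (simp_all add: Z_def p_def)
  have "prime p"
  proof (rule ccontr)
    assume "\<not> prime p"
    moreover have "p \<noteq> 1" using p by auto
    ultimately obtain a where a: "a dvd p" "a \<noteq> 1" "a \<noteq> p"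
      using p(1) unfolding prime_nat_iff by auto
    then obtain c where ac: "p = a * c" by blast
    then have "c \<noteq> 1" "a > 0" "c > 0" using a p(1) by auto
    then have ac_less: "a < p" "c < p" using ac a(2) by auto
    have "(add_pow R a \<one>) \<otimes> (add_pow R c \<one>) = add_pow R a (add_pow R c \<one>)"
      by (simp add: add_pow_ldistr)
    also have "\<dots> = add_pow R p \<one>" using ac by (simp add: add.nat_pow_pow mult.commute)
    finally have "add_pow R a \<one> = \<zero> \<or> add_pow R c \<one> = \<zero>" using p(2) integral by simp
    then have "Z a \<or> Z c" using \<open>a > 0\<close> \<open>c > 0\<close> by (auto simp: Z_def)
    then show False using least[of a] least[of c] ac_less unfolding p_def[symmetric] by linarith
  qed
  then show ?thesis using p(2) by blast
qed

text \<open>Extracts one coefficient; applied to coordinate projections it yields linear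
  independence.\<close>

lemma hom_lincomb_single:
  assumes V: "Module.module K V" and T: "T \<in> lhom K V V" and A: "finite A" "A \<subseteq> carrier V" "v \<in> A"
    and a: "a \<in> A \<rightarrow> carrier K" and Tv: "T v = v" "\<And>u. u \<in> A \<Longrightarrow> u \<noteq> v \<Longrightarrow> T u = \<zero>\<^bsub>V\<^esub>"
  shows "T (module.lincomb V a A) = a v \<odot>\<^bsub>V\<^esub> v"
proof -
  interpret V: Module.module K V by fact
  interpret T: mod_hom K V V T using T by unfold_locales
  have sm: "a w \<odot>\<^bsub>V\<^esub> w \<in> carrier V" if "w \<in> A" for w
    using that A(2) a by (intro V.smult_closed) auto
  have "T (V.lincomb a A') = (\<Oplus>\<^bsub>V\<^esub>u\<in>A'. if v = u then a u \<odot>\<^bsub>V\<^esub> u else \<zero>\<^bsub>V\<^esub>)" if "A' \<subseteq> A" for A'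
    using finite_subset[OF that A(1)] that
  proof (induction A' rule: finite_induct)
    case empty
    then show ?case by (simp add: V.lincomb_def)
  next
    case (insert u A')
    have u: "a u \<in> carrier K" "u \<in> carrier V" using insert A(2) a by auto
    have sub: "A' \<subseteq> carrier V" "a \<in> A' \<rightarrow> carrier K" using insert A(2) a by auto
    have "V.lincomb a (insert u A') = a u \<odot>\<^bsub>V\<^esub> u \<oplus>\<^bsub>V\<^esub> V.lincomb a A'"
      unfolding V.lincomb_def using insert.hyps u sub by (intro V.M.finsum_insert) auto
    then have "T (V.lincomb a (insert u A')) = a u \<odot>\<^bsub>V\<^esub> T u \<oplus>\<^bsub>V\<^esub> T (V.lincomb a A')"
      using u V.lincomb_closed[OF sub] by simp
    also have "a u \<odot>\<^bsub>V\<^esub> T u = (if v = u then a u \<odot>\<^bsub>V\<^esub> u else \<zero>\<^bsub>V\<^esub>)"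
      using Tv insert.prems u by (auto simp: V.rmult_0)
    also have "T (V.lincomb a A') = (\<Oplus>\<^bsub>V\<^esub>u\<in>A'. if v = u then a u \<odot>\<^bsub>V\<^esub> u else \<zero>\<^bsub>V\<^esub>)"
      using insert by simp
    finally show ?case
      using insert.hyps sm insert.prems by (subst V.M.finsum_insert) auto
  qed
  from this[of A] have "T (V.lincomb a A) = (\<Oplus>\<^bsub>V\<^esub>u\<in>A. if v = u then a u \<odot>\<^bsub>V\<^esub> u else \<zero>\<^bsub>V\<^esub>)" by simp
  also have "\<dots> = a v \<odot>\<^bsub>V\<^esub> v" using A a by (intro V.M.finsum_singleton) auto
  finally show ?thesis .
qed

section \<open>The group of a generic representation\<close>

context skeleton
begin

lemma Q_finite: "finite (carrier (Q n))"
proof -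
  have "vectorspace.fin_dim K (Q n)" using Q_obj by (simp add: vec_obj_def)
  from ex_frame[OF Q_vs this] obtain d c where "bij_betw (comb (Q n) c d) (carrier (coord d)) (carrier (Q n))"
    by blast
  moreover have "finite (carrier (coord d))" using finite_field by (auto simp: coord_carrier intro: finite_PiE)
  ultimately show ?thesis by (metis bij_betw_finite)
qed

lemma ex_ev:
  "\<exists>h. h \<in> hom (free_Abelian_group (carrier (Q N))) (add_monoid (Q N)) \<and>
    (\<forall>w\<in>carrier (Q N). h (frag_of w) = w)"
proof -
  interpret Q: Module.module K "Q N" by (rule Q_mod)
  have "(\<lambda>w. w) ` carrier (Q N) \<subseteq> carrier (add_monoid (Q N))" by simp
  from comm_group.free_Abelian_group_universal[OF Q.M.a_comm_group this] show ?thesis by metis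
qed

definition ev :: "nat \<Rightarrow> ('w \<Rightarrow>\<^sub>0 int) \<Rightarrow> 'w"
  where "ev N = (SOME h. h \<in> hom (free_Abelian_group (carrier (Q N))) (add_monoid (Q N)) \<and>
    (\<forall>w\<in>carrier (Q N). h (frag_of w) = w))"

lemma ev_hom: "ev N \<in> hom (free_Abelian_group (carrier (Q N))) (add_monoid (Q N))"
  and ev_frag_of: "w \<in> carrier (Q N) \<Longrightarrow> ev N (frag_of w) = w"
  using someI_ex[OF ex_ev[of N], folded ev_def] by auto

lemma ev_carrier: "Poly_Mapping.keys z \<subseteq> carrier (Q N) \<Longrightarrow> ev N z \<in> carrier (Q N)"
  using hom_carrier[OF ev_hom[of N]] by (auto simp: image_subset_iff)

lemma ev_add: "Poly_Mapping.keys y \<subseteq> carrier (Q N) \<Longrightarrow> Poly_Mapping.keys z \<subseteq> carrier (Q N) \<Longrightarrow>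
    ev N (y + z) = ev N y \<oplus>\<^bsub>Q N\<^esub> ev N z"
  using hom_mult[OF ev_hom[of N], of y z] by simp

lemma ev_0: "ev N 0 = \<zero>\<^bsub>Q N\<^esub>"
proof -
  interpret Q: Module.module K "Q N" by (rule Q_mod)
  have "ev N 0 \<oplus>\<^bsub>Q N\<^esub> ev N 0 = ev N 0" using ev_add[of 0 N 0] by simp
  then show ?thesis using ev_carrier[of 0 N] by (simp add: Q.M.add.r_cancel_one)
qed

lemma ev_diff:
  assumes "Poly_Mapping.keys y \<subseteq> carrier (Q N)" "Poly_Mapping.keys z \<subseteq> carrier (Q N)"
  shows "ev N (y - z) = ev N y \<ominus>\<^bsub>Q N\<^esub> ev N z"
proof -
  interpret Q: Module.module K "Q N" by (rule Q_mod)
  have yz: "Poly_Mapping.keys (y - z) \<subseteq> carrier (Q N)" using keys_diff[of y z] assms by blast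
  have "ev N (y - z) \<oplus>\<^bsub>Q N\<^esub> ev N z = ev N y" using ev_add[OF yz assms(2)] by simp
  then show ?thesis using ev_carrier assms yz by (metis Q.M.minus_eq Q.M.add.inv_solve_right')
qed

text \<open>Multiplying the argument on the right gives a left action on functions.\<close>

definition pact :: "cmat \<Rightarrow> (nat \<Rightarrow> cmat \<Rightarrow> 'w \<Rightarrow>\<^sub>0 int) \<Rightarrow> nat \<Rightarrow> cmat \<Rightarrow> 'w \<Rightarrow>\<^sub>0 int"
  where "pact g f = (\<lambda>N \<phi>. f N (\<phi> \<bullet> g))"

text \<open>The direct limit of the \<open>Q n\<close> is a quotient and not a type. Its elements
  are represented by the table of all their images: \<open>f N \<phi>\<close> is a formal integer
  combination of elements of \<open>Q N\<close> whose value is the image of \<open>T\<close>. Formal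
  combinations are used because \<open>'w\<close> itself has no group structure, while these tables
  form a group pointwise. By the last clause \<open>f\<close> ignores all but the first
  \<open>n\<close> columns, which gives finite support as an equality.\<close>

definition rep :: "nat \<Rightarrow> 'w \<Rightarrow> (nat \<Rightarrow> cmat \<Rightarrow> 'w \<Rightarrow>\<^sub>0 int) \<Rightarrow> bool"
  where "rep n T f \<longleftrightarrow> T \<in> carrier (Q n) \<and>
    (\<forall>N \<phi>. Poly_Mapping.keys (f N \<phi>) \<subseteq> carrier (Q N) \<and> ev N (f N \<phi>) = P n N \<phi> T) \<and>
    (\<forall>N \<phi>. f N (\<phi> \<bullet> pr {..<n}) = f N \<phi>)"

definition GA :: "(nat \<Rightarrow> cmat \<Rightarrow> 'w \<Rightarrow>\<^sub>0 int) set"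
  where "GA = {f. \<exists>n T. rep n T f}"

definition GB :: "(nat \<Rightarrow> cmat \<Rightarrow> 'w \<Rightarrow>\<^sub>0 int) set"
  where "GB = {f. \<exists>n. rep n \<zero>\<^bsub>Q n\<^esub> f}"

lemma repD:
  assumes "rep n T f"
  shows "T \<in> carrier (Q n)" "Poly_Mapping.keys (f N \<phi>) \<subseteq> carrier (Q N)" "ev N (f N \<phi>) = P n N \<phi> T"
    "f N (\<phi> \<bullet> pr {..<n}) = f N \<phi>"
  using assms by (simp_all add: rep_def)

lemma rep_unique: "rep n T f \<Longrightarrow> rep n T' f \<Longrightarrow> T = T'"
  using repD(3)[of n T f n frag_of] repD(3)[of n T' f n frag_of] by (simp add: P_id repD(1))

lemma P_0: "P n m g \<zero>\<^bsub>Q n\<^esub> = \<zero>\<^bsub>Q m\<^esub>"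
proof -
  interpret Qn: Module.module K "Q n" by (rule Q_mod)
  interpret Qm: Module.module K "Q m" by (rule Q_mod)
  interpret mod_hom K "Q n" "Q m" "P n m g" using P_hom by unfold_locales
  show ?thesis by simp
qed

lemma rep_0: "rep n \<zero>\<^bsub>Q n\<^esub> 0"
proof -
  interpret Module.module K "Q n" by (rule Q_mod)
  show ?thesis by (simp add: rep_def ev_0 P_0)
qed

lemma rep_pact:
  assumes f: "rep n T f" and g: "\<And>i. i < n \<Longrightarrow> Poly_Mapping.keys (g i) \<subseteq> {..<m}"
  shows "rep m (P n m g T) (pact g f)"
proof -
  have "f N ((\<phi> \<bullet> pr {..<m}) \<bullet> g) = f N (\<phi> \<bullet> g)" for N \<phi>
  proof -
    have "((\<phi> \<bullet> pr {..<m}) \<bullet> g) \<bullet> pr {..<n} = (\<phi> \<bullet> g) \<bullet> pr {..<n}"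
    proof
      fix i show "(((\<phi> \<bullet> pr {..<m}) \<bullet> g) \<bullet> pr {..<n}) i = ((\<phi> \<bullet> g) \<bullet> pr {..<n}) i"
      proof (cases "i < n")
        case True
        then have "(pr {..<m} \<bullet> g) i = g i" using g[of i] by (simp add: cmul_def frag_extend_pr_id)
        then have "(\<phi> \<bullet> pr {..<m} \<bullet> g) i = (\<phi> \<bullet> g) i" by (simp add: cmul_def[of \<phi>])
        then have "((\<phi> \<bullet> pr {..<m} \<bullet> g) \<bullet> pr {..<n}) i = ((\<phi> \<bullet> g) \<bullet> pr {..<n}) i"
          by (simp only: cmul_pr)
        then show ?thesis by (simp only: cmul_assoc)
      qed (simp add: cmul_pr)
    qed
    then show ?thesis
      using repD(4)[OF f, of N "(\<phi> \<bullet> pr {..<m}) \<bullet> g"] repD(4)[OF f, of N "\<phi> \<bullet> g"] by simp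
  qed
  then show ?thesis
    using repD(1-3)[OF f] P_comp[OF repD(1)[OF f] g] by (simp add: rep_def pact_def P_carrier)
qed

lemma pact_frag_of: "pact frag_of f = f"
  by (simp add: pact_def)

lemma rep_mono: "rep n T f \<Longrightarrow> n \<le> m \<Longrightarrow> rep m (P n m frag_of T) f"
  using rep_pact[of n T f frag_of m] by (simp add: pact_frag_of)

text \<open>Evaluating the table at level \<open>n\<close> and the identity matrix recovers
  \<open>T\<close>, so vanishing does not depend on the chosen representation.\<close>

lemma GB_iff: "rep n T f \<Longrightarrow> f \<in> GB \<longleftrightarrow> T = \<zero>\<^bsub>Q n\<^esub>"
proof
  assume f: "rep n T f" and "f \<in> GB"
  then obtain m where m: "rep m \<zero>\<^bsub>Q m\<^esub> f" by (auto simp: GB_def)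
  from repD(3)[OF f, of n frag_of] repD(3)[OF m, of n frag_of] repD(1)[OF f] show "T = \<zero>\<^bsub>Q n\<^esub>"
    by (simp add: P_id P_0)
qed (auto simp: GB_def)

lemma rep_diff:
  assumes "rep n T f" "rep n T' f'" shows "rep n (T \<ominus>\<^bsub>Q n\<^esub> T') (f - f')"
proof -
  interpret Qn: Module.module K "Q n" by (rule Q_mod)
  have "P n N \<phi> (T \<ominus>\<^bsub>Q n\<^esub> T') = P n N \<phi> T \<ominus>\<^bsub>Q N\<^esub> P n N \<phi> T'" for N \<phi>
  proof -
    interpret QN: Module.module K "Q N" by (rule Q_mod)
    interpret mod_hom K "Q n" "Q N" "P n N \<phi>" using P_hom by unfold_locales
    show ?thesis using repD(1)[OF assms(1)] repD(1)[OF assms(2)] by simp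
  qed
  moreover have "Poly_Mapping.keys (f N \<phi> - f' N \<phi>) \<subseteq> carrier (Q N)" for N \<phi>
    using keys_diff[of "f N \<phi>" "f' N \<phi>"] repD(2)[OF assms(1)] repD(2)[OF assms(2)] by blast
  ultimately show ?thesis
    using repD[OF assms(1)] repD[OF assms(2)] by (simp add: rep_def ev_diff)
qed

lemma rep_add:
  assumes "rep n T f" "rep n T' f'" shows "rep n (T \<oplus>\<^bsub>Q n\<^esub> T') (f + f')"
proof -
  interpret Qn: Module.module K "Q n" by (rule Q_mod)
  have "P n N \<phi> (T \<oplus>\<^bsub>Q n\<^esub> T') = P n N \<phi> T \<oplus>\<^bsub>Q N\<^esub> P n N \<phi> T'" for N \<phi>
    using LinearCombinations.module_hom_add[OF P_hom repD(1)[OF assms(1)] repD(1)[OF assms(2)]] .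
  moreover have "Poly_Mapping.keys (f N \<phi> + f' N \<phi>) \<subseteq> carrier (Q N)" for N \<phi>
    using keys_add[of "f N \<phi>" "f' N \<phi>"] repD(2)[OF assms(1)] repD(2)[OF assms(2)] by blast
  ultimately show ?thesis
    using repD[OF assms(1)] repD[OF assms(2)] by (simp add: rep_def ev_add)
qed

lemma rep_nmul:
  assumes "rep n T f" shows "rep n ((add_pow K k \<one>\<^bsub>K\<^esub>) \<odot>\<^bsub>Q n\<^esub> T) (nmul k f)"
proof -
  interpret Qn: Module.module K "Q n" by (rule Q_mod)
  have T: "T \<in> carrier (Q n)" by (rule repD(1)[OF assms])
  show ?thesis
  proof (induction k)
    case 0
    have "(add_pow K (0::nat) \<one>\<^bsub>K\<^esub>) \<odot>\<^bsub>Q n\<^esub> T = \<zero>\<^bsub>Q n\<^esub>" using T by (simp add: Qn.lmult_0)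
    then show ?case using rep_0[of n] by (simp only: nmul_0)
  next
    case (Suc k)
    have eq: "(add_pow K (Suc k) \<one>\<^bsub>K\<^esub>) \<odot>\<^bsub>Q n\<^esub> T = T \<oplus>\<^bsub>Q n\<^esub> (add_pow K k \<one>\<^bsub>K\<^esub>) \<odot>\<^bsub>Q n\<^esub> T"
      using T by (simp add: Qn.smult_l_distr Qn.M.a_comm)
    show ?case unfolding eq nmul_Suc by (rule rep_add[OF assms Suc])
  qed
qed

lemma rep_common:
  assumes "f \<in> GA" "f' \<in> GA" obtains n T T' where "rep n T f" "rep n T' f'"
proof -
  obtain m T m' T' where "rep m T f" "rep m' T' f'" using assms by (auto simp: GA_def)
  then have "rep (max m m') (P m (max m m') frag_of T) f" "rep (max m m') (P m' (max m m') frag_of T') f'"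
    by (auto intro: rep_mono)
  then show ?thesis using that by blast
qed

lemma pact_rep:
  assumes "rep n T f" obtains m where "rep m (P n m g T) (pact g f)"
proof -
  obtain m where "(\<Union>i\<in>{..<n}. Poly_Mapping.keys (g i)) \<subseteq> {..<m}"
    using finite_nat_iff_bounded[of "\<Union>i\<in>{..<n}. Poly_Mapping.keys (g i)"] by auto
  then have "rep m (P n m g T) (pact g f)" by (intro rep_pact[OF assms]) auto
  then show ?thesis by (rule that)
qed

lemma GB_GA: "GB \<subseteq> GA"
  by (auto simp: GA_def GB_def)

lemma pact_GA: "f \<in> GA \<Longrightarrow> pact g f \<in> GA"
  using pact_rep unfolding GA_def by blast

lemma pact_GB:
  assumes "f \<in> GB" shows "pact g f \<in> GB"
proof -
  obtain n where n: "rep n \<zero>\<^bsub>Q n\<^esub> f" using assms unfolding GB_def by blast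
  obtain m where "rep m (P n m g \<zero>\<^bsub>Q n\<^esub>) (pact g f)" by (rule pact_rep[OF n])
  then have "rep m \<zero>\<^bsub>Q m\<^esub> (pact g f)" by (simp only: P_0)
  then show ?thesis unfolding GB_def by blast
qed

lemma GA_sgrp: "sgrp GA"
  unfolding sgrp_def
proof (intro conjI ballI)
  show "0 \<in> GA" using rep_0 by (auto simp: GA_def)
  fix f f' assume "f \<in> GA" "f' \<in> GA"
  then obtain n T T' where "rep n T f" "rep n T' f'" by (rule rep_common)
  from rep_diff[OF this] show "f - f' \<in> GA" by (auto simp: GA_def)
qed

lemma GB_sgrp: "sgrp GB"
  unfolding sgrp_def
proof (intro conjI ballI)
  show "0 \<in> GB" using rep_0 by (auto simp: GB_def)
  fix f f' assume f: "f \<in> GB" "f' \<in> GB"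
  then have "f \<in> GA" "f' \<in> GA" using GB_GA by auto
  then obtain n T T' where r: "rep n T f" "rep n T' f'" by (rule rep_common)
  interpret Module.module K "Q n" by (rule Q_mod)
  have "T = \<zero>\<^bsub>Q n\<^esub>" "T' = \<zero>\<^bsub>Q n\<^esub>" using f GB_iff[OF r(1)] GB_iff[OF r(2)] by auto
  then have "T \<ominus>\<^bsub>Q n\<^esub> T' = \<zero>\<^bsub>Q n\<^esub>" by (simp add: M.minus_eq)
  then show "f - f' \<in> GB" using GB_iff[OF rep_diff[OF r]] by simp
qed

definition elem :: "nat \<Rightarrow> 'w \<Rightarrow> nat \<Rightarrow> cmat \<Rightarrow> 'w \<Rightarrow>\<^sub>0 int"
  where "elem n T = (\<lambda>N \<phi>. frag_of (P n N \<phi> T))"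

lemma rep_elem:
  assumes "T \<in> carrier (Q n)" shows "rep n T (elem n T)"
proof -
  have "P n N (\<phi> \<bullet> pr {..<n}) = P n N \<phi>" for N \<phi> by (rule P_cong) (simp add: cmul_pr)
  then show ?thesis using assms by (simp add: rep_def elem_def P_carrier ev_frag_of keys_frag_of)
qed

lemma coord_iso: "vec_isomorphic K (coord n) (X n)"
  unfolding vec_isomorphic_def
proof (rule bexI)
  show "restrict (comb (X n) (b n) n) (carrier (coord n)) \<in> vec_hom K (coord n) (X n)"
    by (rule vec_hom_restrict[OF coord_vectorspace X_vs comb_b_hom])
  show "bij_betw (restrict (comb (X n) (b n) n) (carrier (coord n))) (carrier (coord n)) (carrier (X n))"
    using b_frame[of n] by (rule bij_betw_cong[THEN iffD1, rotated]) simp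
qed

text \<open>A non-zero element pure on \<open>k\<close> coordinates has a copy on each \<open>k\<close>-element subset of
  \<open>{..<n}\<close>, and these copies are linearly independent.\<close>

lemma pure_dim:
  assumes f: "f \<in> GA" "f \<notin> GB" and S: "finite S" "pact (pr S) f = f" "\<And>i. i \<in> S \<Longrightarrow> pact (kill i) f = 0"
  shows "n choose card S \<le> vectorspace.dim K (Q n)"
proof -
  interpret Q: vectorspace K "Q n" by (rule Q_vs)
  obtain m T where T: "rep m T f" using f(1) by (auto simp: GA_def)
  define \<E> where "\<E> = {E. E \<subseteq> {..<n} \<and> card E = card S}"
  have fin: "finite E" if "E \<in> \<E>" for E
    by (rule finite_subset[of _ "{..<n}"]) (use that in \<open>simp_all add: \<E>_def\<close>)
  have "\<exists>\<sigma>. bij_betw \<sigma> S E" if "E \<in> \<E>" for E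
  proof (rule finite_same_card_bij[OF S(1) fin[OF that]])
    show "card S = card E" using that by (simp add: \<E>_def)
  qed
  then have "\<forall>E\<in>\<E>. \<exists>\<sigma>. bij_betw \<sigma> S E" by (intro ballI)
  then obtain \<sigma> where "\<forall>E\<in>\<E>. bij_betw (\<sigma> E) S E" by (rule bchoice[THEN exE])
  then have \<sigma>: "\<And>E. E \<in> \<E> \<Longrightarrow> bij_betw (\<sigma> E) S E" by (rule bspec)
  \<comment> \<open>\<open>g E\<close> carries \<open>S\<close> onto \<open>E\<close> and
    \<open>h E\<close> carries it back, so the copy \<open>x E\<close> on \<open>E\<close> cannot be
    zero.\<close>
  define g :: "nat set \<Rightarrow> cmat" where "g E i = (if i \<in> S then frag_of (\<sigma> E i) else 0)" for E i
  define h :: "nat set \<Rightarrow> cmat" where "h E j = (if j \<in> E then frag_of (inv_into S (\<sigma> E) j) else 0)" for E j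
  define x where "x E = P m n (g E) T" for E
  have \<sigma>E: "\<sigma> E i \<in> E" if "E \<in> \<E>" "i \<in> S" for E i
    by (rule bij_betwE[OF \<sigma>[OF that(1)], THEN bspec, OF that(2)])
  have rx: "rep n (x E) (pact (g E) f)" if E: "E \<in> \<E>" for E
    unfolding x_def using \<sigma>E[OF E] E by (intro rep_pact[OF T]) (auto simp: g_def \<E>_def)
  have pact_cmul: "pact (g \<bullet> h) f = pact g (pact h f)" for g h f by (simp add: pact_def cmul_assoc)
  have x0: "x E \<noteq> \<zero>\<^bsub>Q n\<^esub>" if E: "E \<in> \<E>" for E
  proof
    assume "x E = \<zero>\<^bsub>Q n\<^esub>"
    then have "pact (g E) f \<in> GB" using GB_iff[OF rx[OF E]] by simp
    then have "pact (h E) (pact (g E) f) \<in> GB" by (rule pact_GB)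
    moreover have "h E \<bullet> g E = pr S"
      using \<sigma>[OF E] \<sigma>E[OF E] by (auto simp: fun_eq_iff cmul_def g_def h_def pr_def bij_betw_def)
    ultimately show False using S(2) f(2) by (simp flip: pact_cmul)
  qed
  have rp: "rep n (P n n (pr E') (x E)) (pact (pr E' \<bullet> g E) f)" if "E \<in> \<E>" "E' \<in> \<E>" for E E'
    unfolding pact_cmul using that by (intro rep_pact[OF rx]) (auto simp: pr_def)
  have same: "P n n (pr E) (x E) = x E" if E: "E \<in> \<E>" for E
  proof -
    have "pr E \<bullet> g E = g E" using \<sigma>E[OF E] by (intro pr_cmul_id) (auto simp: g_def)
    then show ?thesis using rep_unique[OF rp[OF E E]] rx[OF E] by simp
  qed
  \<comment> \<open>Projecting to another set \<open>E'\<close> of the same size loses some point of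
    \<open>E\<close>; the corresponding \<open>i\<close> in \<open>S\<close> is killed, and purity
    of \<open>f\<close> gives zero.\<close>
  have diff: "P n n (pr E') (x E) = \<zero>\<^bsub>Q n\<^esub>" if E: "E \<in> \<E>" "E' \<in> \<E>" "E \<noteq> E'" for E E'
  proof -
    have "\<not> E \<subseteq> E'"
    proof
      assume "E \<subseteq> E'"
      moreover have "card E = card E'" using E(1,2) by (simp add: \<E>_def)
      ultimately have "E = E'" by (rule card_subset_eq[OF fin[OF E(2)]])
      then show False using E(3) by simp
    qed
    then obtain e where e: "e \<in> E" "e \<notin> E'" by blast
    have "e \<in> \<sigma> E ` S" using e(1) by (simp only: bij_betw_imp_surj_on[OF \<sigma>[OF E(1)]])
    then obtain i where i: "i \<in> S" "\<sigma> E i \<notin> E'" using e(2) by blast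
    have "pr E' \<bullet> g E = (pr E' \<bullet> g E) \<bullet> kill i"
    proof
      fix j
      have "(pr E' \<bullet> g E) i = 0" using i by (simp add: cmul_def g_def pr_def)
      then show "(pr E' \<bullet> g E) j = ((pr E' \<bullet> g E) \<bullet> kill i) j" by (simp add: cmul_pr)
    qed
    then have "pact (pr E' \<bullet> g E) f = pact (pr E' \<bullet> g E) (pact (kill i) f)"
      unfolding pact_cmul[symmetric] by (rule arg_cong)
    also have "\<dots> = 0" using S(3)[OF i(1)] by (simp add: pact_def fun_eq_iff)
    finally show ?thesis using rep_unique[OF rp[OF E(1,2)]] rep_0 by simp
  qed
  have inj: "inj_on x \<E>"
  proof (rule inj_onI, rule ccontr)
    fix E E' assume E: "E \<in> \<E>" "E' \<in> \<E>" "x E = x E'" "E \<noteq> E'"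
    then show False using same[OF E(2)] diff[OF E(1,2,4)] x0[OF E(2)] by simp
  qed
  have fin\<E>: "finite \<E>" unfolding \<E>_def by (rule finite_subset[of _ "Pow {..<n}"]) auto
  have sub: "x ` \<E> \<subseteq> carrier (Q n)" using repD(1)[OF rx] by auto
  have "Q.lin_indpt (x ` \<E>)"
  proof (rule Q.finite_lin_indpt2[OF finite_imageI[OF fin\<E>] sub], rule ballI)
    fix a v assume a: "a \<in> x ` \<E> \<rightarrow> carrier K" "Q.lincomb a (x ` \<E>) = \<zero>\<^bsub>Q n\<^esub>" and v: "v \<in> x ` \<E>"
    then obtain E where E: "E \<in> \<E>" "v = x E" by blast
    have vQ: "v \<in> carrier (Q n)" using v sub by blast
    have av: "a v \<in> carrier K" using a(1) v by blast
    have "P n n (pr E) (Q.lincomb a (x ` \<E>)) = a v \<odot>\<^bsub>Q n\<^esub> v"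
    proof (rule hom_lincomb_single[OF Q_mod P_hom finite_imageI[OF fin\<E>] sub v a(1)])
      show "P n n (pr E) v = v" using same E by simp
      show "P n n (pr E) u = \<zero>\<^bsub>Q n\<^esub>" if "u \<in> x ` \<E>" "u \<noteq> v" for u using diff E that by auto
    qed
    then have av0: "a v \<odot>\<^bsub>Q n\<^esub> v = \<zero>\<^bsub>Q n\<^esub>" using a(2) P_0 by simp
    show "a v = \<zero>\<^bsub>K\<^esub>"
    proof (rule ccontr)
      assume "a v \<noteq> \<zero>\<^bsub>K\<^esub>"
      then have u: "a v \<in> Units K" using av field_Units by blast
      have "v = (inv\<^bsub>K\<^esub> (a v) \<otimes>\<^bsub>K\<^esub> a v) \<odot>\<^bsub>Q n\<^esub> v" using u vQ by simp
      also have "\<dots> = inv\<^bsub>K\<^esub> (a v) \<odot>\<^bsub>Q n\<^esub> (a v \<odot>\<^bsub>Q n\<^esub> v)" using u av vQ by (intro Q.smult_assoc1) auto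
      also have "\<dots> = \<zero>\<^bsub>Q n\<^esub>" using av0 u by (simp add: Q.rmult_0)
      finally show False using x0[OF E(1)] E(2) by simp
    qed
  qed
  then have "card (x ` \<E>) \<le> Q.dim"
    using Q_obj[of n] by (intro Q.li_le_dim(2) sub) (simp_all add: vec_obj_def)
  moreover have "card (x ` \<E>) = n choose card S"
    using card_image[OF inj] n_subsets[of "{..<n}" "card S"] by (simp add: \<E>_def)
  ultimately show ?thesis by simp
qed

lemma ex_poly_action: "\<exists>p D. poly_action pact GA GB p D"
proof -
  obtain p :: nat where p: "prime p" "add_pow K p \<one>\<^bsub>K\<^esub> = \<zero>\<^bsub>K\<^esub>" using ex_prime_char[OF finite_field] by blast
  obtain r :: "real poly" where r: "\<And>n V. vec_obj K V \<Longrightarrow> vec_isomorphic K (coord n) V \<Longrightarrow>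
      real (vectorspace.dim K (F\<^sub>o V)) \<le> poly r (real n)"
    using polynomial_growth by blast
  \<comment> \<open>A nonzero element pure on \<open>k\<close> coordinates forces
    \<open>n choose k\<close> to be at most \<open>poly r n\<close> for all \<open>n\<close>, which
    fails once \<open>k\<close> exceeds the degree of \<open>r\<close>.\<close>
  have "poly_action pact GA GB p (Suc (degree r))"
  proof
    show "pact (g \<bullet> h) f = pact g (pact h f)" for g h f by (simp add: pact_def cmul_assoc)
    show "pact g (f + f') = pact g f + pact g f'" for g f f' by (simp add: pact_def fun_eq_iff)
    show "pact frag_of f = f" for f by (rule pact_frag_of)
    show "sgrp GA" "sgrp GB" "GB \<subseteq> GA" by (rule GA_sgrp GB_sgrp GB_GA)+
    show "pact g f \<in> GA" if "f \<in> GA" for f g using that by (rule pact_GA)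
    show "pact g f \<in> GB" if "f \<in> GB" for f g using that by (rule pact_GB)
    show "prime p" by (rule p)
    show "nmul p f \<in> GB" if f: "f \<in> GA" for f
    proof -
      obtain n T where T: "rep n T f" using f by (auto simp: GA_def)
      interpret Module.module K "Q n" by (rule Q_mod)
      have "(add_pow K p \<one>\<^bsub>K\<^esub>) \<odot>\<^bsub>Q n\<^esub> T = \<zero>\<^bsub>Q n\<^esub>" using repD(1)[OF T] p(2) by (simp add: lmult_0)
      then show ?thesis using GB_iff[OF rep_nmul[OF T, of p]] by simp
    qed
    show "\<exists>n. pact (pr {..<n}) f = f" if f: "f \<in> GA" for f
    proof -
      obtain n T where "rep n T f" using f by (auto simp: GA_def)
      from repD(4)[OF this] show ?thesis by (intro exI[of _ n]) (simp add: pact_def fun_eq_iff)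
    qed
    show "\<exists>F. finite F \<and> F \<subseteq> GA \<and> (\<forall>f\<in>GA. pact (pr {..<n}) f = f \<longrightarrow> (\<exists>e\<in>F. f - e \<in> GB))" for n
    proof (intro exI conjI ballI impI)
      show "finite (elem n ` carrier (Q n))" using Q_finite by (rule finite_imageI)
      show "elem n ` carrier (Q n) \<subseteq> GA" using rep_elem by (auto simp: GA_def)
      fix f assume f: "f \<in> GA" "pact (pr {..<n}) f = f"
      then obtain m T where T: "rep m T f" by (auto simp: GA_def)
      interpret Module.module K "Q n" by (rule Q_mod)
      have T': "rep n (P m n (pr {..<n}) T) f"
        using rep_pact[OF T, of "pr {..<n}" n] f(2) by (simp add: pr_def)
      note TQ = repD(1)[OF T']
      have "P m n (pr {..<n}) T \<ominus>\<^bsub>Q n\<^esub> P m n (pr {..<n}) T = \<zero>\<^bsub>Q n\<^esub>"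
        using TQ by (simp add: M.minus_eq M.r_neg)
      then have "f - elem n (P m n (pr {..<n}) T) \<in> GB"
        using GB_iff[OF rep_diff[OF T' rep_elem[OF TQ]]] by simp
      then show "\<exists>e\<in>elem n ` carrier (Q n). f - e \<in> GB" using TQ by blast
    qed
    show "f \<in> GB" if f: "f \<in> GA" "finite S" "Suc (degree r) \<le> card S" "pact (pr S) f = f"
      "\<And>i. i \<in> S \<Longrightarrow> pact (kill i) f = 0" for f S
    proof (rule ccontr)
      assume "f \<notin> GB"
      obtain n where n: "poly r (real n) < real (n choose card S)"
        using binomial_not_poly_bounded[of r "card S"] f(3) by auto
      have "n choose card S \<le> vectorspace.dim K (Q n)"
        by (rule pure_dim[OF f(1) \<open>f \<notin> GB\<close> f(2,4,5)])
      then have "real (n choose card S) \<le> poly r (real n)"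
        using r[OF X_obj coord_iso, of n] by linarith
      then show False using n by simp
    qed
  qed
  then show ?thesis by blast
qed

lemma skeleton_wqo:
  fixes T :: "nat \<Rightarrow> 'w"
  assumes T: "\<And>i. T i \<in> carrier (Q (n i))"
  shows "\<exists>i j. i < j \<and> (\<exists>g. T i = P (n j) (n i) g (T j))"
proof -
  obtain p D where "poly_action pact GA GB p D" using ex_poly_action by blast
  then interpret poly_action pact GA GB p D .
  have "range (\<lambda>i. elem (n i) (T i)) \<subseteq> GA" using rep_elem[OF T] by (auto simp: GA_def)
  from wqo[unfolded wqo_on_def, THEN spec, THEN mp, OF this]
  obtain i j g where ij: "i < j" "pact g (elem (n j) (T j)) - elem (n i) (T i) \<in> GB"
    by (elim exE conjE bexE)
  interpret Q: Module.module K "Q (n i)" by (rule Q_mod)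
  obtain N where N: "rep N \<zero>\<^bsub>Q N\<^esub> (pact g (elem (n j) (T j)) - elem (n i) (T i))"
    using ij(2) by (simp only: GB_def mem_Collect_eq) (erule exE)
  \<comment> \<open>The difference represents zero, so its entry at level \<open>n i\<close> and the
    identity evaluates to zero. This entry involves only the rows of \<open>g\<close> below
    \<open>n i\<close>, hence a linear map into \<open>X (n i)\<close>.\<close>
  have "ev (n i) ((pact g (elem (n j) (T j)) - elem (n i) (T i)) (n i) frag_of) = \<zero>\<^bsub>Q (n i)\<^esub>"
    unfolding repD(3)[OF N] by (rule P_0)
  then have "P (n j) (n i) g (T j) \<ominus>\<^bsub>Q (n i)\<^esub> T i = \<zero>\<^bsub>Q (n i)\<^esub>"
    using T by (simp add: pact_def elem_def P_id ev_diff ev_frag_of P_carrier keys_frag_of)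
  moreover have "T i = P (n j) (n i) g (T j) \<ominus>\<^bsub>Q (n i)\<^esub> (P (n j) (n i) g (T j) \<ominus>\<^bsub>Q (n i)\<^esub> T i)"
    using T[of i] P_carrier[OF T[of j], of "n i" g]
    by (simp add: Q.M.minus_eq Q.M.minus_add Q.M.a_assoc[symmetric] Q.M.r_neg)
  ultimately have "T i = P (n j) (n i) g (T j)"
    using P_carrier[OF T[of j], of "n i" g] by (simp add: Q.M.minus_eq)
  then show ?thesis using ij(1) by blast
qed

lemma ex_skeleton_iso:
  assumes "vec_obj K V"
  shows "\<exists>n. \<exists>f\<in>vec_hom K V (X n). \<exists>f'\<in>vec_hom K (X n) V. \<forall>v\<in>carrier V. f' (f v) = v"
proof -
  have V: "vectorspace K V" "vectorspace.fin_dim K V" using assms by (simp_all add: vec_obj_def)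
  then have Vm: "Module.module K V" by (simp add: vectorspace_def)
  obtain n d where d: "d \<in> {..<n} \<rightarrow> carrier V" "bij_betw (comb V d n) (carrier (coord n)) (carrier V)"
    using ex_frame[OF V] by blast
  let ?c = "comb V d n" and ?c' = "comb (X n) (b n) n"
  have c: "?c \<in> lhom K (coord n) V" by (rule comb_hom[OF Vm d(1)])
  have ic: "inv_into (carrier (coord n)) ?c \<in> lhom K V (coord n)"
    by (rule module_hom_inverse[OF coord_module c d(2)])
  have ic': "inv_into (carrier (coord n)) ?c' \<in> lhom K (X n) (coord n)"
    by (rule module_hom_inverse[OF coord_module comb_b_hom b_frame])
  let ?f = "\<lambda>v\<in>carrier V. ?c' (inv_into (carrier (coord n)) ?c v)"
  let ?f' = "\<lambda>w\<in>carrier (X n). ?c (inv_into (carrier (coord n)) ?c' w)"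
  have f: "?f \<in> vec_hom K V (X n)" by (rule vec_hom_restrict[OF V(1) X_vs module_hom_comp[OF ic comb_b_hom]])
  have f': "?f' \<in> vec_hom K (X n) V" by (rule vec_hom_restrict[OF X_vs V(1) module_hom_comp[OF ic' c]])
  have inv: "?f' (?f v) = v" if v: "v \<in> carrier V" for v
  proof -
    have "inv_into (carrier (coord n)) ?c v \<in> carrier (coord n)" "?c (inv_into (carrier (coord n)) ?c v) = v"
      using v d(2) by (auto simp: bij_betw_def inv_into_into f_inv_into_f)
    then show ?thesis using v b_frame[of n] by (auto simp: bij_betw_def)
  qed
  show ?thesis by (rule exI, rule bexI[OF _ f], rule bexI[OF _ f'], rule ballI, rule inv)
qed

end

theorem theorem1p6p1:
  fixes K :: "('k, 'm) ring_scheme"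
    and P\<^sub>o :: "('k, 'v) module \<Rightarrow> ('k, 'w) module"
    and P\<^sub>m :: "('k, 'v) module \<Rightarrow> ('k, 'v) module \<Rightarrow> ('v \<Rightarrow> 'v) \<Rightarrow> 'w \<Rightarrow> 'w"
    and V :: "nat \<Rightarrow> ('k, 'v) module"
    and T :: "nat \<Rightarrow> 'w"
  assumes "infinite (UNIV :: 'v set)"
    and "polynomial_generic_representation K P\<^sub>o P\<^sub>m"
    and "\<And>i. vec_obj K (V i)"
    and "\<And>i. T i \<in> carrier (P\<^sub>o (V i))"
  shows "\<exists>i j. i < j \<and> (\<exists>\<phi> \<in> vec_hom K (V j) (V i). T i = P\<^sub>m (V j) (V i) \<phi> (T j))"
proof -
  interpret polynomial_generic_representation K P\<^sub>o P\<^sub>m by (rule assms(2))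
  have "\<exists>(X :: ('k, 'v) module) b. vec_obj K X \<and> b \<in> {..<n} \<rightarrow> carrier X \<and>
      bij_betw (comb X b n) (carrier (coord n)) (carrier X)" for n
  proof -
    obtain X :: "('k, 'v) module" and c where X: "vectorspace K X" "finite (carrier X)"
      "c \<in> lhom K (coord n) X" "bij_betw c (carrier (coord n)) (carrier X)"
      using ex_copy[OF finite_field assms(1)] by blast
    have Xm: "Module.module K X" using X(1) by (simp add: vectorspace_def)
    have b: "(\<lambda>i. c (unitvec n i)) \<in> {..<n} \<rightarrow> carrier X"
      using LinearCombinations.module_hom_closed[OF X(3)] unitvec_carrier by blast
    have "comb X (\<lambda>i. c (unitvec n i)) n x = c x" if "x \<in> carrier (coord n)" for x
      by (rule coord_hom_unique[OF Xm comb_hom[OF Xm b] X(3) _ that]) (simp add: comb_unitvec[OF Xm b])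
    \<comment> \<open>Taking the images of the unit vectors as frame makes \<open>comb\<close> agree
      with \<open>c\<close>, which is bijective.\<close>
    then have "bij_betw (comb X (\<lambda>i. c (unitvec n i)) n) (carrier (coord n)) (carrier X)"
      using X(4) by (subst bij_betw_cong[of _ _ c]) auto
    then show ?thesis using b X(1,2) fin_dim_if_finite by (auto simp: vec_obj_def)
  qed
  then have "\<forall>n. \<exists>(X :: ('k, 'v) module) b. vec_obj K X \<and> b \<in> {..<n} \<rightarrow> carrier X \<and>
      bij_betw (comb X b n) (carrier (coord n)) (carrier X)" by (rule allI)
  from choice[OF this] obtain X :: "nat \<Rightarrow> ('k, 'v) module" where
    "\<forall>n. \<exists>b. vec_obj K (X n) \<and> b \<in> {..<n} \<rightarrow> carrier (X n) \<and>
      bij_betw (comb (X n) b n) (carrier (coord n)) (carrier (X n))" ..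
  from choice[OF this] obtain b where Xb: "\<And>n. vec_obj K (X n)"
    "\<And>n. b n \<in> {..<n} \<rightarrow> carrier (X n)"
    "\<And>n. bij_betw (comb (X n) (b n) n) (carrier (coord n)) (carrier (X n))" by blast
  interpret skeleton K P\<^sub>o P\<^sub>m X b by unfold_locales (rule Xb)+
  have "\<forall>i. \<exists>n f f'. f \<in> vec_hom K (V i) (X n) \<and> f' \<in> vec_hom K (X n) (V i) \<and> (\<forall>v\<in>carrier (V i). f' (f v) = v)"
    using ex_skeleton_iso[OF assms(3)] by blast
  from choice[OF this] obtain n where
    "\<forall>i. \<exists>f f'. f \<in> vec_hom K (V i) (X (n i)) \<and> f' \<in> vec_hom K (X (n i)) (V i) \<and> (\<forall>v\<in>carrier (V i). f' (f v) = v)" ..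
  from choice[OF this] obtain f where
    "\<forall>i. \<exists>f'. f i \<in> vec_hom K (V i) (X (n i)) \<and> f' \<in> vec_hom K (X (n i)) (V i) \<and> (\<forall>v\<in>carrier (V i). f' (f i v) = v)" ..
  from choice[OF this] obtain f' where f: "\<And>i. f i \<in> vec_hom K (V i) (X (n i))"
    "\<And>i. f' i \<in> vec_hom K (X (n i)) (V i)" "\<And>i v. v \<in> carrier (V i) \<Longrightarrow> f' i (f i v) = v" by blast
  \<comment> \<open>The terms are moved to the skeleton along \<open>f i\<close>, which has the left
    inverse \<open>f' i\<close>.\<close>
  define T' where "T' i = P\<^sub>m (V i) (X (n i)) (f i) (T i)" for i
  have hom_carrier: "h x \<in> carrier W" if "h \<in> vec_hom K U W" "x \<in> carrier U" for h x and U W :: "('k, 'w) module"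
  proof -
    have "h \<in> lhom K U W" using that(1) by (simp add: vec_hom_iff)
    then show ?thesis using LinearCombinations.module_hom_closed that(2) by blast
  qed
  have T': "T' i \<in> carrier (Q (n i))" for i
    unfolding T'_def by (rule hom_carrier[OF map_hom[OF assms(3) X_obj f(1)] assms(4)])
  obtain i j g where ij: "i < j" "T' i = P (n j) (n i) g (T' j)" using skeleton_wqo[OF T'] by blast
  let ?q = "q (n j) (n i) g"
  define \<psi> where "\<psi> = compose (carrier (V j)) ?q (f j)"
  \<comment> \<open>The matrix map between skeleton spaces is preceded by \<open>f j\<close> and
    followed by \<open>f' i\<close>; functoriality and the left inverse then turn
    \<open>T' i\<close> back into \<open>T i\<close>.\<close>
  define \<phi> where "\<phi> = compose (carrier (V j)) (f' i) \<psi>"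
  have compose_hom: "compose (carrier U) k h \<in> vec_hom K U W"
    if "h \<in> vec_hom K U U'" "k \<in> vec_hom K U' W" for h k and U U' W :: "('k, 'v) module"
  proof -
    have "(\<lambda>x. k (h x)) \<in> lhom K U W" using that module_hom_comp by (auto simp: vec_hom_iff)
    then show ?thesis using that vec_hom_restrict[of K U W "\<lambda>x. k (h x)"] by (simp add: vec_hom_iff compose_def)
  qed
  have \<psi>: "\<psi> \<in> vec_hom K (V j) (X (n i))" unfolding \<psi>_def by (rule compose_hom[OF f(1) q_hom])
  have \<phi>: "\<phi> \<in> vec_hom K (V j) (V i)" unfolding \<phi>_def by (rule compose_hom[OF \<psi> f(2)])
  have "P\<^sub>m (V j) (X (n i)) \<psi> (T j) = T' i"
    unfolding ij(2) \<psi>_def map_comp[OF assms(3) X_obj X_obj f(1)[of j] q_hom] compose_eq[OF assms(4)]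
    by (simp add: P_def T'_def)
  then have "P\<^sub>m (V j) (V i) \<phi> (T j) = P\<^sub>m (X (n i)) (V i) (f' i) (T' i)"
    unfolding \<phi>_def map_comp[OF assms(3) X_obj assms(3) \<psi> f(2)] compose_eq[OF assms(4)] by simp
  also have "\<dots> = T i"
  proof -
    have "compose (carrier (V i)) (f' i) (f i) = restrict id (carrier (V i))"
      using f(3)[of _ i] by (auto simp: compose_def fun_eq_iff)
    then have "compose (carrier (P\<^sub>o (V i))) (P\<^sub>m (X (n i)) (V i) (f' i)) (P\<^sub>m (V i) (X (n i)) (f i))
        = restrict id (carrier (P\<^sub>o (V i)))"
      using map_comp[OF assms(3) X_obj assms(3) f(1,2)[of i]] map_id[OF assms(3)[of i]] by simp
    from fun_cong[OF this, of "T i"] show ?thesis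
      using assms(4)[of i] by (simp add: T'_def compose_eq)
  qed
  finally have "T i = P\<^sub>m (V j) (V i) \<phi> (T j)" by (rule sym)
  then show ?thesis using ij(1) \<phi> by blast
qed

end
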